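(* Let $l\in\mathbb N$, $n\in\mathbb Z$ and $j\in\{1,\dots,l-1\}$. The left module $\overline{\mathbb C[SU_{2,q}]^{(nl+j)}}$ over $C(\mathbb{WP}_{1,l,q})=\big(\bigoplus_{s=1}^l\mathcal K\big)^+$ is isomorphic to the projective module determined by the projection $$I_1\oplus\Big(\bigoplus_{s=1}^{l-j}P_{n}\oplus\bigoplus_{s=l-j+1}^{l}P_{n+1}\Big)\quad\text{if } n\ge 0,$$ $$1-\Big(\bigoplus_{s=1}^{l-j}P_{|n|}\oplus\bigoplus_{s=l-j+1}^{l}P_{|n+1|}\Big)\quad\text{if } n<0.$$
   Context: Fix $q\in(0,1)$ and $l\in\mathbb N=\{1,2,\dots\}$; $\mathbb N_0=\{0,1,2,\dots\}$. $\mathbb C[SU_{2,q}]$ is the unital complex $*$-algebra generated by $\alpha,\beta$ with relations $\beta\alpha=q\alpha\beta$, $\beta^*\alpha=q\alpha\beta^*$, $\beta\beta^*=\beta^*\beta$, $\alpha\alpha^*+\beta\beta^*=1$, $\alpha^*\alpha+q^2\beta^*\beta=1$. Let $B=\mathbb C[u,u^{-1}]$ be the Hopf $*$-algebra in which $u$ is grouplike and unitary, and let $\theta:\mathbb C[SU_{2,q}]\to\mathbb C[SU_{2,q}]\otimes B$ be the $*$-homomorphism with $\alpha\mapsto\alpha\otimes u^{-1}$, $\beta\mapsto\beta\otimes u^{l}$ (this is the case $k=1$). For $i\in\mathbb Z$ let $\mathbb C[SU_{2,q}]^{(i)}=\{t:\theta(t)=t\otimes u^i\}$; then $\mathbb C[\mathbb{WP}_{1,l,q}]:=\mathbb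 C[SU_{2,q}]^{(0)}$, which is the $*$-subalgebra generated by $\beta\beta^*$ and $\beta\alpha^l$. Let $\varpi$ be the faithful $*$-representation of $\mathbb C[SU_{2,q}]$ on $l^2(\mathbb Z)\otimes l^2(\mathbb N_0)$ given on basis vectors by $\varpi(\alpha)(e_r\otimes e_n)=\sqrt{1-q^{2(n+1)}}\,e_r\otimes e_{n+1}$ and $\varpi(\beta)(e_r\otimes e_n)=q^n e_{r+1}\otimes e_n$. Identify $l^2(\mathbb N_0)$ with $\bigoplus_{s=1}^l l^2(\mathbb N_0)$ by $e_{lp+s-1}\mapsto e^s_p$ ($p\in\mathbb N_0$, $1\le s\le l$), where $\{e^s_p\}_p$ is the basis of the $s$-th copy. For $m\in\mathbb Z$ let $\mathcal X_m$ be the closed span of the $e_{p+m}\otimes e^s_p$ ($p\ge0$, $1\le s\le l$), identified with $\bigoplus_{s=1}^l l^2(\mathbb N_0)$ by $e_{p+m}\otimes e^s_p\mapsto e^s_p$. The operators in $\varpi(\mathbb C[\mathbb{WP}_{1,l,q}])$ preserve each $\mathcal X_m$ and act on it by an operator in $\mathcal B(\bigoplus_{s=1}^l l^2(\mathbb N_0))$ independent of $m$; $C(\mathbb{WP}_{1,l,q})$ is the operator norm completion of this algebra of operators. It equals $(\bigoplus_{s=1}^l\mathcal K)^+=\bigoplus_{s=1}^l\mathcal K+\mathbb C1$, where $\mathcal K$ is the algebra of compact operators on $l^2(\mathbb N_0)$ and $+$ denotes unitization. $\overline{\mathbb C[SU_{2,q}]^{(i)}}$ denotes the operator norm completion of $\varpi(\mathbb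 C[SU_{2,q}]^{(i)})$, a left module over $C(\mathbb{WP}_{1,l,q})$ (identified with the norm closure of $\varpi(\mathbb C[\mathbb{WP}_{1,l,q}])$) under the operator product. For $r\in\mathbb N_0$, the symbol $P_r$ in the $s$-th summand of $\bigoplus_{s=1}^l\mathcal K$ is the finite rank projection onto the span of $e^s_0,\dots,e^s_{r-1}$, with $P_0=0$. Put $A=(\bigoplus_{s=1}^l\mathcal K)^+$; $I_1$ is the identity of $M_1(A)=A$. A projection $p\in M_r(A)$ determines the left projective module $A^{\oplus r}p$. Thus $I_1\oplus Q$ with $Q\in A$ lies in $M_2(A)$ and determines $(A\oplus A)(I_1\oplus Q)$, while $1-Q\in A$ determines $A(1-Q)$. *)

theory Defs
  imports "HOL-Analysis.Analysis" "HOL-Library.Poly_Mapping"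
begin

section \<open>Square-summable families and weighted shifts\<close>

typedef 'a l2 = "{f :: 'a \<Rightarrow> complex. (\<lambda>i. (cmod (f i))\<^sup>2) summable_on UNIV}"
  morphisms coord Abs_l2
  by (rule exI[of _ "\<lambda>_. 0"]) simp

setup_lifting type_definition_l2

lemma coord_summable: "(\<lambda>i. (cmod (coord x i))\<^sup>2) summable_on UNIV"
  using coord[of x] by simp

lemma l2_eqI: "(\<And>i. coord x i = coord y i) \<Longrightarrow> x = y"
  by (metis coord_inject ext)

lemma square_summable_add:
  fixes f g :: "'a \<Rightarrow> complex"
  assumes "(\<lambda>i. (cmod (f i))\<^sup>2) summable_on UNIV" "(\<lambda>i. (cmod (g i))\<^sup>2) summable_on UNIV"
  shows "(\<lambda>i. (cmod (f i + g i))\<^sup>2) summable_on UNIV"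
proof (rule summable_on_comparison_test)
  show "(\<lambda>i. 2 * (cmod (f i))\<^sup>2 + 2 * (cmod (g i))\<^sup>2) summable_on UNIV"
    by (intro summable_on_add summable_on_cmult_right assms)
  fix i
  have "(cmod (f i + g i))\<^sup>2 \<le> (cmod (f i) + cmod (g i))\<^sup>2"
    by (intro power_mono norm_triangle_ineq norm_ge_zero)
  also have "\<dots> \<le> 2 * (cmod (f i))\<^sup>2 + 2 * (cmod (g i))\<^sup>2"
    using sum_squares_bound[of "cmod (f i)" "cmod (g i)"] by (simp add: power2_sum)
  finally show "(cmod (f i + g i))\<^sup>2 \<le> 2 * (cmod (f i))\<^sup>2 + 2 * (cmod (g i))\<^sup>2" .
qed simp

lemma inner_coord_summable: "(\<lambda>i. coord x i \<bullet> coord y i) summable_on UNIV"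
proof -
  have "(\<lambda>i. norm (coord x i \<bullet> coord y i)) summable_on UNIV"
  proof (rule summable_on_comparison_test)
    show "(\<lambda>i. (cmod (coord x i))\<^sup>2 + (cmod (coord y i))\<^sup>2) summable_on UNIV"
      by (intro summable_on_add coord_summable)
    fix i
    have "norm (coord x i \<bullet> coord y i) \<le> cmod (coord x i) * cmod (coord y i)"
      by (simp add: Cauchy_Schwarz_ineq2)
    also have "\<dots> \<le> (cmod (coord x i))\<^sup>2 + (cmod (coord y i))\<^sup>2"
      using sum_squares_bound[of "cmod (coord x i)" "cmod (coord y i)"]
        mult_nonneg_nonneg[OF norm_ge_zero[of "coord x i"] norm_ge_zero[of "coord y i"]] by linarith
    finally show "norm (coord x i \<bullet> coord y i) \<le> (cmod (coord x i))\<^sup>2 + (cmod (coord y i))\<^sup>2" .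
  qed simp
  then show ?thesis
    by (rule abs_summable_summable)
qed

instantiation l2 :: (type) real_vector
begin

lift_definition zero_l2 :: "'a l2" is "\<lambda>_. 0" by simp
lift_definition plus_l2 :: "'a l2 \<Rightarrow> 'a l2 \<Rightarrow> 'a l2" is "\<lambda>f g i. f i + g i"
  by (rule square_summable_add)
lift_definition uminus_l2 :: "'a l2 \<Rightarrow> 'a l2" is "\<lambda>f i. - f i" by simp
lift_definition minus_l2 :: "'a l2 \<Rightarrow> 'a l2 \<Rightarrow> 'a l2" is "\<lambda>f g i. f i - g i"
  subgoal for f g using square_summable_add[of f "\<lambda>i. - g i"] by simp
  done
lift_definition scaleR_l2 :: "real \<Rightarrow> 'a l2 \<Rightarrow> 'a l2" is "\<lambda>r f i. r *\<^sub>R f i"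
  by (simp add: power_mult_distrib summable_on_cmult_right)

instance
  by standard (transfer; simp add: algebra_simps)+

end

text \<open>Only the real part of the Hermitian inner product is recorded; it has the same norm, and
  for complex linear operators the same adjoint, as the Hermitian one.\<close>

instantiation l2 :: (type) real_inner
begin

definition inner_l2 :: "'a l2 \<Rightarrow> 'a l2 \<Rightarrow> real" where
  "inner_l2 x y = (\<Sum>\<^sub>\<infinity>i. coord x i \<bullet> coord y i)"
definition norm_l2 :: "'a l2 \<Rightarrow> real" where "norm_l2 x = sqrt (x \<bullet> x)"
definition sgn_l2 :: "'a l2 \<Rightarrow> 'a l2" where "sgn_l2 x = x /\<^sub>R norm x"
definition dist_l2 :: "'a l2 \<Rightarrow> 'a l2 \<Rightarrow> real" where "dist_l2 x y = norm (x - y)"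
definition uniformity_l2 :: "('a l2 \<times> 'a l2) filter" where
  "uniformity_l2 = (INF e\<in>{0 <..}. principal {(x, y). dist x y < e})"
definition open_l2 :: "'a l2 set \<Rightarrow> bool" where
  "open_l2 S = (\<forall>x\<in>S. \<forall>\<^sub>F (x', y) in uniformity. x' = x \<longrightarrow> y \<in> S)"

instance
proof
  fix x y z :: "'a l2" and r :: real
  show "x \<bullet> y = y \<bullet> x"
    by (simp add: inner_l2_def inner_commute)
  show "(x + y) \<bullet> z = x \<bullet> z + y \<bullet> z"
    by (simp add: inner_l2_def plus_l2.rep_eq inner_add_left infsum_add inner_coord_summable)
  show "r *\<^sub>R x \<bullet> y = r * (x \<bullet> y)"
    by (simp add: inner_l2_def scaleR_l2.rep_eq infsum_cmult_right inner_coord_summable)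
  show "0 \<le> x \<bullet> x"
    by (simp add: inner_l2_def infsum_nonneg)
  show "(x \<bullet> x = 0) = (x = 0)"
  proof
    assume "x \<bullet> x = 0"
    then have "coord x i \<bullet> coord x i = 0" for i
      by (intro nonneg_infsum_le_0D[where A = UNIV and f = "\<lambda>i. coord x i \<bullet> coord x i"])
        (auto simp: inner_l2_def inner_coord_summable)
    then show "x = 0"
      by (intro l2_eqI) (simp add: zero_l2.rep_eq)
  next
    assume "x = 0"
    then show "x \<bullet> x = 0" by (simp add: inner_l2_def zero_l2.rep_eq)
  qed
qed (fact norm_l2_def sgn_l2_def dist_l2_def uniformity_l2_def open_l2_def)+

end

lemma norm_l2_power2: "(norm x)\<^sup>2 = (\<Sum>\<^sub>\<infinity>i. (cmod (coord x i))\<^sup>2)"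
  unfolding power2_norm_eq_inner inner_l2_def ..

lift_definition ket :: "'a \<Rightarrow> 'a l2" is "\<lambda>a i. if i = a then 1 else 0"
proof -
  fix a :: 'a
  show "(\<lambda>i. (cmod (if i = a then 1 else 0))\<^sup>2) summable_on UNIV"
    by (rule finite_nonzero_values_imp_summable_on) (rule finite_subset[of _ "{a}"], auto)
qed

lift_definition scaleC :: "complex \<Rightarrow> 'a l2 \<Rightarrow> 'a l2" is "\<lambda>c f i. c * f i"
  by (simp add: norm_mult power_mult_distrib summable_on_cmult_right)

text \<open>The bounded operator with \<open>ket a \<mapsto> w a \<cdot> ket (f a)\<close>, for injective \<open>f\<close> and bounded \<open>w\<close>; the
  inner sum has at most one term.\<close>

definition weighted_shift :: "('a \<Rightarrow> complex) \<Rightarrow> ('a \<Rightarrow> 'b) \<Rightarrow> 'a l2 \<Rightarrow>\<^sub>L 'b l2" where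
  "weighted_shift w f = Blinfun (\<lambda>x. Abs_l2 (\<lambda>b. \<Sum>a | f a = b. w a * coord x a))"

lemma fiber_sum:
  fixes h :: "'a \<Rightarrow> 'c::comm_monoid_add"
  assumes "inj f"
  shows "(\<Sum>a | f a = f a'. h a) = h a'"
proof -
  have "{a. f a = f a'} = {a'}" using assms by (auto dest: injD)
  then show ?thesis by simp
qed

lemma fiber_sum_out: "b \<notin> range f \<Longrightarrow> (\<Sum>a | f a = b. h a) = 0"
  by (rule sum.neutral) auto

lemma weighted_shift_aux:
  assumes inj: "inj f" and bdd: "\<And>a. cmod (w a) \<le> C"
  shows "(\<lambda>b. (cmod (\<Sum>a | f a = b. w a * coord x a))\<^sup>2) summable_on UNIV"
    and "(\<Sum>\<^sub>\<infinity>b. (cmod (\<Sum>a | f a = b. w a * coord x a))\<^sup>2) \<le> (C * norm x)\<^sup>2"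
proof -
  let ?F = "\<lambda>b. (cmod (\<Sum>a | f a = b. w a * coord x a))\<^sup>2"
  have Ff: "(?F \<circ> f) = (\<lambda>a. (cmod (w a * coord x a))\<^sup>2)"
    by (auto simp: fun_eq_iff fiber_sum[OF inj])
  have le: "(cmod (w a * coord x a))\<^sup>2 \<le> C\<^sup>2 * (cmod (coord x a))\<^sup>2" for a
    using power_mono[OF bdd[of a] norm_ge_zero, of 2]
    by (simp add: norm_mult power_mult_distrib mult_right_mono)
  have sC: "(\<lambda>a. C\<^sup>2 * (cmod (coord x a))\<^sup>2) summable_on UNIV"
    by (intro summable_on_cmult_right coord_summable)
  have s1: "(?F \<circ> f) summable_on UNIV"
    unfolding Ff by (rule summable_on_comparison_test[OF sC le]) simp
  then have s2: "?F summable_on range f"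
    by (simp add: summable_on_reindex[OF inj])
  show "?F summable_on UNIV"
    by (rule summable_on_cong_neutral[THEN iffD1, OF _ _ _ s2]) (auto simp: fiber_sum_out)
  have "(\<Sum>\<^sub>\<infinity>b. ?F b) = (\<Sum>\<^sub>\<infinity>b\<in>range f. ?F b)"
    by (rule infsum_cong_neutral) (auto simp: fiber_sum_out)
  also have "\<dots> = (\<Sum>\<^sub>\<infinity>a. (cmod (w a * coord x a))\<^sup>2)"
    by (simp add: infsum_reindex[OF inj] Ff)
  also have "\<dots> \<le> (\<Sum>\<^sub>\<infinity>a. C\<^sup>2 * (cmod (coord x a))\<^sup>2)"
    using s1 by (intro infsum_mono le sC) (simp add: Ff)
  also have "\<dots> = (C * norm x)\<^sup>2"
    by (simp add: infsum_cmult_right coord_summable norm_l2_power2 power_mult_distrib)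
  finally show "(\<Sum>\<^sub>\<infinity>b. ?F b) \<le> (C * norm x)\<^sup>2" .
qed

lemma coord_weighted_shift:
  assumes "inj f" and "\<And>a. cmod (w a) \<le> C"
  shows "coord (weighted_shift w f x) b = (\<Sum>a | f a = b. w a * coord x a)"
proof -
  define T where "T = (\<lambda>x. Abs_l2 (\<lambda>b. \<Sum>a | f a = b. w a * coord x a))"
  have c: "coord (T x) = (\<lambda>b. \<Sum>a | f a = b. w a * coord x a)" for x
    unfolding T_def by (intro Abs_l2_inverse CollectI weighted_shift_aux(1)[OF assms])
  have "0 \<le> C" using assms(2) norm_ge_zero order_trans by blast
  have "bounded_linear T"
  proof (rule bounded_linear_intro[where K = C])
    show "T (x + y) = T x + T y" for x y
      by (intro l2_eqI) (simp add: c plus_l2.rep_eq distrib_left sum.distrib)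
    show "T (r *\<^sub>R x) = r *\<^sub>R T x" for r x
      by (intro l2_eqI) (simp add: c scaleR_l2.rep_eq scaleR_sum_right)
    show "norm (T x) \<le> norm x * C" for x
    proof (rule power2_le_imp_le)
      show "(norm (T x))\<^sup>2 \<le> (norm x * C)\<^sup>2"
        unfolding norm_l2_power2[of "T x"] c mult.commute[of "norm x"]
          by (rule weighted_shift_aux(2)[OF assms])
    qed (use \<open>0 \<le> C\<close> in simp)
  qed
  then show ?thesis
    unfolding weighted_shift_def T_def[symmetric] by (simp add: bounded_linear_Blinfun_apply c)
qed

lemma weighted_shift_ket:
  assumes "inj f" and "\<And>a. cmod (w a) \<le> C"
  shows "weighted_shift w f (ket a) = scaleC (w a) (ket (f a))"
proof (rule l2_eqI)
  fix b
  show "coord (weighted_shift w f (ket a)) b = coord (scaleC (w a) (ket (f a))) b"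
  proof (cases "b \<in> range f")
    case True
    then show ?thesis
      using assms(1) by (auto simp: coord_weighted_shift[OF assms] fiber_sum ket.rep_eq scaleC.rep_eq dest: injD)
  next
    case False
    then show ?thesis
      by (auto simp: coord_weighted_shift[OF assms] fiber_sum_out ket.rep_eq scaleC.rep_eq)
  qed
qed

definition op_adjoint :: "('a l2 \<Rightarrow>\<^sub>L 'b l2) \<Rightarrow> 'b l2 \<Rightarrow>\<^sub>L 'a l2" where
  "op_adjoint T = Blinfun (adjoint (blinfun_apply T))"

definition scal_op :: "complex \<Rightarrow> 'a l2 \<Rightarrow>\<^sub>L 'a l2" where
  "scal_op c = weighted_shift (\<lambda>_. c) (\<lambda>a. a)"

lemma scal_op_apply: "scal_op c x = scaleC c x"
  by (rule l2_eqI) (simp add: scal_op_def coord_weighted_shift[where C = "cmod c"] scaleC.rep_eq)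

lemma op_adjoint_weighted_shift:
  assumes inj: "inj f" and bdd: "\<And>a. cmod (w a) \<le> C"
  shows "coord (op_adjoint (weighted_shift w f) y) a = cnj (w a) * coord y (f a)"
    and "weighted_shift w f x \<bullet> y = x \<bullet> op_adjoint (weighted_shift w f) y"
proof -
  define S where "S = (\<lambda>y. Abs_l2 (\<lambda>a. cnj (w a) * coord y (f a)))"
  have "0 \<le> C" using bdd norm_ge_zero order_trans by blast
  have le: "(cmod (cnj (w a) * coord y (f a)))\<^sup>2 \<le> C\<^sup>2 * (cmod (coord y (f a)))\<^sup>2" for a y
    using power_mono[OF bdd[of a] norm_ge_zero, of 2]
    by (simp add: norm_mult power_mult_distrib mult_right_mono)
  have sr: "(\<lambda>b. (cmod (coord y b))\<^sup>2) summable_on range f" for y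
    by (rule summable_on_subset[OF coord_summable]) simp
  then have sf: "(\<lambda>a. C\<^sup>2 * (cmod (coord y (f a)))\<^sup>2) summable_on UNIV" for y
    using summable_on_reindex[OF inj, of "\<lambda>b. (cmod (coord y b))\<^sup>2"]
    by (intro summable_on_cmult_right) (simp add: o_def)
  have ss: "(\<lambda>a. (cmod (cnj (w a) * coord y (f a)))\<^sup>2) summable_on UNIV" for y
    by (rule summable_on_comparison_test[OF sf le]) simp
  have c: "coord (S y) = (\<lambda>a. cnj (w a) * coord y (f a))" for y
    unfolding S_def using ss by (intro Abs_l2_inverse) simp
  have "bounded_linear S"
  proof (rule bounded_linear_intro[where K = C])
    show "S (x + y) = S x + S y" for x y
      by (intro l2_eqI) (simp add: c plus_l2.rep_eq distrib_left)
    show "S (r *\<^sub>R x) = r *\<^sub>R S x" for r x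
      by (intro l2_eqI) (simp add: c scaleR_l2.rep_eq)
    show "norm (S y) \<le> norm y * C" for y
    proof (rule power2_le_imp_le)
      have "(norm (S y))\<^sup>2 \<le> (\<Sum>\<^sub>\<infinity>a. C\<^sup>2 * (cmod (coord y (f a)))\<^sup>2)"
        unfolding norm_l2_power2 c by (intro infsum_mono le ss sf)
      also have "\<dots> = C\<^sup>2 * (\<Sum>\<^sub>\<infinity>b\<in>range f. (cmod (coord y b))\<^sup>2)"
        by (simp only: infsum_cmult_right' infsum_reindex[OF inj] o_def)
      also have "\<dots> \<le> C\<^sup>2 * (norm y)\<^sup>2"
        unfolding norm_l2_power2
        by (intro mult_left_mono infsum_mono_neutral sr coord_summable) auto
      finally show "(norm (S y))\<^sup>2 \<le> (norm y * C)\<^sup>2"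
        by (simp add: power_mult_distrib mult.commute)
    qed (use \<open>0 \<le> C\<close> in simp)
  qed
  moreover have adj: "weighted_shift w f x \<bullet> y = x \<bullet> S y" for x y
  proof -
    have "weighted_shift w f x \<bullet> y = (\<Sum>\<^sub>\<infinity>b\<in>range f. coord (weighted_shift w f x) b \<bullet> coord y b)"
      unfolding inner_l2_def
      by (rule infsum_cong_neutral) (auto simp: coord_weighted_shift[OF assms] fiber_sum_out)
    also have "\<dots> = (\<Sum>\<^sub>\<infinity>a. (w a * coord x a) \<bullet> coord y (f a))"
      by (simp add: infsum_reindex[OF inj] o_def coord_weighted_shift[OF assms] fiber_sum[OF inj])
    also have "\<dots> = x \<bullet> S y"
      unfolding inner_l2_def c
      by (rule infsum_cong) (simp add: inner_complex_def algebra_simps)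
    finally show ?thesis .
  qed
  ultimately have "blinfun_apply (op_adjoint (weighted_shift w f)) = S"
    unfolding op_adjoint_def by (subst adjoint_unique[of _ S]) (auto simp: bounded_linear_Blinfun_apply)
  then show "coord (op_adjoint (weighted_shift w f) y) a = cnj (w a) * coord y (f a)"
    and "weighted_shift w f x \<bullet> y = x \<bullet> op_adjoint (weighted_shift w f) y"
    by (simp_all add: c adj)
qed

section \<open>The algebra \<open>\<complex>[SU\<^bsub>2,q\<^esub>]\<close> and its grading\<close>

datatype suq_gen = Alpha | AlphaStar | Beta | BetaStar

datatype suq_word = Word (letters: "suq_gen list")

instantiation suq_word :: monoid_add
begin

definition zero_suq_word :: suq_word where "0 = Word []"
definition plus_suq_word :: "suq_word \<Rightarrow> suq_word \<Rightarrow> suq_word" where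
  "v + w = Word (letters v @ letters w)"

instance
  by standard (simp_all add: zero_suq_word_def plus_suq_word_def)

end

text \<open>The monoid of words is written additively, so that convolution of finitely supported
  functions makes \<open>free_suq\<close> the free unital complex algebra on the four letters.\<close>

type_synonym free_suq = "suq_word \<Rightarrow>\<^sub>0 complex"

definition gen :: "suq_gen \<Rightarrow> free_suq" where
  "gen x = Poly_Mapping.single (Word [x]) 1"

definition cst :: "complex \<Rightarrow> free_suq" where
  "cst c = Poly_Mapping.single 0 c"

fun gen_star :: "suq_gen \<Rightarrow> suq_gen" where
  "gen_star Alpha = AlphaStar"
| "gen_star AlphaStar = Alpha"
| "gen_star Beta = BetaStar"
| "gen_star BetaStar = Beta"

definition word_star :: "suq_word \<Rightarrow> suq_word" where
  "word_star w = Word (rev (map gen_star (letters w)))"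

definition free_star :: "free_suq \<Rightarrow> free_suq" where
  "free_star t = (\<Sum>w\<in>Poly_Mapping.keys t.
     Poly_Mapping.single (word_star w) (cnj (Poly_Mapping.lookup t w)))"

definition suq_relators :: "real \<Rightarrow> free_suq set" where
  "suq_relators q =
    {gen Beta * gen Alpha - cst (of_real q) * gen Alpha * gen Beta,
     gen BetaStar * gen Alpha - cst (of_real q) * gen Alpha * gen BetaStar,
     gen Beta * gen BetaStar - gen BetaStar * gen Beta,
     gen Alpha * gen AlphaStar + gen Beta * gen BetaStar - 1,
     gen AlphaStar * gen Alpha + cst (of_real (q\<^sup>2)) * gen BetaStar * gen Beta - 1}"

inductive_set suq_ideal :: "real \<Rightarrow> free_suq set" for q where
  relator: "t \<in> suq_relators q \<Longrightarrow> t \<in> suq_ideal q"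
| zero: "0 \<in> suq_ideal q"
| add: "s \<in> suq_ideal q \<Longrightarrow> t \<in> suq_ideal q \<Longrightarrow> s + t \<in> suq_ideal q"
| left: "t \<in> suq_ideal q \<Longrightarrow> a * t \<in> suq_ideal q"
| right: "t \<in> suq_ideal q \<Longrightarrow> t * a \<in> suq_ideal q"
| star: "t \<in> suq_ideal q \<Longrightarrow> free_star t \<in> suq_ideal q"

definition suq_rel :: "real \<Rightarrow> (free_suq \<times> free_suq) set" where
  "suq_rel q = {(s, t). s - t \<in> suq_ideal q}"

definition suq_class :: "real \<Rightarrow> free_suq \<Rightarrow> free_suq set" where
  "suq_class q t = suq_rel q `` {t}"

definition suq :: "real \<Rightarrow> free_suq set set" where
  "suq q = UNIV // suq_rel q"

text \<open>\<open>A \<otimes> \<complex>[u, u\<^sup>-\<^sup>1]\<close> is the algebra of Laurent polynomials with coefficients in \<open>A\<close>, that is, the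
  convolution algebra of finitely supported functions \<open>int \<Rightarrow> A\<close>; \<open>Poly_Mapping.single i t\<close> is
  \<open>t \<otimes> u\<^sup>i\<close>.  \<open>free_theta\<close> is the lift of the coaction to the free algebra (its values on the starred letters
  are forced by \<open>u\<^sup>* = u\<^sup>-\<^sup>1\<close>), and \<open>suq_theta\<close> the coaction on classes, whose values are given by their
  coefficients in \<open>suq q\<close>.\<close>

fun theta_gen :: "nat \<Rightarrow> suq_gen \<Rightarrow> int \<Rightarrow>\<^sub>0 free_suq" where
  "theta_gen l Alpha = Poly_Mapping.single (- 1) (gen Alpha)"
| "theta_gen l AlphaStar = Poly_Mapping.single 1 (gen AlphaStar)"
| "theta_gen l Beta = Poly_Mapping.single (int l) (gen Beta)"
| "theta_gen l BetaStar = Poly_Mapping.single (- int l) (gen BetaStar)"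

definition free_theta :: "nat \<Rightarrow> free_suq \<Rightarrow> int \<Rightarrow>\<^sub>0 free_suq" where
  "free_theta l t = (\<Sum>w\<in>Poly_Mapping.keys t.
     Poly_Mapping.single 0 (cst (Poly_Mapping.lookup t w)) * prod_list (map (theta_gen l) (letters w)))"

definition suq_theta :: "real \<Rightarrow> nat \<Rightarrow> free_suq set \<Rightarrow> int \<Rightarrow> free_suq set" where
  "suq_theta q l X = (\<lambda>k. \<Union>t\<in>X. suq_class q (Poly_Mapping.lookup (free_theta l t) k))"

definition tensor_u :: "real \<Rightarrow> free_suq set \<Rightarrow> int \<Rightarrow> int \<Rightarrow> free_suq set" where
  "tensor_u q X i = (\<lambda>k. if k = i then X else suq_class q 0)"

definition suq_degree :: "real \<Rightarrow> nat \<Rightarrow> int \<Rightarrow> free_suq set set" where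
  "suq_degree q l i = {X \<in> suq q. suq_theta q l X = tensor_u q X i}"

section \<open>The representation on \<open>l\<^sup>2(\<int>) \<otimes> l\<^sup>2(\<nat>)\<close>\<close>

definition rep_alpha :: "real \<Rightarrow> (int \<times> nat) l2 \<Rightarrow>\<^sub>L (int \<times> nat) l2" where
  "rep_alpha q = weighted_shift (\<lambda>(r, n). of_real (sqrt (1 - q ^ (2 * (n + 1))))) (\<lambda>(r, n). (r, n + 1))"

definition rep_beta :: "real \<Rightarrow> (int \<times> nat) l2 \<Rightarrow>\<^sub>L (int \<times> nat) l2" where
  "rep_beta q = weighted_shift (\<lambda>(r, n). of_real (q ^ n)) (\<lambda>(r, n). (r + 1, n))"

fun rep_gen :: "real \<Rightarrow> suq_gen \<Rightarrow> (int \<times> nat) l2 \<Rightarrow>\<^sub>L (int \<times> nat) l2" where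
  "rep_gen q Alpha = rep_alpha q"
| "rep_gen q AlphaStar = op_adjoint (rep_alpha q)"
| "rep_gen q Beta = rep_beta q"
| "rep_gen q BetaStar = op_adjoint (rep_beta q)"

definition rep_word :: "real \<Rightarrow> suq_word \<Rightarrow> (int \<times> nat) l2 \<Rightarrow>\<^sub>L (int \<times> nat) l2" where
  "rep_word q w = foldr (\<lambda>x T. rep_gen q x o\<^sub>L T) (letters w) id_blinfun"

definition free_rep :: "real \<Rightarrow> free_suq \<Rightarrow> (int \<times> nat) l2 \<Rightarrow>\<^sub>L (int \<times> nat) l2" where
  "free_rep q t = (\<Sum>w\<in>Poly_Mapping.keys t. scal_op (Poly_Mapping.lookup t w) o\<^sub>L rep_word q w)"

definition suq_rep :: "real \<Rightarrow> free_suq set \<Rightarrow> (int \<times> nat) l2 \<Rightarrow>\<^sub>L (int \<times> nat) l2" where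
  "suq_rep q X = the_elem (free_rep q ` X)"

text \<open>\<open>l2\<close> is complete, hence so are the spaces of bounded operators, and norm completions of
  spaces of operators are norm closures.\<close>

definition suq_degree_closure :: "real \<Rightarrow> nat \<Rightarrow> int \<Rightarrow> ((int \<times> nat) l2 \<Rightarrow>\<^sub>L (int \<times> nat) l2) set" where
  "suq_degree_closure q l i = closure (suq_rep q ` suq_degree q l i)"

section \<open>The quantum weighted projective line\<close>

text \<open>The sum of \<open>l\<close> copies of \<open>l\<^sup>2(\<nat>)\<close> is \<open>nat l2\<close>, with \<open>ket (l * p + s - 1)\<close> the \<open>p\<close>-th basis
  vector of the \<open>s\<close>-th copy; \<open>block_embed l m\<close> is the resulting unitary from \<open>nat l2\<close> onto the
  subspace \<open>X\<^sub>m\<close> of \<open>l\<^sup>2(\<int>) \<otimes> l\<^sup>2(\<nat>)\<close>.\<close>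

definition block_embed :: "nat \<Rightarrow> int \<Rightarrow> nat l2 \<Rightarrow>\<^sub>L (int \<times> nat) l2" where
  "block_embed l m = weighted_shift (\<lambda>_. 1) (\<lambda>k. (int (k div l) + m, k))"

definition block :: "nat \<Rightarrow> int \<Rightarrow> ((int \<times> nat) l2 \<Rightarrow>\<^sub>L (int \<times> nat) l2) \<Rightarrow> nat l2 \<Rightarrow>\<^sub>L nat l2" where
  "block l m T = op_adjoint (block_embed l m) o\<^sub>L T o\<^sub>L block_embed l m"

definition CWP :: "real \<Rightarrow> nat \<Rightarrow> (nat l2 \<Rightarrow>\<^sub>L nat l2) set" where
  "CWP q l = closure ((\<lambda>X. block l 0 (suq_rep q X)) ` suq_degree q l 0)"

text \<open>Elements of \<open>\<Rightarrow>\<^sub>L\<close> are only real linear, so complex linearity is required separately.\<close>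

definition compact_ops :: "('a l2 \<Rightarrow>\<^sub>L 'a l2) set" where
  "compact_ops = {T. (\<forall>c x. blinfun_apply T (scaleC c x) = scaleC c (blinfun_apply T x)) \<and>
     compact (closure (blinfun_apply T ` cball 0 1))}"

definition copy_embed :: "nat \<Rightarrow> nat \<Rightarrow> nat l2 \<Rightarrow>\<^sub>L nat l2" where
  "copy_embed l s = weighted_shift (\<lambda>_. 1) (\<lambda>p. l * p + s - 1)"

definition direct_sum :: "nat \<Rightarrow> (nat \<Rightarrow> nat l2 \<Rightarrow>\<^sub>L nat l2) \<Rightarrow> nat l2 \<Rightarrow>\<^sub>L nat l2" where
  "direct_sum l K = (\<Sum>s = 1..l. copy_embed l s o\<^sub>L K s o\<^sub>L op_adjoint (copy_embed l s))"

definition compact_sum_unitization :: "nat \<Rightarrow> (nat l2 \<Rightarrow>\<^sub>L nat l2) set" where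
  "compact_sum_unitization l =
    {direct_sum l K + scal_op c | K c. \<forall>s\<in>{1..l}. K s \<in> compact_ops}"

section \<open>Projective modules\<close>

definition rank_proj :: "nat \<Rightarrow> nat l2 \<Rightarrow>\<^sub>L nat l2" where
  "rank_proj r = weighted_shift (\<lambda>k. if k < r then 1 else 0) (\<lambda>k. k)"

definition diag_matrix :: "(nat l2 \<Rightarrow>\<^sub>L nat l2) list \<Rightarrow> nat \<Rightarrow> nat \<Rightarrow> nat l2 \<Rightarrow>\<^sub>L nat l2" where
  "diag_matrix ps = (\<lambda>i j. if i = j \<and> i < length ps then ps ! i else 0)"

text \<open>\<open>proj_module A r p\<close> is \<open>A\<^sup>r p\<close>; a row of length \<open>r\<close> is a function vanishing outside \<open>{..<r}\<close>.\<close>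

definition proj_module ::
  "(nat l2 \<Rightarrow>\<^sub>L nat l2) set \<Rightarrow> nat \<Rightarrow> (nat \<Rightarrow> nat \<Rightarrow> nat l2 \<Rightarrow>\<^sub>L nat l2) \<Rightarrow> (nat \<Rightarrow> nat l2 \<Rightarrow>\<^sub>L nat l2) set" where
  "proj_module A r p = {(\<lambda>j. if j < r then \<Sum>i<r. v i o\<^sub>L p i j else 0) | v. \<forall>i<r. v i \<in> A}"

text \<open>Isomorphism of left modules over \<open>C(\<W>\<P>\<^bsub>1,l,q\<^esub>)\<close>.  A scalar is given by an operator \<open>b\<close> in the closure
  of the image of the degree zero part: it multiplies operators on \<open>l\<^sup>2(\<int>) \<otimes> l\<^sup>2(\<nat>)\<close> as \<open>b\<close> and rows over
  \<open>CWP q l\<close> as the corresponding operator \<open>block l 0 b\<close>.\<close>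

definition module_isomorphic ::
  "real \<Rightarrow> nat \<Rightarrow> ((int \<times> nat) l2 \<Rightarrow>\<^sub>L (int \<times> nat) l2) set \<Rightarrow> (nat \<Rightarrow> nat l2 \<Rightarrow>\<^sub>L nat l2) set \<Rightarrow> bool" where
  "module_isomorphic q l M N \<longleftrightarrow> (\<exists>\<phi>. bij_betw \<phi> M N \<and>
    (\<forall>x\<in>M. \<forall>y\<in>M. \<phi> (x + y) = (\<lambda>i. \<phi> x i + \<phi> y i)) \<and>
    (\<forall>b\<in>suq_degree_closure q l 0. \<forall>x\<in>M. \<phi> (b o\<^sub>L x) = (\<lambda>i. block l 0 b o\<^sub>L \<phi> x i)))"

section \<open>Well-definedness on classes\<close>

lemma free_suq_decomp: "t = (\<Sum>w\<in>Poly_Mapping.keys t. Poly_Mapping.single w (Poly_Mapping.lookup t w))"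
  by (rule poly_mapping_eqI) (auto simp: lookup_sum lookup_single when_def in_keys_iff)

lemma free_suq_induct [case_names single add]:
  fixes t :: free_suq
  assumes "\<And>w c. P (Poly_Mapping.single w c)" and "\<And>s t. P s \<Longrightarrow> P t \<Longrightarrow> P (s + t)"
  shows "P t"
proof -
  have "P 0" using assms(1)[of 0 0] by simp
  have "P (\<Sum>w\<in>W. Poly_Mapping.single w (Poly_Mapping.lookup t w))" if "finite W" for W
    using that by induction (auto simp: assms \<open>P 0\<close>)
  then show ?thesis by (subst free_suq_decomp) simp
qed

lemma keys_sum_additive:
  fixes g :: "suq_word \<Rightarrow> complex \<Rightarrow> 'm::ab_group_add"
  assumes G: "\<And>t. G t = (\<Sum>w\<in>Poly_Mapping.keys t. g w (Poly_Mapping.lookup t w))"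
    and add: "\<And>w a b. g w (a + b) = g w a + g w b"
  shows "G (s + t) = G s + G t" and "G (Poly_Mapping.single w c) = g w c"
proof -
  have z: "g w 0 = 0" for w using add[of w 0 0] by simp
  have ext: "G t = (\<Sum>w\<in>W. g w (Poly_Mapping.lookup t w))"
    if "finite W" "Poly_Mapping.keys t \<subseteq> W" for t W
    unfolding G by (rule sum.mono_neutral_left) (use that in \<open>auto simp: in_keys_iff z\<close>)
  let ?W = "Poly_Mapping.keys s \<union> Poly_Mapping.keys t"
  show "G (s + t) = G s + G t"
    by (subst (1 2 3) ext[of ?W]) (auto simp: keys_add lookup_add add sum.distrib dest: subsetD[OF keys_add])
  show "G (Poly_Mapping.single w c) = g w c"
    by (subst ext[of "{w}"]) auto
qed

lemma free_star_add: "free_star (s + t) = free_star s + free_star t"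
  and free_star_single: "free_star (Poly_Mapping.single w c) = Poly_Mapping.single (word_star w) (cnj c)"
  by (rule keys_sum_additive[of free_star "\<lambda>w c. Poly_Mapping.single (word_star w) (cnj c)"];
      simp add: free_star_def single_add)+

lemma suq_ideal_uminus: "t \<in> suq_ideal q \<Longrightarrow> - t \<in> suq_ideal q"
  using suq_ideal.left[of t q "- 1"] by simp

lemma equiv_suq_rel: "equiv UNIV (suq_rel q)"
proof (rule equivI)
  show "refl (suq_rel q)" by (simp add: refl_on_def suq_rel_def suq_ideal.zero)
  show "sym (suq_rel q)"
    by (rule symI) (use suq_ideal_uminus in \<open>fastforce simp: suq_rel_def\<close>)
  show "trans (suq_rel q)"
    by (rule transI) (use suq_ideal.add in \<open>fastforce simp: suq_rel_def\<close>)
qed auto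

lemma suq_class_eq_iff: "suq_class q s = suq_class q t \<longleftrightarrow> s - t \<in> suq_ideal q"
  unfolding suq_class_def eq_equiv_class_iff[OF equiv_suq_rel UNIV_I UNIV_I] by (simp add: suq_rel_def)

lemma suq_classE: assumes "X \<in> suq q" obtains t where "X = suq_class q t"
  using assms unfolding suq_def suq_class_def by (auto elim: quotientE)

lemma self_in_suq_class: "t \<in> suq_class q t"
  by (simp add: suq_class_def suq_rel_def suq_ideal.zero)

fun gen_deg :: "nat \<Rightarrow> suq_gen \<Rightarrow> int" where
  "gen_deg l Alpha = - 1"
| "gen_deg l AlphaStar = 1"
| "gen_deg l Beta = int l"
| "gen_deg l BetaStar = - int l"

definition word_deg :: "nat \<Rightarrow> suq_word \<Rightarrow> int" where
  "word_deg l w = sum_list (map (gen_deg l) (letters w))"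

lemma word_deg_add: "word_deg l (v + w) = word_deg l v + word_deg l w"
  by (simp add: word_deg_def plus_suq_word_def)

lemma theta_word:
  "prod_list (map (theta_gen l) xs) =
    Poly_Mapping.single (word_deg l (Word xs)) (Poly_Mapping.single (Word xs) 1)"
proof (induction xs)
  case Nil
  have "letters 0 = []" by (simp add: zero_suq_word_def)
  then show ?case by (simp add: word_deg_def zero_suq_word_def[symmetric])
next
  case (Cons x xs)
  have "theta_gen l x = Poly_Mapping.single (gen_deg l x) (Poly_Mapping.single (Word [x]) 1)"
    by (cases x) (simp_all add: gen_def)
  then show ?case
    by (simp add: Cons mult_single word_deg_def plus_suq_word_def)
qed

lemma lookup_free_theta_add:
    "Poly_Mapping.lookup (free_theta l (s + t)) k =
     Poly_Mapping.lookup (free_theta l s) k + Poly_Mapping.lookup (free_theta l t) k"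
  and lookup_free_theta_single:
    "Poly_Mapping.lookup (free_theta l (Poly_Mapping.single w c)) k =
     (if k = word_deg l w then Poly_Mapping.single w c else 0)"
proof -
  let ?g = "\<lambda>w c. if k = word_deg l w then Poly_Mapping.single w c else 0"
  have "Poly_Mapping.lookup (free_theta l t) k =
    (\<Sum>w\<in>Poly_Mapping.keys t. ?g w (Poly_Mapping.lookup t w))" for t
    by (simp add: free_theta_def theta_word cst_def mult_single lookup_sum lookup_single when_def eq_commute
        cong: if_cong)
  note * = keys_sum_additive[of "\<lambda>t. Poly_Mapping.lookup (free_theta l t) k" ?g, OF this]
  show "Poly_Mapping.lookup (free_theta l (s + t)) k =
     Poly_Mapping.lookup (free_theta l s) k + Poly_Mapping.lookup (free_theta l t) k"
    by (rule *(1)) (simp add: single_add)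
  show "Poly_Mapping.lookup (free_theta l (Poly_Mapping.single w c)) k =
     (if k = word_deg l w then Poly_Mapping.single w c else 0)"
    by (rule *(2)) (simp add: single_add)
qed

lemma lookup_free_theta_zero: "Poly_Mapping.lookup (free_theta l 0) k = 0"
  using lookup_free_theta_single[of l 0 0 k] by simp

lemma lookup_free_theta_minus:
  "Poly_Mapping.lookup (free_theta l (s - t)) k =
     Poly_Mapping.lookup (free_theta l s) k - Poly_Mapping.lookup (free_theta l t) k"
  using lookup_free_theta_add[of l "s - t" t k] by simp

lemma free_theta_left:
  "Poly_Mapping.lookup (free_theta l (Poly_Mapping.single w c * t)) k =
    Poly_Mapping.single w c * Poly_Mapping.lookup (free_theta l t) (k - word_deg l w)"
  by (induction t rule: free_suq_induct)
    (auto simp: mult_single lookup_free_theta_single lookup_free_theta_add word_deg_add distrib_left)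

lemma free_theta_right:
  "Poly_Mapping.lookup (free_theta l (t * Poly_Mapping.single w c)) k =
    Poly_Mapping.lookup (free_theta l t) (k - word_deg l w) * Poly_Mapping.single w c"
  by (induction t rule: free_suq_induct)
    (auto simp: mult_single lookup_free_theta_single lookup_free_theta_add word_deg_add distrib_right)

lemma word_deg_star: "word_deg l (word_star w) = - word_deg l w"
proof -
  have "gen_deg l (gen_star x) = - gen_deg l x" for x by (cases x) auto
  then have "sum_list (map (gen_deg l) (map gen_star xs)) = - sum_list (map (gen_deg l) xs)" for xs
    by (induction xs) auto
  then show ?thesis
    by (simp add: word_deg_def word_star_def rev_map[symmetric])
qed

lemma free_theta_star:
  "Poly_Mapping.lookup (free_theta l (free_star t)) k = free_star (Poly_Mapping.lookup (free_theta l t) (- k))"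
proof (induction t rule: free_suq_induct)
  case (single w c)
  have "free_star 0 = 0" by (simp add: free_star_def)
  then show ?case by (auto simp: free_star_single lookup_free_theta_single word_deg_star)
qed (simp add: free_star_add lookup_free_theta_add)

lemma free_theta_ideal:
  "t \<in> suq_ideal q \<Longrightarrow> Poly_Mapping.lookup (free_theta l t) k \<in> suq_ideal q"
proof (induction arbitrary: k rule: suq_ideal.induct)
  case (relator t)
  obtain d where "\<And>k. Poly_Mapping.lookup (free_theta l t) k = (if k = d then t else 0)"
  proof -
    have "\<exists>d. \<forall>k. Poly_Mapping.lookup (free_theta l t) k = (if k = d then t else 0)"
      using relator unfolding suq_relators_def
      apply (auto simp: gen_def cst_def mult_single single_one[symmetric] plus_suq_word_def zero_suq_word_def
          lookup_free_theta_add lookup_free_theta_minus lookup_free_theta_single word_deg_def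
          simp del: single_one split: if_splits)
      done
    then show ?thesis using that by blast
  qed
  then show ?case using relator by (auto intro: suq_ideal.intros)
next
  case (left t a)
  show ?case
    by (induction a rule: free_suq_induct)
      (auto simp: free_theta_left lookup_free_theta_add distrib_right intro: suq_ideal.intros left)
next
  case (right t a)
  show ?case
    by (induction a rule: free_suq_induct)
      (auto simp: free_theta_right lookup_free_theta_add distrib_left intro: suq_ideal.intros right)
qed (auto simp: lookup_free_theta_zero lookup_free_theta_add free_theta_star intro: suq_ideal.intros)

lemma suq_theta_class:
  "suq_theta q l (suq_class q t) k = suq_class q (Poly_Mapping.lookup (free_theta l t) k)"
proof -
  have "suq_class q (Poly_Mapping.lookup (free_theta l s) k) = suq_class q (Poly_Mapping.lookup (free_theta l t) k)"
    if "s \<in> suq_class q t" for s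
  proof -
    have "t - s \<in> suq_ideal q" using that by (simp add: suq_class_def suq_rel_def)
    then have "s - t \<in> suq_ideal q" using suq_ideal_uminus by fastforce
    then show ?thesis
      using free_theta_ideal[of "s - t" q l k] by (simp add: suq_class_eq_iff lookup_free_theta_minus)
  qed
  then show ?thesis
    unfolding suq_theta_def using self_in_suq_class[of t q] by blast
qed

lemma op_compose_assoc: "(R o\<^sub>L S) o\<^sub>L T = R o\<^sub>L (S o\<^sub>L T)"
  by (rule blinfun_eqI) simp

lemma op_compose_add:
  shows "(R + S) o\<^sub>L T = (R o\<^sub>L T) + (S o\<^sub>L T)" and "T' o\<^sub>L (R + S) = (T' o\<^sub>L R) + (T' o\<^sub>L S)"
  by (rule blinfun_eqI; simp add: blinfun.add_left blinfun.add_right)+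

lemma op_compose_id:
  shows "id_blinfun o\<^sub>L T = T" and "T' o\<^sub>L id_blinfun = T'"
  by (rule blinfun_eqI; simp)+

lemma coord_add: "coord (x + y) i = coord x i + coord y i"
  by (simp add: plus_l2.rep_eq)

lemma coord_minus: "coord (x - y) i = coord x i - coord y i"
  by (simp add: minus_l2.rep_eq)

lemma scal_op_zero: "scal_op 0 = 0"
  and scal_op_add: "scal_op (c + d) = scal_op c + scal_op d"
  and scal_op_one: "scal_op 1 = id_blinfun"
  and scal_op_mult: "scal_op (c * d) = scal_op c o\<^sub>L scal_op d"
  by (auto intro!: blinfun_eqI l2_eqI
      simp: scal_op_apply scaleC.rep_eq zero_l2.rep_eq coord_add blinfun.add_left algebra_simps)

lemma coord_scal_op: "coord (scal_op c x) i = c * coord x i"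
  by (simp add: scal_op_apply scaleC.rep_eq)

definition adjoint_pair :: "('a l2 \<Rightarrow>\<^sub>L 'a l2) \<Rightarrow> ('a l2 \<Rightarrow>\<^sub>L 'a l2) \<Rightarrow> bool" where
  "adjoint_pair S T \<longleftrightarrow> (\<forall>x y. S x \<bullet> y = x \<bullet> T y)"

lemma adjoint_pair_add: "adjoint_pair S T \<Longrightarrow> adjoint_pair S' T' \<Longrightarrow> adjoint_pair (S + S') (T + T')"
  by (simp add: adjoint_pair_def blinfun.add_left inner_add_left inner_add_right)

lemma adjoint_pair_compose: "adjoint_pair S T \<Longrightarrow> adjoint_pair S' T' \<Longrightarrow> adjoint_pair (S o\<^sub>L S') (T' o\<^sub>L T)"
  by (simp add: adjoint_pair_def)

lemma adjoint_pair_zero: "adjoint_pair 0 T \<Longrightarrow> T = 0"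
  unfolding adjoint_pair_def by (intro blinfun_eqI) (metis blinfun.zero_left inner_eq_zero_iff inner_zero_left)

lemma adjoint_pair_scal_op: "adjoint_pair (scal_op c) (scal_op (cnj c))"
proof -
  have "op_adjoint (scal_op c) = (scal_op (cnj c) :: 'a l2 \<Rightarrow>\<^sub>L 'a l2)"
    by (intro blinfun_eqI l2_eqI)
      (simp add: coord_scal_op, simp add: scal_op_def op_adjoint_weighted_shift(1)[where C = "cmod c"])
  moreover have "scal_op c x \<bullet> y = x \<bullet> op_adjoint (scal_op c) y" for x y :: "'a l2"
    unfolding scal_op_def by (rule op_adjoint_weighted_shift(2)[where C = "cmod c"]) auto
  ultimately show ?thesis by (simp add: adjoint_pair_def)
qed

context
  fixes q :: real
  assumes q: "0 < q" "q < 1"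
begin

lemma alpha_shift: "inj (\<lambda>(r :: int, n :: nat). (r, n + 1))"
    "cmod (case a of (r :: int, n) \<Rightarrow> complex_of_real (sqrt (1 - q ^ (2 * (n + 1))))) \<le> 1"
  subgoal by (auto simp: inj_def)
  subgoal
  proof (cases a)
    case (Pair r n)
    have "0 \<le> q ^ (2 * (n + 1))" "q ^ (2 * (n + 1)) \<le> 1" using q by (simp_all add: power_le_one del: power_Suc)
    then have "0 \<le> sqrt (1 - q ^ (2 * (n + 1)))" "sqrt (1 - q ^ (2 * (n + 1))) \<le> 1" by simp_all
    then show ?thesis unfolding Pair by (simp only: prod.case norm_of_real real_norm_def abs_of_nonneg)
  qed
  done

lemma beta_shift: "inj (\<lambda>(r :: int, n :: nat). (r + 1, n))"
    "cmod (case a of (r :: int, n) \<Rightarrow> complex_of_real (q ^ n)) \<le> 1"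
  using q by (auto simp: inj_def power_le_one norm_power split: prod.split)

lemma rep_alpha_ket:
    "rep_alpha q (ket (r, n)) = scaleC (of_real (sqrt (1 - q ^ (2 * (n + 1))))) (ket (r, n + 1))"
  and rep_beta_ket: "rep_beta q (ket (r, n)) = scaleC (of_real (q ^ n)) (ket (r + 1, n))"
  unfolding rep_alpha_def rep_beta_def weighted_shift_ket[OF alpha_shift] weighted_shift_ket[OF beta_shift]
  by (simp_all only: prod.case)

lemma coord_rep_gen:
  "coord (rep_gen q Alpha x) (r, n) =
    (if n = 0 then 0 else of_real (sqrt (1 - q ^ (2 * n))) * coord x (r, n - 1))"
  "coord (rep_gen q AlphaStar x) (r, n) = of_real (sqrt (1 - q ^ (2 * (n + 1)))) * coord x (r, n + 1)"
  "coord (rep_gen q Beta x) (r, n) = of_real (q ^ n) * coord x (r - 1, n)"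
  "coord (rep_gen q BetaStar x) (r, n) = of_real (q ^ n) * coord x (r + 1, n)"
proof -
  have "{a. (case a of (r :: int, n) \<Rightarrow> (r, n + 1)) = (r, n)} = (if n = 0 then {} else {(r, n - 1)})"
    for r and n :: nat by auto
  then show "coord (rep_gen q Alpha x) (r, n) =
    (if n = 0 then 0 else of_real (sqrt (1 - q ^ (2 * n))) * coord x (r, n - 1))"
    unfolding rep_gen.simps rep_alpha_def coord_weighted_shift[OF alpha_shift]
    by (cases n) (simp_all del: power_Suc)
  have "{a. (case a of (r :: int, n) \<Rightarrow> (r + 1, n)) = (r, n)} = {(r - 1, n)}"
    for r and n :: nat by auto
  then show "coord (rep_gen q Beta x) (r, n) = of_real (q ^ n) * coord x (r - 1, n)"
    using coord_weighted_shift[OF beta_shift] by (simp add: rep_beta_def)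
  show "coord (rep_gen q AlphaStar x) (r, n) = of_real (sqrt (1 - q ^ (2 * (n + 1)))) * coord x (r, n + 1)"
    using op_adjoint_weighted_shift(1)[OF alpha_shift] by (simp add: rep_alpha_def)
  show "coord (rep_gen q BetaStar x) (r, n) = of_real (q ^ n) * coord x (r + 1, n)"
    using op_adjoint_weighted_shift(1)[OF beta_shift] by (simp add: rep_beta_def)
qed

lemma adjoint_pair_rep_gen: "adjoint_pair (rep_gen q x) (rep_gen q (gen_star x))"
proof -
  have a: "rep_alpha q x \<bullet> y = x \<bullet> op_adjoint (rep_alpha q) y" for x y
    unfolding rep_alpha_def by (rule op_adjoint_weighted_shift(2)[OF alpha_shift])
  have b: "rep_beta q x \<bullet> y = x \<bullet> op_adjoint (rep_beta q) y" for x y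
    unfolding rep_beta_def by (rule op_adjoint_weighted_shift(2)[OF beta_shift])
  have "op_adjoint (rep_alpha q) x \<bullet> y = x \<bullet> rep_alpha q y"
    "op_adjoint (rep_beta q) x \<bullet> y = x \<bullet> rep_beta q y" for x y
    using a[of y x] b[of y x] by (simp_all only: inner_commute[of x] inner_commute[of _ y])
  then show ?thesis
    by (cases x) (simp_all only: adjoint_pair_def rep_gen.simps gen_star.simps a b simp_thms)
qed

lemma rep_gen_scal_op: "rep_gen q x o\<^sub>L scal_op c = scal_op c o\<^sub>L rep_gen q x"
  by (cases x; intro blinfun_eqI l2_eqI)
    (auto simp: coord_rep_gen coord_scal_op simp del: rep_gen.simps)

lemma rep_word_add: "rep_word q (v + w) = rep_word q v o\<^sub>L rep_word q w"
proof -
  have "foldr (\<lambda>x T. rep_gen q x o\<^sub>L T) xs S = foldr (\<lambda>x T. rep_gen q x o\<^sub>L T) xs id_blinfun o\<^sub>L S" for xs and S :: "(int \<times> nat) l2 \<Rightarrow>\<^sub>L (int \<times> nat) l2"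
  proof (induction xs)
    case (Cons x xs)
    show ?case unfolding foldr.simps comp_apply Cons op_compose_assoc ..
  qed (simp add: op_compose_id)
  from this[of "letters v" "rep_word q w"] show ?thesis
    unfolding rep_word_def plus_suq_word_def suq_word.sel foldr_append comp_apply .
qed

lemma rep_word_single: "rep_word q (Word [x]) = rep_gen q x"
  by (simp add: rep_word_def op_compose_id)

lemma suq_word_induct [case_names zero add]:
  assumes "P 0" and "\<And>x w. P w \<Longrightarrow> P (Word [x] + w)"
  shows "P w"
proof -
  have "P (Word xs)" for xs
  proof (induction xs)
    case Nil
    then show ?case using assms(1) by (simp add: zero_suq_word_def)
  next
    case (Cons x xs)
    then show ?case using assms(2)[of "Word xs" x] by (simp add: plus_suq_word_def)
  qed
  then show ?thesis by (cases w) simp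
qed

lemma rep_word_zero: "rep_word q 0 = id_blinfun"
  by (simp add: rep_word_def zero_suq_word_def)

lemma rep_word_scal_op: "rep_word q w o\<^sub>L scal_op c = scal_op c o\<^sub>L rep_word q w"
proof (induction w rule: suq_word_induct)
  case (add x w)
  show ?case
    unfolding rep_word_add rep_word_single op_compose_assoc add
    unfolding op_compose_assoc[symmetric] rep_gen_scal_op ..
qed (simp add: rep_word_zero op_compose_id)

lemma adjoint_pair_rep_word: "adjoint_pair (rep_word q w) (rep_word q (word_star w))"
proof (induction w rule: suq_word_induct)
  case zero
  have "word_star 0 = 0" by (simp add: word_star_def zero_suq_word_def)
  then show ?case by (simp add: rep_word_zero adjoint_pair_def)
next
  case (add x w)
  have eq: "word_star (Word [x] + w) = word_star w + Word [gen_star x]"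
    by (simp add: word_star_def plus_suq_word_def)
  show ?case
    unfolding eq rep_word_add rep_word_single by (rule adjoint_pair_compose[OF adjoint_pair_rep_gen add])
qed

lemma free_rep_add: "free_rep q (s + t) = free_rep q s + free_rep q t"
  and free_rep_single: "free_rep q (Poly_Mapping.single w c) = scal_op c o\<^sub>L rep_word q w"
proof -
  note * = keys_sum_additive[of "free_rep q" "\<lambda>w c. scal_op c o\<^sub>L rep_word q w", OF free_rep_def]
  show "free_rep q (s + t) = free_rep q s + free_rep q t"
    by (rule *(1)) (simp only: scal_op_add op_compose_add)
  show "free_rep q (Poly_Mapping.single w c) = scal_op c o\<^sub>L rep_word q w"
    by (rule *(2)) (simp only: scal_op_add op_compose_add)
qed

lemma free_rep_zero: "free_rep q 0 = 0"
  by (simp add: free_rep_def)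

lemma free_rep_minus: "free_rep q (s - t) = free_rep q s - free_rep q t"
  using free_rep_add[of "s - t" t] by simp

lemma free_rep_mult: "free_rep q (s * t) = free_rep q s o\<^sub>L free_rep q t"
proof (induction s rule: free_suq_induct)
  case (single v c)
  show ?case
  proof (induction t rule: free_suq_induct)
    case (single w d)
    have "rep_word q v o\<^sub>L (scal_op d o\<^sub>L rep_word q w) = scal_op d o\<^sub>L (rep_word q v o\<^sub>L rep_word q w)"
      unfolding op_compose_assoc[symmetric] rep_word_scal_op ..
    then show ?case
      by (simp only: mult_single free_rep_single scal_op_mult rep_word_add op_compose_assoc)
  qed (simp add: distrib_left free_rep_add op_compose_add)
qed (simp add: distrib_right free_rep_add op_compose_add)

lemma adjoint_pair_free_rep: "adjoint_pair (free_rep q t) (free_rep q (free_star t))"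
proof (induction t rule: free_suq_induct)
  case (single w c)
  have "free_rep q (free_star (Poly_Mapping.single w c)) = rep_word q (word_star w) o\<^sub>L scal_op (cnj c)"
    by (simp only: free_star_single free_rep_single rep_word_scal_op)
  then show ?case
    using adjoint_pair_compose[OF adjoint_pair_scal_op adjoint_pair_rep_word, of c w] by (simp only: free_rep_single)
next
  case (add s t)
  then show ?case
    unfolding free_star_add free_rep_add by (rule adjoint_pair_add)
qed

lemma free_rep_gen: "free_rep q (gen x) = rep_gen q x"
  by (simp only: gen_def free_rep_single scal_op_one rep_word_single op_compose_id)

lemma free_rep_cst: "free_rep q (cst c) = scal_op c"
  by (simp only: cst_def free_rep_single rep_word_zero op_compose_id)

lemma free_rep_one: "free_rep q 1 = id_blinfun"
  using free_rep_cst[of 1] by (simp only: cst_def scal_op_one single_one)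

lemma free_rep_relator:
  assumes "t \<in> suq_relators q"
  shows "free_rep q t = 0"
proof -
  have sq: "complex_of_real (sqrt (1 - q ^ k)) * (complex_of_real (sqrt (1 - q ^ k)) * z) = (1 - of_real q ^ k) * z"
    for k z
  proof -
    have "0 \<le> 1 - q ^ k" using q by (simp add: power_le_one)
    then have "complex_of_real (sqrt (1 - q ^ k)) * complex_of_real (sqrt (1 - q ^ k)) = of_real (1 - q ^ k)"
      by (metis of_real_mult real_sqrt_mult_self abs_of_nonneg)
    then show ?thesis by (simp add: mult.assoc[symmetric])
  qed
  note simps = free_rep_minus free_rep_add free_rep_mult free_rep_gen free_rep_cst free_rep_one
    blinfun.diff_left blinfun.add_left blinfun_apply_blinfun_compose blinfun_apply_id_blinfun
    coord_add coord_minus coord_rep_gen coord_scal_op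
  have r1: "coord (free_rep q (gen Beta * gen Alpha - cst (of_real q) * gen Alpha * gen Beta) x) (r, n) = 0"
    for x r n
    by (cases n) (simp_all only: simps, simp_all)
  have r2: "coord (free_rep q (gen BetaStar * gen Alpha - cst (of_real q) * gen Alpha * gen BetaStar) x) (r, n) = 0"
    for x r n
    by (cases n) (simp_all only: simps, simp_all)
  have r3: "coord (free_rep q (gen Beta * gen BetaStar - gen BetaStar * gen Beta) x) (r, n) = 0" for x r n
    by (simp only: simps) simp
  have r4: "coord (free_rep q (gen Alpha * gen AlphaStar + gen Beta * gen BetaStar - 1) x) (r, n) = 0" for x r n
  proof (cases n)
    case (Suc k)
    then have "n \<noteq> 0" "n - 1 + 1 = n" by simp_all
    then show ?thesis
      by (simp only: simps if_False sq) (simp add: algebra_simps power2_eq_square power_mult)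
  qed (simp only: simps, simp)
  have r5: "coord (free_rep q (gen AlphaStar * gen Alpha + cst (of_real (q\<^sup>2)) * gen BetaStar * gen Beta - 1) x) (r, n) = 0"
    for x r n
  proof -
    have "n + 1 \<noteq> 0" "n + 1 - 1 = n" by simp_all
    then show ?thesis
      by (simp only: simps if_False sq) (simp add: algebra_simps power2_eq_square power_mult)
  qed
  have "coord (free_rep q t x) (r, n) = 0" for x r n
    using assms r1 r2 r3 r4 r5 unfolding suq_relators_def insert_iff empty_iff by blast
  then show ?thesis
    by (intro blinfun_eqI l2_eqI) (auto simp: zero_l2.rep_eq)
qed

lemma free_rep_ideal: "t \<in> suq_ideal q \<Longrightarrow> free_rep q t = 0"
proof (induction rule: suq_ideal.induct)
  case (relator t)
  then show ?case by (rule free_rep_relator)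
next
  case (star t)
  have "adjoint_pair 0 (free_rep q (free_star t))"
    using adjoint_pair_free_rep[of t] unfolding star.IH .
  then show ?case by (rule adjoint_pair_zero)
qed (simp_all only: free_rep_zero free_rep_add free_rep_mult blinfun_compose_zero add_0)

lemma suq_rep_class: "suq_rep q (suq_class q t) = free_rep q t"
proof -
  have "free_rep q s = free_rep q t" if "s \<in> suq_class q t" for s
  proof -
    have "t - s \<in> suq_ideal q" using that by (simp add: suq_class_def suq_rel_def)
    then have "free_rep q t - free_rep q s = 0" unfolding free_rep_minus[symmetric] by (rule free_rep_ideal)
    then show ?thesis by simp
  qed
  then have "free_rep q ` suq_class q t = {free_rep q t}"
    using self_in_suq_class[of t q] by blast
  then show ?thesis unfolding suq_rep_def by (simp only: the_elem_eq)
qed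

lemma coord_block_embed: "coord (block_embed l m y) (r, n) = (if r = int (n div l) + m then coord y n else 0)"
proof -
  have "inj (\<lambda>k. (int (k div l) + m, k))" by (auto simp: inj_def)
  moreover have "{k. (int (k div l) + m, k) = (r, n)} = (if r = int (n div l) + m then {n} else {})" by auto
  ultimately show ?thesis
    by (simp add: block_embed_def coord_weighted_shift[where C = 1])
qed

lemma block_embed_adjoint: "op_adjoint (block_embed l m) o\<^sub>L block_embed l m = id_blinfun"
proof -
  have "inj (\<lambda>k. (int (k div l) + m, k))" by (auto simp: inj_def)
  then have "coord (op_adjoint (block_embed l m) y) k = coord y (int (k div l) + m, k)" for y k
    by (simp add: block_embed_def op_adjoint_weighted_shift(1)[where C = 1])
  then show ?thesis by (intro blinfun_eqI l2_eqI) (simp add: coord_block_embed)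
qed

lemma coord_rep_word:
  "\<exists>g a b. word_deg l w = int l * b - a \<and>
    (\<forall>x r n. coord (rep_word q w x) (r, n) =
      (if a \<le> int n then g n * coord x (r - b, nat (int n - a)) else 0))"
proof (induction w rule: suq_word_induct)
  case zero
  have "word_deg l 0 = 0" by (simp add: word_deg_def zero_suq_word_def)
  then show ?case
    by (intro exI[of _ "\<lambda>_. 1"] exI[of _ 0]) (simp add: rep_word_zero)
next
  case (add x w)
  then obtain g a b where d: "word_deg l w = int l * b - a"
    and c: "\<And>x r n. coord (rep_word q w x) (r, n) =
      (if a \<le> int n then g n * coord x (r - b, nat (int n - a)) else 0)" by blast
  have dx: "word_deg l (Word [x] + w) = gen_deg l x + (int l * b - a)"
    unfolding word_deg_add d by (simp add: word_deg_def)
  note simps = rep_word_add rep_word_single coord_rep_gen c blinfun_apply_blinfun_compose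
  show ?case
  proof (cases x)
    case Alpha
    show ?thesis
      by (rule exI[of _ "\<lambda>n. if n = 0 then 0 else of_real (sqrt (1 - q ^ (2 * n))) * g (n - 1)"],
          rule exI[of _ "a + 1"], rule exI[of _ b])
        (use dx Alpha in \<open>auto simp: simps algebra_simps nat_diff_distrib simp del: rep_gen.simps power_Suc intro!: arg_cong[of _ _ "coord _"]\<close>)
  next
    case AlphaStar
    show ?thesis
      by (rule exI[of _ "\<lambda>n. of_real (sqrt (1 - q ^ (2 * (n + 1)))) * g (n + 1)"],
          rule exI[of _ "a - 1"], rule exI[of _ b])
        (use dx AlphaStar in \<open>auto simp: simps algebra_simps simp del: rep_gen.simps power_Suc intro!: arg_cong[of _ _ "coord _"]\<close>)
  next
    case Beta
    show ?thesis
      by (rule exI[of _ "\<lambda>n. of_real (q ^ n) * g n"], rule exI[of _ a], rule exI[of _ "b + 1"])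
        (use dx Beta in \<open>auto simp: simps algebra_simps simp del: rep_gen.simps\<close>)
  next
    case BetaStar
    show ?thesis
      by (rule exI[of _ "\<lambda>n. of_real (q ^ n) * g n"], rule exI[of _ a], rule exI[of _ "b - 1"])
        (use dx BetaStar in \<open>auto simp: simps algebra_simps simp del: rep_gen.simps\<close>)
  qed
qed

lemma coord_block: "coord (block l m T y) n = coord (T (block_embed l m y)) (int (n div l) + m, n)"
proof -
  have "inj (\<lambda>k. (int (k div l) + m, k))" by (auto simp: inj_def)
  then show ?thesis
    by (simp add: block_def block_embed_def op_adjoint_weighted_shift(1)[where C = 1])
qed

lemma rep_word_block:
  assumes "word_deg l w = 0" "1 \<le> l"
  shows "rep_word q w o\<^sub>L block_embed l m = block_embed l m o\<^sub>L block l 0 (rep_word q w)"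
proof -
  obtain g a b where d: "word_deg l w = int l * b - a"
    and c: "\<And>x r n. coord (rep_word q w x) (r, n) =
      (if a \<le> int n then g n * coord x (r - b, nat (int n - a)) else 0)" using coord_rep_word by blast
  have a: "a = int l * b" using assms d by simp
  define h where "h = (\<lambda>y n. if a \<le> int n then g n * coord y (nat (int n - a)) else 0)"
  have div: "int (nat (int n - a) div l) = int (n div l) - b" if "a \<le> int n" for n
  proof -
    have "int (nat (int n - a) div l) = (int n - a) div int l" using that by (simp add: zdiv_int)
    also have "\<dots> = (int n + (- b) * int l) div int l" by (simp add: a algebra_simps)
    also have "\<dots> = - b + int n div int l" using assms(2) by (intro div_mult_self1) auto
    finally show ?thesis by (simp add: zdiv_int)
  qed
  have h: "coord (rep_word q w (block_embed l m y)) (r, n) = (if r = int (n div l) + m then h y n else 0)"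
    for m y r n
    unfolding c coord_block_embed h_def using div[of n] by auto
  have "coord (block l 0 (rep_word q w) y) n = h y n" for y n
    unfolding coord_block h by simp
  then have "coord (rep_word q w (block_embed l m y)) (r, n) =
      coord (block_embed l m (block l 0 (rep_word q w) y)) (r, n)" for y r n
    unfolding h coord_block_embed by simp
  then show ?thesis
    by (intro blinfun_eqI l2_eqI) (auto simp: split_paired_all)
qed

lemma block_unique:
  assumes "\<And>m. T o\<^sub>L block_embed l m = block_embed l m o\<^sub>L R"
  shows "T o\<^sub>L block_embed l m = block_embed l m o\<^sub>L block l 0 T"
proof -
  have "block l 0 T = R"
    unfolding block_def op_compose_assoc assms
    unfolding op_compose_assoc[symmetric] block_embed_adjoint op_compose_id ..
  then show ?thesis using assms by simp
qed

lemma scal_op_block_embed: "scal_op c o\<^sub>L block_embed l m = block_embed l m o\<^sub>L scal_op c"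
  by (intro blinfun_eqI l2_eqI) (auto simp: coord_scal_op coord_block_embed split_paired_all)

text \<open>Operators in the closure of the degree zero part preserve every \<open>X\<^sub>m\<close> and act on it
  independently of \<open>m\<close>.\<close>

lemma suq_degree_zero_block:
  assumes "T \<in> suq_degree_closure q l 0" and l: "1 \<le> l"
  shows "T o\<^sub>L block_embed l m = block_embed l m o\<^sub>L block l 0 T"
proof -
  define S where "S = {T. \<forall>m. T o\<^sub>L block_embed l m = block_embed l m o\<^sub>L block l 0 T}"
  note lin = bounded_bilinear.bounded_linear_left[OF bounded_bilinear_blinfun_compose]
    bounded_bilinear.bounded_linear_right[OF bounded_bilinear_blinfun_compose]
  have bl: "bounded_linear (block l 0)"
    unfolding block_def by (intro bounded_linear_compose[OF lin(1)] lin)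
  have S_iff: "T \<in> S \<longleftrightarrow> (\<exists>R. \<forall>m. T o\<^sub>L block_embed l m = block_embed l m o\<^sub>L R)" for T
    unfolding S_def using block_unique by blast
  have "closed S"
    unfolding S_def Collect_all_eq
    by (intro closed_INT ballI closed_Collect_eq linear_continuous_on lin bounded_linear_compose[OF lin(2) bl])
  moreover have "suq_rep q X \<in> S" if X: "X \<in> suq_degree q l 0" for X
  proof -
    obtain t where t: "X = suq_class q t" using X suq_classE by (auto simp: suq_degree_def)
    have "suq_theta q l X 0 = X" using X by (simp add: suq_degree_def tensor_u_def)
    then have "suq_rep q X = free_rep q (Poly_Mapping.lookup (free_theta l t) 0)"
      unfolding t suq_theta_class by (metis suq_rep_class)
    also have "\<dots> \<in> S"
    proof (induction t rule: free_suq_induct)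
      case (single w c)
      show ?case
      proof (cases "word_deg l w = 0")
        case True
        have "(scal_op c o\<^sub>L rep_word q w) o\<^sub>L block_embed l m =
            block_embed l m o\<^sub>L (scal_op c o\<^sub>L block l 0 (rep_word q w))" for m
          unfolding op_compose_assoc rep_word_block[OF True l]
          unfolding op_compose_assoc[symmetric] scal_op_block_embed ..
        then show ?thesis
          unfolding S_iff by (auto simp: lookup_free_theta_single True free_rep_single)
      next
        case False
        then have "Poly_Mapping.lookup (free_theta l (Poly_Mapping.single w c)) 0 = 0"
          by (auto simp: lookup_free_theta_single)
        moreover have "0 \<in> S" unfolding S_iff by (intro exI[of _ 0]) simp
        ultimately show ?thesis by (simp only: free_rep_zero)
      qed
    next
      case (add s t)
      then obtain R R' where R:
        "\<And>m. free_rep q (Poly_Mapping.lookup (free_theta l s) 0) o\<^sub>L block_embed l m = block_embed l m o\<^sub>L R"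
        "\<And>m. free_rep q (Poly_Mapping.lookup (free_theta l t) 0) o\<^sub>L block_embed l m = block_embed l m o\<^sub>L R'"
        unfolding S_iff by blast
      show ?case
        unfolding S_iff lookup_free_theta_add free_rep_add
        by (intro exI[of _ "R + R'"] allI, unfold op_compose_add R) (rule refl)
    qed
    finally show ?thesis .
  qed
  ultimately have "suq_degree_closure q l 0 \<subseteq> S"
    unfolding suq_degree_closure_def by (intro closure_minimal image_subsetI)
  then have "T \<in> S" using assms(1) by (rule subsetD)
  then show ?thesis unfolding S_def mem_Collect_eq by (rule spec)
qed

lemma block_independent:
  assumes "T \<in> suq_degree_closure q l 0" and "1 \<le> l"
  shows "block l m T = block l 0 T"
proof -
  have "block l m T = op_adjoint (block_embed l m) o\<^sub>L (T o\<^sub>L block_embed l m)"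
    by (simp only: block_def op_compose_assoc)
  also have "\<dots> = (op_adjoint (block_embed l m) o\<^sub>L block_embed l m) o\<^sub>L block l 0 T"
    by (simp only: suq_degree_zero_block[OF assms] op_compose_assoc)
  also have "\<dots> = block l 0 T"
    by (simp only: block_embed_adjoint op_compose_id)
  finally show ?thesis .
qed

end

end

theory Submission
  imports Defs
begin

text \<open>Every monomial of degree \<open>i\<close> in the generators acts on \<open>l\<^sup>2(\<int>) \<otimes> l\<^sup>2(\<nat>)\<close> as a weighted shift
  \<open>ket (r, n) \<mapsto> g (n + a) \<cdot> ket (r + b, n + a)\<close> with \<open>l b - a = i\<close>.  Hence it carries the copy of
  \<open>l\<^sup>2(\<nat>)\<close> spanned by the \<open>ket ((k - i) div l + m, k)\<close> to \<open>X\<^sub>m\<close>, by an operator that does not depend on \<open>m\<close>: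
  its degree block.  Since these copies decompose the whole space, the degree block has the same norm as the
  operator (\<open>norm_le_degree_block\<close>), so that a completed homogeneous part can be studied on the single space
  \<open>l\<^sup>2(\<nat>)\<close>.

  The weights \<open>g\<close> of a monomial converge: to \<open>0\<close> if a letter \<open>\<beta>\<close> or \<open>\<beta>\<^sup>*\<close> occurs, and to \<open>1\<close> otherwise, in which
  case \<open>b = 0\<close> and \<open>a = - i\<close>.  So the block is a compact operator plus a multiple of the shift \<open>V\<^sub>i\<close> with
  \<open>ket k \<mapsto> ket (k - i)\<close>.  Its matrix entries \<open>(s, t)\<close> vanish unless \<open>s\<close> is congruent to \<open>t - i\<close> modulo \<open>l\<close>.
  Conversely all matrix units satisfying this congruence are limits of monomials
  \<open>\<alpha>\<^sup>s \<beta>\<^sup>x (\<beta>\<^sup>*)\<^sup>y (\<alpha>\<^sup>*)\<^sup>t\<close>, because \<open>(\<beta>\<beta>\<^sup>*)\<^sup>m\<close> tends to the projection onto the kets \<open>ket (r, 0)\<close>.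
  With \<open>K\<^sub>i\<close> the space of compact operators with that congruence, the completed part of degree \<open>i\<close> is therefore
  \<open>K\<^sub>i + \<complex> V\<^sub>i\<close> (\<open>degree_block_image\<close>).  For \<open>i = 0\<close> the operators in \<open>K\<^sub>0\<close> are the direct sums of \<open>l\<close>
  compact operators, one on each residue class, and \<open>K\<^sub>0 + \<complex> 1\<close> is the algebra \<open>A = compact_sum_unitization l\<close>.

  It remains to recognise \<open>K\<^sub>i + \<complex> V\<^sub>i\<close> as a left \<open>A\<close>-module.  If \<open>i \<ge> 0\<close>, then \<open>V\<^sub>i\<close> is a coisometry and
  \<open>1 - V\<^sub>i\<^sup>* V\<^sub>i\<close> is the projection \<open>E\<close> onto the kets \<open>ket k\<close> with \<open>k < i\<close>.  Then \<open>R \<mapsto> (R V\<^sub>i\<^sup>*, R E)\<close> identifies the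
  module with \<open>A \<oplus> K\<^sub>i E\<close>, and composing with a permutation \<open>U\<close> that rotates the residue classes by \<open>j\<close> turns
  \<open>K\<^sub>i E\<close> into \<open>A Q\<close> (\<open>positive_degree_module\<close>).  If \<open>i < 0\<close>, then \<open>V\<^sub>i\<close> is an isometry with range projection
  \<open>1 - Q\<close>, and \<open>R \<mapsto> R V\<^sub>i\<^sup>*\<close> identifies the module with \<open>A (1 - Q)\<close> (\<open>negative_degree_module\<close>).  The ranks
  in \<open>Q\<close> count the numbers below \<open>\<bar>i\<bar>\<close> in each residue class, after the rotation if \<open>i \<ge> 0\<close>.\<close>


section \<open>Square-summable families\<close>

lemma sum_coord_le: "finite F \<Longrightarrow> (\<Sum>i\<in>F. (cmod (coord x i))\<^sup>2) \<le> (norm x)\<^sup>2"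
  unfolding norm_l2_power2 by (rule finite_sum_le_infsum[OF coord_summable]) auto

lemma norm_l2_leI:
  assumes "0 \<le> C" and "\<And>F. finite F \<Longrightarrow> (\<Sum>i\<in>F. (cmod (coord x i))\<^sup>2) \<le> C\<^sup>2"
  shows "norm x \<le> C"
proof (rule power2_le_imp_le)
  show "(norm x)\<^sup>2 \<le> C\<^sup>2"
    unfolding norm_l2_power2 by (rule infsum_le_finite_sums[OF coord_summable]) (rule assms(2))
qed (rule assms(1))

lemma norm_coord_le: "cmod (coord x i) \<le> norm x"
proof (rule power2_le_imp_le)
  show "(cmod (coord x i))\<^sup>2 \<le> (norm x)\<^sup>2"
    using sum_coord_le[of "{i}" x] by (simp only: sum.insert[OF finite.emptyI] finite.intros sum.empty empty_iff
      not_False_eq_True add_0_right simp_thms)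
qed (rule norm_ge_zero)

lemma Cauchy_coord:
  assumes "Cauchy X" shows "Cauchy (\<lambda>n. coord (X n) i)"
proof (rule metric_CauchyI)
  fix e :: real assume "0 < e"
  then obtain M where M: "\<And>m n. M \<le> m \<Longrightarrow> M \<le> n \<Longrightarrow> dist (X m) (X n) < e"
    using metric_CauchyD[OF assms] by blast
  have "dist (coord (X m) i) (coord (X n) i) < e" if "M \<le> m" "M \<le> n" for m n
    using norm_coord_le[of "X m - X n" i] M[OF that] by (simp add: dist_norm coord_minus)
  then show "\<exists>M. \<forall>m\<ge>M. \<forall>n\<ge>M. dist (coord (X m) i) (coord (X n) i) < e" by blast
qed

text \<open>Fatou's argument: a Cauchy sequence converges coordinatewise, and every bound for the finite
  partial sums of the squares survives this convergence.\<close>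

lemma Cauchy_l2_convergent:
  fixes X :: "nat \<Rightarrow> 'a l2"
  assumes "Cauchy X" shows "convergent X"
proof -
  define f where "f = (\<lambda>i. lim (\<lambda>n. coord (X n) i))"
  have f: "(\<lambda>n. coord (X n) i) \<longlonglongrightarrow> f i" for i
    unfolding f_def by (intro convergent_LIMSEQ_iff[THEN iffD1] Cauchy_convergent Cauchy_coord assms)
  have tail: "\<exists>M. \<forall>n\<ge>M. \<forall>F. finite F \<longrightarrow> (\<Sum>i\<in>F. (cmod (coord (X n) i - f i))\<^sup>2) \<le> e\<^sup>2"
    if "0 < e" for e
  proof -
    obtain M where M: "\<And>m n. M \<le> m \<Longrightarrow> M \<le> n \<Longrightarrow> dist (X m) (X n) < e"
      using metric_CauchyD[OF assms \<open>0 < e\<close>] by blast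
    have "(\<Sum>i\<in>F. (cmod (coord (X n) i - f i))\<^sup>2) \<le> e\<^sup>2" if "M \<le> n" "finite F" for n F
    proof (rule LIMSEQ_le_const2)
      show "(\<lambda>m. \<Sum>i\<in>F. (cmod (coord (X n) i - coord (X m) i))\<^sup>2) \<longlonglongrightarrow> (\<Sum>i\<in>F. (cmod (coord (X n) i - f i))\<^sup>2)"
        by (intro tendsto_intros f)
      have "(\<Sum>i\<in>F. (cmod (coord (X n) i - coord (X m) i))\<^sup>2) \<le> e\<^sup>2" if "M \<le> m" for m
      proof -
        have "(\<Sum>i\<in>F. (cmod (coord (X n - X m) i))\<^sup>2) \<le> (norm (X n - X m))\<^sup>2"
          by (rule sum_coord_le) fact
        also have "\<dots> \<le> e\<^sup>2"
          using M[OF \<open>M \<le> n\<close> that] by (intro power_mono) (simp_all add: dist_norm)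
        finally show ?thesis by (simp add: coord_minus)
      qed
      then show "\<exists>N. \<forall>m\<ge>N. (\<Sum>i\<in>F. (cmod (coord (X n) i - coord (X m) i))\<^sup>2) \<le> e\<^sup>2" by blast
    qed
    then show ?thesis by blast
  qed
  obtain M where M: "\<And>F. finite F \<Longrightarrow> (\<Sum>i\<in>F. (cmod (coord (X M) i - f i))\<^sup>2) \<le> 1"
    using tail[of 1] by (metis order_refl power_one zero_less_one)
  have "(\<lambda>i. (cmod (coord (X M) i - f i))\<^sup>2) summable_on UNIV"
    by (rule nonneg_bdd_above_summable_on) (simp, rule bdd_aboveI2[where M = 1], use M in blast)
  then have "(\<lambda>i. (cmod (coord (X M) i + - (coord (X M) i - f i)))\<^sup>2) summable_on UNIV"
    by (intro square_summable_add coord_summable) (simp add: norm_minus_commute)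
  then have "coord (Abs_l2 f) = f"
    by (intro Abs_l2_inverse) simp
  then obtain y where y: "coord y = f" by blast
  have "X \<longlonglongrightarrow> y"
  proof (rule metric_LIMSEQ_I)
    fix r :: real assume "0 < r"
    then obtain N where N: "\<And>n F. N \<le> n \<Longrightarrow> finite F \<Longrightarrow> (\<Sum>i\<in>F. (cmod (coord (X n) i - f i))\<^sup>2) \<le> (r / 2)\<^sup>2"
      using tail[of "r / 2"] half_gt_zero[OF \<open>0 < r\<close>] by metis
    have "dist (X n) y < r" if "N \<le> n" for n
    proof -
      have "norm (X n - y) \<le> r / 2"
        by (rule norm_l2_leI) (use N[OF that] \<open>0 < r\<close> in \<open>auto simp: coord_minus y\<close>)
      then show ?thesis using \<open>0 < r\<close> by (simp add: dist_norm)
    qed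
    then show "\<exists>N. \<forall>n\<ge>N. dist (X n) y < r" by blast
  qed
  then show ?thesis by (rule convergentI)
qed

instance l2 :: (type) banach
  by standard (rule Cauchy_l2_convergent)

section \<open>Operators given by their coordinates\<close>

text \<open>An operator each of whose output coordinates depends on at most one input coordinate, distinct outputs on
  distinct inputs, has norm at most the supremum of its weights.\<close>

lemma norm_op_leI:
  fixes T :: "'a l2 \<Rightarrow>\<^sub>L 'b l2"
  assumes "0 \<le> C" and inj: "inj_on h S"
    and S: "\<And>x b. b \<in> S \<Longrightarrow> cmod (coord (blinfun_apply T x) b) \<le> C * cmod (coord x (h b))"
    and nS: "\<And>x b. b \<notin> S \<Longrightarrow> coord (blinfun_apply T x) b = 0"
  shows "norm T \<le> C"
proof (rule norm_blinfun_bound[OF assms(1)])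
  fix x :: "'a l2"
  show "norm (T x) \<le> C * norm x"
  proof (rule norm_l2_leI)
    fix F :: "'b set" assume F: "finite F"
    have "(\<Sum>b\<in>F. (cmod (coord (T x) b))\<^sup>2) = (\<Sum>b\<in>F \<inter> S. (cmod (coord (T x) b))\<^sup>2)"
      by (rule sum.mono_neutral_right[OF F]) (auto simp: nS)
    also have "\<dots> \<le> (\<Sum>b\<in>F \<inter> S. C\<^sup>2 * (cmod (coord x (h b)))\<^sup>2)"
      using S by (intro sum_mono) (metis IntD2 norm_ge_zero power_mono power_mult_distrib)
    also have "\<dots> = C\<^sup>2 * (\<Sum>a\<in>h ` (F \<inter> S). (cmod (coord x a))\<^sup>2)"
      by (subst sum.reindex) (auto simp: sum_distrib_left intro: inj_on_subset[OF inj])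
    also have "\<dots> \<le> C\<^sup>2 * (norm x)\<^sup>2"
      by (intro mult_left_mono sum_coord_le) (use F in auto)
    finally show "(\<Sum>b\<in>F. (cmod (coord (T x) b))\<^sup>2) \<le> (C * norm x)\<^sup>2"
      by (simp add: power_mult_distrib)
  qed (use assms(1) in simp)
qed

lemma coord_zero [simp]: "coord 0 i = 0"
  by (simp add: zero_l2.rep_eq)

lemma coord_sum: "coord (sum f A) i = (\<Sum>a\<in>A. coord (f a) i)"
  by (induction A rule: infinite_finite_induct) (auto simp: coord_add)

lemma blinfun_apply_sum: "blinfun_apply (sum f A) x = (\<Sum>a\<in>A. blinfun_apply (f a) x)"
  by (induction A rule: infinite_finite_induct) (auto simp: blinfun.add_left)

definition pullback :: "('a \<Rightarrow> 'b) \<Rightarrow> 'b l2 \<Rightarrow>\<^sub>L 'a l2" where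
  "pullback f = op_adjoint (weighted_shift (\<lambda>_. 1) f)"

lemma coord_pullback: "inj f \<Longrightarrow> coord (pullback f y) a = coord y (f a)"
  unfolding pullback_def by (simp add: op_adjoint_weighted_shift(1)[where C = 1])

lemma coord_weighted_shift_image:
  assumes "inj f" "\<And>a. cmod (w a) \<le> C"
  shows "coord (weighted_shift w f x) (f a) = w a * coord x a"
    and "b \<notin> range f \<Longrightarrow> coord (weighted_shift w f x) b = 0"
  by (simp_all add: coord_weighted_shift[OF assms] fiber_sum[OF assms(1)] fiber_sum_out)

text \<open>\<open>weighted_shift\<close> needs an injective map on indices, so the entry at row \<open>a\<close> and column \<open>b\<close> is realised by the
  transposition of \<open>a\<close> and \<open>b\<close> with all weights but one equal to zero.\<close>

definition matrix_unit :: "complex \<Rightarrow> 'a \<Rightarrow> 'a \<Rightarrow> 'a l2 \<Rightarrow>\<^sub>L 'a l2" where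
  "matrix_unit c a b =
    weighted_shift (\<lambda>k. if k = b then c else 0) (\<lambda>k. if k = b then a else if k = a then b else k)"

lemma coord_matrix_unit: "coord (matrix_unit c a b x) k = (if k = a then c * coord x b else 0)"
proof -
  define f where "f = (\<lambda>k. if k = b then a else if k = a then b else k)"
  have f: "inj f" by (auto simp: inj_def f_def)
  have eq: "matrix_unit c a b = weighted_shift (\<lambda>k. if k = b then c else 0) f"
    by (simp add: matrix_unit_def f_def)
  have ff: "f (f k) = k" for k by (simp add: f_def)
  have "coord (matrix_unit c a b x) (f (f k)) = (if f k = b then c else 0) * coord x (f k)"
    unfolding eq by (rule coord_weighted_shift_image(1)[OF f, where C = "cmod c"]) auto
  also have "\<dots> = (if k = a then c * coord x b else 0)"
    by (auto simp: f_def)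
  finally show ?thesis unfolding ff .
qed

lemma coord_rank_proj: "coord (rank_proj r x) k = (if k < r then coord x k else 0)"
  unfolding rank_proj_def by (subst coord_weighted_shift_image(1)[where C = 1]) auto

lemma op_compose_scaleR:
  shows "(r *\<^sub>R S) o\<^sub>L T = r *\<^sub>R (S o\<^sub>L T)" and "S o\<^sub>L (r *\<^sub>R T) = r *\<^sub>R (S o\<^sub>L T)"
  by (rule blinfun_eqI; simp add: blinfun.scaleR_left blinfun.scaleR_right)+

lemma op_compose_zero [simp]: "0 o\<^sub>L T = 0" "T o\<^sub>L 0 = 0"
  by (rule blinfun_eqI; simp)+

lemma linear_compose_right: "bounded_linear (\<lambda>T. T o\<^sub>L S)"
  by (rule bounded_bilinear.bounded_linear_left[OF bounded_bilinear_blinfun_compose])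

lemma linear_compose_left: "bounded_linear (\<lambda>T. S o\<^sub>L T)"
  by (rule bounded_bilinear.bounded_linear_right[OF bounded_bilinear_blinfun_compose])

lemma scal_op_of_real: "scal_op (of_real r) = r *\<^sub>R id_blinfun"
  by (intro blinfun_eqI l2_eqI) (simp add: coord_scal_op blinfun.scaleR_left scaleR_l2.rep_eq scaleR_conv_of_real)

section \<open>Closed spans of matrix units with prescribed residues\<close>

lemma subspace_closure:
  fixes S :: "'a::real_normed_vector set"
  assumes "subspace S" shows "subspace (closure S)"
proof (rule subspaceI)
  show "0 \<in> closure S" using subspace_0[OF assms] closure_subset by blast
next
  fix x y assume "x \<in> closure S" "y \<in> closure S"
  then obtain f g where "\<forall>n. f n \<in> S" "f \<longlonglongrightarrow> x" "\<forall>n. g n \<in> S" "g \<longlonglongrightarrow> y"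
    unfolding closure_sequential by blast
  then show "x + y \<in> closure S"
    unfolding closure_sequential
    by (intro exI[of _ "\<lambda>n. f n + g n"]) (auto intro: tendsto_add subspace_add[OF assms])
next
  fix c x assume "x \<in> closure S"
  then obtain f where "\<forall>n. f n \<in> S" "f \<longlonglongrightarrow> x"
    unfolding closure_sequential by blast
  then show "c *\<^sub>R x \<in> closure S"
    unfolding closure_sequential
    by (intro exI[of _ "\<lambda>n. c *\<^sub>R f n"]) (auto intro: tendsto_intros subspace_scale[OF assms])
qed

text \<open>The compact operators that shift the residues of the indices modulo \<open>l\<close> by \<open>- i\<close>; for \<open>l = 1\<close> these are all
  compact operators.  Defining them as a closed linear span lets every inclusion be checked on matrix units, see
  \<open>residue_compacts_minimal\<close> and \<open>residue_compacts_map\<close>.\<close>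

definition residue_compacts :: "nat \<Rightarrow> int \<Rightarrow> (nat l2 \<Rightarrow>\<^sub>L nat l2) set" where
  "residue_compacts l i = closure (span {matrix_unit c a b | c a b. int l dvd int a - int b + i})"

lemma subspace_residue_compacts: "subspace (residue_compacts l i)"
  unfolding residue_compacts_def by (intro subspace_closure subspace_span)

lemma closed_residue_compacts: "closed (residue_compacts l i)"
  unfolding residue_compacts_def by simp

lemma matrix_unit_residue_compacts:
  "int l dvd int a - int b + i \<Longrightarrow> matrix_unit c a b \<in> residue_compacts l i"
  unfolding residue_compacts_def by (intro subsetD[OF closure_subset] span_base) blast

lemma residue_compacts_minimal:
  assumes "closed S" "subspace S" "\<And>c a b. int l dvd int a - int b + i \<Longrightarrow> matrix_unit c a b \<in> S"
  shows "residue_compacts l i \<subseteq> S"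
  unfolding residue_compacts_def using assms by (intro closure_minimal span_minimal) auto

lemma residue_compacts_map:
  assumes f: "bounded_linear f"
    and "\<And>c a b. int l dvd int a - int b + i \<Longrightarrow> f (matrix_unit c a b) \<in> residue_compacts l' i'"
    and "T \<in> residue_compacts l i"
  shows "f T \<in> residue_compacts l' i'"
proof -
  interpret f: bounded_linear f by fact
  have "closed {T. f T \<in> residue_compacts l' i'}"
    using continuous_closed_vimage[OF closed_residue_compacts, of f] f.continuous_on[OF continuous_on_id]
    by (simp add: vimage_def continuous_on_eq_continuous_at f.isCont)
  moreover have "subspace {T. f T \<in> residue_compacts l' i'}"
    using f.linear_axioms subspace_residue_compacts linear_subspace_vimage[of f] by (simp add: vimage_def)
  ultimately show ?thesis
    using residue_compacts_minimal[of "{T. f T \<in> residue_compacts l' i'}" l i] assms(2,3) by blast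
qed

lemma residue_compacts_mod: "int l dvd i - i' \<Longrightarrow> residue_compacts l i = residue_compacts l i'"
proof -
  assume "int l dvd i - i'"
  then have "int l dvd int a - int b + i \<longleftrightarrow> int l dvd int a - int b + i'" for a b
    using dvd_add_left_iff[of "int l" "i - i'" "int a - int b + i'"] by (simp add: algebra_simps)
  then show ?thesis by (simp add: residue_compacts_def)
qed

text \<open>If row \<open>b\<close> of \<open>S\<close> is zero or reads off one coordinate \<open>b'\<close>, then a matrix unit times \<open>S\<close> is zero or
  again a matrix unit, with column \<open>b'\<close>.  All the shifts, rotations and diagonal projections below are of this kind.\<close>

lemma residue_compacts_compose_coord:
  assumes S: "\<And>b. (\<exists>b'. int l dvd int b' - int b - d \<and> (\<forall>x. coord (blinfun_apply S x) b = coord x b'))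
      \<or> (\<forall>x. coord (blinfun_apply S x) b = 0)"
    and "T \<in> residue_compacts l i"
  shows "T o\<^sub>L S \<in> residue_compacts l (i + d)"
proof (rule residue_compacts_map[OF linear_compose_right _ assms(2)])
  fix c a b assume ab: "int l dvd int a - int b + i"
  from S[of b] show "matrix_unit c a b o\<^sub>L S \<in> residue_compacts l (i + d)"
  proof
    assume "\<exists>b'. int l dvd int b' - int b - d \<and> (\<forall>x. coord (blinfun_apply S x) b = coord x b')"
    then obtain b' where b': "int l dvd int b' - int b - d" "\<And>x. coord (blinfun_apply S x) b = coord x b'" by blast
    have "matrix_unit c a b o\<^sub>L S = matrix_unit c a b'"
      by (intro blinfun_eqI l2_eqI) (simp add: coord_matrix_unit b'(2))
    moreover have "int l dvd int a - int b' + (i + d)"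
      using dvd_diff[OF ab b'(1)] by (simp add: algebra_simps)
    ultimately show ?thesis by (simp add: matrix_unit_residue_compacts)
  next
    assume "\<forall>x. coord (blinfun_apply S x) b = 0"
    then have "matrix_unit c a b o\<^sub>L S = 0"
      by (intro blinfun_eqI l2_eqI) (simp add: coord_matrix_unit)
    then show ?thesis using subspace_0[OF subspace_residue_compacts] by simp
  qed
qed

text \<open>A diagonal of weights that tend to zero is the norm limit of its finite sections.\<close>

lemma vanishing_band_residue_compacts:
  assumes T: "\<And>x n. coord (blinfun_apply T x) n = (if a \<le> int n then g n * coord x (nat (int n - a)) else 0)"
    and g: "g \<longlonglongrightarrow> 0" and a: "int l dvd a + i"
  shows "T \<in> residue_compacts l i"
proof -
  have "\<exists>S\<in>residue_compacts l i. dist S T \<le> e" if "0 < e" for e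
  proof -
    obtain N where N: "\<And>n. N \<le> n \<Longrightarrow> cmod (g n) < e"
      using LIMSEQ_D[OF g \<open>0 < e\<close>] by auto
    define S where "S = (\<Sum>n | n < N \<and> a \<le> int n. matrix_unit (g n) n (nat (int n - a)))"
    have "S \<in> residue_compacts l i"
      unfolding S_def by (intro subspace_sum subspace_residue_compacts matrix_unit_residue_compacts) (use a in auto)
    moreover have "norm (T - S) \<le> e"
    proof (rule norm_op_leI[where S = "{n. N \<le> n \<and> a \<le> int n}" and h = "\<lambda>n. nat (int n - a)"])
      fix x n
      have "coord ((T - S) x) n = (if N \<le> n \<and> a \<le> int n then g n * coord x (nat (int n - a)) else 0)"
        by (auto simp: S_def blinfun.diff_left coord_minus blinfun_apply_sum coord_sum coord_matrix_unit T
            sum.delta)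
      then show "n \<in> {n. N \<le> n \<and> a \<le> int n} \<Longrightarrow> cmod (coord ((T - S) x) n) \<le> e * cmod (coord x (nat (int n - a)))"
        "n \<notin> {n. N \<le> n \<and> a \<le> int n} \<Longrightarrow> coord ((T - S) x) n = 0"
        using N[of n] by (auto simp: norm_mult intro!: mult_right_mono)
    qed (use \<open>0 < e\<close> in \<open>auto simp: inj_on_def\<close>)
    ultimately show ?thesis by (auto simp: dist_norm norm_minus_commute)
  qed
  then have "T \<in> closure (residue_compacts l i)" by (simp add: closure_approachable_le)
  then show ?thesis using closed_residue_compacts by simp
qed



section \<open>Compact operators are the limits of finite matrices\<close>

lemma rank_proj_tendsto:
  fixes x :: "nat l2"
  shows "(\<lambda>N. rank_proj N x) \<longlonglongrightarrow> x"
proof (rule metric_LIMSEQ_I)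
  fix r :: real assume "0 < r"
  have "summable (\<lambda>i. (cmod (coord x i))\<^sup>2)"
    by (rule summable_on_imp_summable[OF coord_summable])
  moreover have "0 < (r / 2)\<^sup>2" using \<open>0 < r\<close> by simp
  ultimately obtain M where M: "\<And>m n. M \<le> m \<Longrightarrow> norm (\<Sum>i=m..<n. (cmod (coord x i))\<^sup>2) < (r / 2)\<^sup>2"
    unfolding summable_Cauchy by blast
  have "dist (rank_proj N x) x < r" if "M \<le> N" for N
  proof -
    have "norm (x - rank_proj N x) \<le> r / 2"
    proof (rule norm_l2_leI)
      fix F :: "nat set" assume F: "finite F"
      then obtain n where n: "F \<subseteq> {..<n}" using finite_nat_iff_bounded by blast
      have "(\<Sum>i\<in>F. (cmod (coord (x - rank_proj N x) i))\<^sup>2) = (\<Sum>i\<in>F \<inter> {N..}. (cmod (coord x i))\<^sup>2)"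
        unfolding sum.inter_restrict[OF F] by (rule sum.cong) (auto simp: coord_minus coord_rank_proj)
      also have "\<dots> \<le> (\<Sum>i=N..<n. (cmod (coord x i))\<^sup>2)"
        by (rule sum_mono2) (use n in auto)
      also have "\<dots> \<le> (r / 2)\<^sup>2" using M[OF that, of n] by simp
      finally show "(\<Sum>i\<in>F. (cmod (coord (x - rank_proj N x) i))\<^sup>2) \<le> (r / 2)\<^sup>2" .
    qed (use \<open>0 < r\<close> in simp)
    then show ?thesis using \<open>0 < r\<close> by (simp add: dist_norm norm_minus_commute)
  qed
  then show "\<exists>N. \<forall>n\<ge>N. dist (rank_proj n x) x < r" by blast
qed

lemma norm_scaleC: "norm (scaleC c x) = cmod c * norm x"
proof -
  have "(norm (scaleC c x))\<^sup>2 = (cmod c * norm x)\<^sup>2"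
    by (simp only: norm_l2_power2 scaleC.rep_eq norm_mult power_mult_distrib infsum_cmult_right')
  then show ?thesis by (rule power2_eq_imp_eq) auto
qed

lemma norm_scal_op_apply: "norm (scal_op c x) = cmod c * norm x"
  by (simp add: scal_op_apply norm_scaleC)

lemma coord_ket: "coord (ket a) i = (if i = a then 1 else 0)"
  by (simp add: ket.rep_eq)

lemma coord_scal_op_ket: "coord (scal_op c (ket a)) i = (if i = a then c else 0)"
  by (simp add: coord_scal_op coord_ket)

lemma rank_proj_expand: "rank_proj N x = (\<Sum>k<N. scal_op (coord x k) (ket k))"
  by (rule l2_eqI) (simp add: coord_rank_proj coord_sum coord_scal_op_ket)

lemma norm_ket: "norm (ket a) = 1"
proof (rule antisym)
  show "norm (ket a) \<le> 1"
  proof (rule norm_l2_leI)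
    fix F :: "'a set" assume F: "finite F"
    have "(\<Sum>i\<in>F. (cmod (coord (ket a) i))\<^sup>2) = (\<Sum>i\<in>F. if i = a then 1 else 0)"
      by (rule sum.cong) (auto simp: coord_ket)
    then show "(\<Sum>i\<in>F. (cmod (coord (ket a) i))\<^sup>2) \<le> 1\<^sup>2" using F by simp
  qed simp
  show "1 \<le> norm (ket a)" using norm_coord_le[of "ket a" a] by (simp add: coord_ket)
qed

definition complex_linear :: "('a l2 \<Rightarrow>\<^sub>L 'b l2) \<Rightarrow> bool" where
  "complex_linear T \<longleftrightarrow> (\<forall>c. T o\<^sub>L scal_op c = scal_op c o\<^sub>L T)"

lemma complex_linear_iff: "complex_linear T \<longleftrightarrow> (\<forall>c x. T (scaleC c x) = scaleC c (T x))"
  unfolding complex_linear_def by (metis blinfun_apply_blinfun_compose blinfun_eqI scal_op_apply)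

lemma complex_linear_scal_op: "complex_linear T \<Longrightarrow> T (scal_op c x) = scal_op c (T x)"
  by (simp add: complex_linear_iff scal_op_apply)

lemma complex_linear_rank_proj:
  assumes "complex_linear T"
  shows "coord (blinfun_apply T (rank_proj N x)) n = (\<Sum>k<N. coord (T (ket k)) n * coord x k)"
  unfolding rank_proj_expand
  by (simp add: blinfun.sum_right coord_sum complex_linear_scal_op[OF assms] coord_scal_op mult.commute)

text \<open>The \<open>n\<close>-th row of a bounded matrix is square summable, as one sees by applying the operator to the
  conjugate of a section of the row; Cauchy's inequality turns this into a norm estimate.\<close>

lemma row_tail_small:
  fixes T :: "nat l2 \<Rightarrow>\<^sub>L nat l2"
  assumes T: "complex_linear T" and e: "0 < e"
  obtains M where "\<And>x. cmod (coord (T (x - rank_proj M x)) n) \<le> e * norm x"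
proof -
  define a where "a k = coord (T (ket k)) n" for k
  note row = complex_linear_rank_proj[OF T, of _ _ n, folded a_def]
  have "(\<Sum>k<N. (cmod (a k))\<^sup>2) \<le> (norm T)\<^sup>2" for N
  proof -
    let ?s = "\<Sum>k<N. (cmod (a k))\<^sup>2"
    \<comment> \<open>the \<open>n\<close>-th coordinate of \<open>T x\<close> is \<open>\<parallel>x\<parallel>\<^sup>2\<close>, which forces \<open>\<parallel>x\<parallel> \<le> \<parallel>T\<parallel>\<close>\<close>
    define x where "x = (\<Sum>k<N. scal_op (cnj (a k)) (ket k))"
    have x: "coord x k = (if k < N then cnj (a k) else 0)" for k
      by (simp add: x_def coord_sum coord_scal_op_ket)
    have s0: "0 \<le> ?s" by (intro sum_nonneg) simp
    have "rank_proj N x = x" by (rule l2_eqI) (simp add: coord_rank_proj x)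
    then have "coord (T x) n = (\<Sum>k<N. a k * cnj (a k))"
      using row[of N x] by (simp add: x)
    also have "\<dots> = of_real ?s"
      by (simp only: complex_norm_square of_real_sum)
    finally have "?s = cmod (coord (T x) n)" using s0 by (metis norm_of_real abs_of_nonneg)
    also have "\<dots> \<le> norm (T x)" by (rule norm_coord_le)
    also have "\<dots> \<le> norm T * norm x" by (rule norm_blinfun)
    also have "norm x \<le> sqrt ?s"
    proof (rule norm_l2_leI)
      fix F :: "nat set" assume F: "finite F"
      have "(\<Sum>i\<in>F. (cmod (coord x i))\<^sup>2) = (\<Sum>i\<in>F \<inter> {..<N}. (cmod (a i))\<^sup>2)"
        unfolding sum.inter_restrict[OF F] by (rule sum.cong) (auto simp: x)
      also have "\<dots> \<le> ?s" by (rule sum_mono2) auto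
      finally show "(\<Sum>i\<in>F. (cmod (coord x i))\<^sup>2) \<le> (sqrt ?s)\<^sup>2" using s0 by simp
    qed (use s0 in simp)
    finally have "sqrt ?s * sqrt ?s \<le> norm T * sqrt ?s" using s0 by (simp add: mult_left_mono)
    then have "sqrt ?s \<le> norm T"
    proof (cases "?s = 0")
      case False
      then have "0 < sqrt ?s" using s0 by simp
      then show ?thesis using \<open>sqrt ?s * sqrt ?s \<le> norm T * sqrt ?s\<close> mult_right_le_imp_le by blast
    next
      case True then show ?thesis by (simp only: real_sqrt_zero norm_ge_zero)
    qed
    then have "(sqrt ?s)\<^sup>2 \<le> (norm T)\<^sup>2" by (rule power_mono) (use s0 in simp)
    then show ?thesis using s0 by simp
  qed
  then have "summable (\<lambda>k. (cmod (a k))\<^sup>2)" by (intro summableI_nonneg_bounded) auto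
  moreover have "0 < e\<^sup>2" using e by simp
  ultimately obtain M where M: "\<And>N. norm (\<Sum>k=M..<N. (cmod (a k))\<^sup>2) < e\<^sup>2"
    unfolding summable_Cauchy by blast
  have "cmod (coord (T (x - rank_proj M x)) n) \<le> e * norm x" for x
  proof (rule LIMSEQ_le_const2)
    have "(\<lambda>N. T (rank_proj N x - rank_proj M x)) \<longlonglongrightarrow> T (x - rank_proj M x)"
      by (intro tendsto_intros rank_proj_tendsto)
    moreover have "bounded_linear (\<lambda>y :: nat l2. coord y n)"
      by (rule bounded_linear_intro[where K = 1])
        (auto simp: coord_add scaleR_l2.rep_eq norm_coord_le)
    ultimately show "(\<lambda>N. cmod (coord (T (rank_proj N x - rank_proj M x)) n)) \<longlonglongrightarrow> cmod (coord (T (x - rank_proj M x)) n)"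
      by (intro tendsto_norm bounded_linear.tendsto[of "\<lambda>y. coord y n"])
    have "cmod (coord (T (rank_proj N x - rank_proj M x)) n) \<le> e * norm x" if "M \<le> N" for N
    proof -
      have "coord (T (rank_proj N x - rank_proj M x)) n = (\<Sum>k<N. a k * coord x k) - (\<Sum>k<M. a k * coord x k)"
        by (simp add: blinfun.diff_right coord_minus row)
      also have "\<dots> = (\<Sum>k=M..<N. a k * coord x k)"
        using sum_diff_nat_ivl[of 0 M N "\<lambda>k. a k * coord x k"] that by (simp add: lessThan_atLeast0)
      finally have "cmod (coord (T (rank_proj N x - rank_proj M x)) n) \<le> (\<Sum>k=M..<N. \<bar>cmod (a k)\<bar> * \<bar>cmod (coord x k)\<bar>)"
        by (simp add: norm_mult[symmetric] norm_sum)
      also have "\<dots> \<le> L2_set (\<lambda>k. cmod (a k)) {M..<N} * L2_set (\<lambda>k. cmod (coord x k)) {M..<N}"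
        by (rule L2_set_mult_ineq)
      also have "\<dots> \<le> e * norm x"
      proof (rule mult_mono)
        have "(\<Sum>k=M..<N. (cmod (a k))\<^sup>2) \<le> e\<^sup>2" using M[of N] by simp
        then show "L2_set (\<lambda>k. cmod (a k)) {M..<N} \<le> e"
          unfolding L2_set_def using e real_le_lsqrt by (simp add: sum_nonneg)
        show "L2_set (\<lambda>k. cmod (coord x k)) {M..<N} \<le> norm x"
          unfolding L2_set_def by (intro real_le_lsqrt sum_coord_le norm_ge_zero) (auto intro: sum_nonneg)
      qed (use e in auto)
      finally show ?thesis .
    qed
    then show "\<exists>N. \<forall>n'\<ge>N. cmod (coord (T (rank_proj n' x - rank_proj M x)) n) \<le> e * norm x" by blast
  qed
  then show ?thesis by (rule that)
qed

text \<open>Every bounded complex linear operator has rows that are limits of finite rows; compactness is what makes finitely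
  many rows suffice, see \<open>compact_ops_section\<close>.\<close>

lemma row_residue_compacts:
  assumes T: "complex_linear T"
  shows "matrix_unit 1 n n o\<^sub>L T \<in> residue_compacts 1 0"
proof -
  have "\<exists>S\<in>residue_compacts 1 0. dist S (matrix_unit 1 n n o\<^sub>L T) \<le> e" if e: "0 < e" for e
  proof -
    obtain M where M: "\<And>x. cmod (coord (T (x - rank_proj M x)) n) \<le> e * norm x"
      using row_tail_small[OF T e] by blast
    define S where "S = (\<Sum>k<M. matrix_unit (coord (T (ket k)) n) n k)"
    have "S \<in> residue_compacts 1 0"
      unfolding S_def by (intro subspace_sum subspace_residue_compacts matrix_unit_residue_compacts) auto
    moreover have "norm ((matrix_unit 1 n n o\<^sub>L T) - S) \<le> e"
    proof (rule norm_blinfun_bound)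
      fix x
      have "S x = matrix_unit 1 n n (T (rank_proj M x))"
        by (rule l2_eqI)
          (simp add: S_def coord_matrix_unit complex_linear_rank_proj[OF T] blinfun_apply_sum coord_sum)
      then have c: "coord (((matrix_unit 1 n n o\<^sub>L T) - S) x) k = (if k = n then coord (T (x - rank_proj M x)) n else 0)" for k
        by (simp add: blinfun.diff_left blinfun.diff_right coord_minus coord_matrix_unit)
      show "norm (((matrix_unit 1 n n o\<^sub>L T) - S) x) \<le> e * norm x"
      proof (rule norm_l2_leI)
        fix F :: "nat set" assume F: "finite F"
        have "(\<Sum>i\<in>F. (cmod (coord (((matrix_unit 1 n n o\<^sub>L T) - S) x) i))\<^sup>2)
            = (\<Sum>i\<in>F. if i = n then (cmod (coord (T (x - rank_proj M x)) n))\<^sup>2 else 0)"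
          unfolding c by (rule sum.cong) auto
        also have "\<dots> \<le> (cmod (coord (T (x - rank_proj M x)) n))\<^sup>2" using F by simp
        also have "\<dots> \<le> (e * norm x)\<^sup>2" by (intro power_mono M norm_ge_zero)
        finally show "(\<Sum>i\<in>F. (cmod (coord (((matrix_unit 1 n n o\<^sub>L T) - S) x) i))\<^sup>2) \<le> (e * norm x)\<^sup>2" .
      qed (use e in simp)
    qed (use e in simp)
    ultimately show ?thesis
      by (intro bexI[of _ S]) (simp_all only: dist_norm norm_minus_commute[of S])
  qed
  then have "matrix_unit 1 n n o\<^sub>L T \<in> closure (residue_compacts 1 0)" by (simp add: closure_approachable_le)
  then show ?thesis using closed_residue_compacts by simp
qed

lemma compact_closure_iff_finite_nets:
  fixes S :: "'a::complete_space set"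
  shows "compact (closure S) \<longleftrightarrow> (\<forall>e>0. \<exists>k. finite k \<and> S \<subseteq> (\<Union>x\<in>k. ball x e))"
proof
  assume "compact (closure S)"
  then have "\<forall>e>0. \<exists>k. finite k \<and> closure S \<subseteq> (\<Union>x\<in>k. ball x e)"
    unfolding compact_eq_totally_bounded by blast
  then show "\<forall>e>0. \<exists>k. finite k \<and> S \<subseteq> (\<Union>x\<in>k. ball x e)"
    using closure_subset by (metis subset_trans)
next
  assume nets: "\<forall>e>0. \<exists>k. finite k \<and> S \<subseteq> (\<Union>x\<in>k. ball x e)"
  have "\<exists>k. finite k \<and> closure S \<subseteq> (\<Union>x\<in>k. ball x e)" if e: "0 < e" for e
  proof -
    obtain k where k: "finite k" "S \<subseteq> (\<Union>x\<in>k. ball x (e / 2))"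
      using nets half_gt_zero[OF e] by blast
    have "closure S \<subseteq> (\<Union>x\<in>k. cball x (e / 2))"
    proof (rule closure_minimal)
      show "S \<subseteq> (\<Union>x\<in>k. cball x (e / 2))" using k(2) ball_subset_cball by blast
      show "closed (\<Union>x\<in>k. cball x (e / 2))" using k(1) by (intro closed_UN) auto
    qed
    also have "\<dots> \<subseteq> (\<Union>x\<in>k. ball x e)" using e by force
    finally show ?thesis using k(1) by blast
  qed
  then show "compact (closure S)"
    unfolding compact_eq_totally_bounded by (simp add: complete_eq_closed)
qed

lemma compact_closure_subset:
  fixes K :: "'a::t2_space set"
  assumes "compact K" "S \<subseteq> K"
  shows "compact (closure S)"
proof -
  have "closure S \<subseteq> K" using assms by (intro closure_minimal compact_imp_closed)
  then have "closure S \<inter> K = closure S" by blast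
  then show ?thesis using closed_Int_compact[OF closed_closure[of S] assms(1)] by (simp only:)
qed

text \<open>On the finitely many points of a net of the image of the unit ball the truncations \<open>rank_proj N\<close> converge
  uniformly, and the complementary projections are contractions, so the error on the whole image is as small as on the
  net.\<close>

lemma compact_ops_section:
  fixes T :: "nat l2 \<Rightarrow>\<^sub>L nat l2"
  assumes "T \<in> compact_ops" and e: "0 < e"
  obtains N where "norm (T - (rank_proj N o\<^sub>L T)) \<le> e"
proof -
  have "compact (closure (T ` cball 0 1))" using assms(1) by (simp add: compact_ops_def)
  then obtain k where k: "finite k" "T ` cball 0 1 \<subseteq> (\<Union>y\<in>k. ball y (e / 2))"
    unfolding compact_closure_iff_finite_nets using half_gt_zero[OF e] by blast
  have "\<forall>\<^sub>F N in sequentially. \<forall>y\<in>k. dist (rank_proj N y) y < e / 2"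
    using tendstoD[OF rank_proj_tendsto half_gt_zero[OF e]] by (intro eventually_ball_finite k(1) ballI)
  then obtain N where N: "\<And>y. y \<in> k \<Longrightarrow> dist (rank_proj N y) y < e / 2"
    unfolding eventually_sequentially by blast
  have cut: "norm (id_blinfun - rank_proj N) \<le> 1"
    by (rule norm_op_leI[where S = "{N..}" and h = id])
      (auto simp: blinfun.diff_left coord_minus coord_rank_proj)
  have unit: "norm ((T - (rank_proj N o\<^sub>L T)) x) \<le> e" if x: "norm x \<le> 1" for x
  proof -
    obtain y where y: "y \<in> k" "dist y (T x) < e / 2" using k(2) x by fastforce
    have "(T - (rank_proj N o\<^sub>L T)) x = (id_blinfun - rank_proj N) (T x - y) + (y - rank_proj N y)"
      by (simp add: blinfun.diff_left blinfun.diff_right)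
    also have "norm \<dots> \<le> norm ((id_blinfun - rank_proj N) (T x - y)) + norm (y - rank_proj N y)"
      by (rule norm_triangle_ineq)
    also have "norm ((id_blinfun - rank_proj N) (T x - y)) \<le> norm (T x - y)"
      using order_trans[OF norm_blinfun mult_right_mono[OF cut norm_ge_zero]] by simp
    finally show ?thesis
      using y N[OF y(1)] unfolding dist_norm by (simp add: norm_minus_commute)
  qed
  have "norm (T - (rank_proj N o\<^sub>L T)) \<le> e"
  proof (rule norm_blinfun_bound)
    fix x
    show "norm ((T - (rank_proj N o\<^sub>L T)) x) \<le> e * norm x"
    proof (cases "x = 0")
      case False
      have "norm ((T - (rank_proj N o\<^sub>L T)) (x /\<^sub>R norm x)) \<le> e"
        by (rule unit) (use False in simp)
      then show ?thesis
        using False by (simp add: blinfun.scaleR_right divide_simps mult.commute)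
    qed simp
  qed (use e in simp)
  then show ?thesis by (rule that)
qed

lemma compact_ops_subset_matrix_closure: "compact_ops \<subseteq> residue_compacts 1 0"
proof
  fix T :: "nat l2 \<Rightarrow>\<^sub>L nat l2" assume T: "T \<in> compact_ops"
  then have lin: "complex_linear T" by (simp add: compact_ops_def complex_linear_iff)
  have "rank_proj N o\<^sub>L T \<in> residue_compacts 1 0" for N
  proof -
    have "rank_proj N o\<^sub>L T = (\<Sum>n<N. matrix_unit 1 n n o\<^sub>L T)"
      by (intro blinfun_eqI l2_eqI) (simp add: coord_rank_proj blinfun_apply_sum coord_sum coord_matrix_unit)
    then show ?thesis
      by (simp only:) (intro subspace_sum subspace_residue_compacts row_residue_compacts lin)
  qed
  then have "\<exists>S\<in>residue_compacts 1 0. dist S T \<le> e" if "0 < e" for e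
    using compact_ops_section[OF T that] by (metis dist_norm norm_minus_commute)
  then have "T \<in> closure (residue_compacts 1 0)" by (simp add: closure_approachable_le)
  then show "T \<in> residue_compacts 1 0" using closed_residue_compacts by simp
qed

text \<open>Compactness of the closed image of the ball is preserved by linear combinations and, in the form of finite nets,
  by norm limits, so it is enough to look at matrix units.\<close>

lemma matrix_closure_subset_compact_ops: "residue_compacts 1 0 \<subseteq> compact_ops"
proof -
  define C where "C = {T :: nat l2 \<Rightarrow>\<^sub>L nat l2. compact (closure (T ` cball 0 1))}"
  have "subspace C"
  proof (rule subspaceI)
    show "0 \<in> C" by (simp add: C_def image_constant_conv)
  next
    fix S T assume "S \<in> C" "T \<in> C"
    then have c: "compact {x + y |x y. x \<in> closure (S ` cball 0 1) \<and> y \<in> closure (T ` cball 0 1)}" (is "compact ?K")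
      unfolding C_def by (intro compact_sums) auto
    have "(S + T) ` cball 0 1 \<subseteq> ?K"
      unfolding blinfun.add_left using closure_subset by blast
    then show "S + T \<in> C"
      unfolding C_def using compact_closure_subset[OF c] by blast
  next
    fix r T assume "T \<in> C"
    then have c: "compact ((*\<^sub>R) r ` closure (T ` cball 0 1))"
      unfolding C_def by (intro compact_scaling) auto
    have "(r *\<^sub>R T) ` cball 0 1 \<subseteq> (*\<^sub>R) r ` closure (T ` cball 0 1)"
      unfolding blinfun.scaleR_left using closure_subset by blast
    then show "r *\<^sub>R T \<in> C"
      unfolding C_def using compact_closure_subset[OF c] by blast
  qed
  moreover have "closed C"
  proof -
    have "T \<in> C" if T: "T \<in> closure C" for T
      unfolding C_def mem_Collect_eq compact_closure_iff_finite_nets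
    proof (intro allI impI)
      fix e :: real assume e: "0 < e"
      then obtain S where S: "S \<in> C" "dist S T < e / 2"
        using T half_gt_zero[OF e] unfolding closure_approachable by blast
      then obtain k where k: "finite k" "S ` cball 0 1 \<subseteq> (\<Union>x\<in>k. ball x (e / 2))"
        unfolding C_def compact_closure_iff_finite_nets using half_gt_zero[OF e] by blast
      have "T x \<in> (\<Union>x\<in>k. ball x e)" if x: "x \<in> cball 0 1" for x
      proof -
        obtain y where y: "y \<in> k" "dist y (S x) < e / 2" using k(2) x by fastforce
        have "norm (S x - T x) \<le> norm (S - T) * norm x"
          unfolding blinfun.diff_left[symmetric] by (rule norm_blinfun)
        also have "\<dots> \<le> norm (S - T)" using x by (simp add: mult_left_le)
        also have "\<dots> < e / 2" using S(2) by (simp add: dist_norm)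
        finally have "dist y (T x) < e"
          using dist_triangle[of y "T x" "S x"] y(2) by (simp add: dist_norm)
        then show ?thesis using y(1) by auto
      qed
      then show "\<exists>k. finite k \<and> T ` cball 0 1 \<subseteq> (\<Union>x\<in>k. ball x e)" using k(1) by blast
    qed
    then show ?thesis using closure_subset_eq by blast
  qed
  moreover have "matrix_unit c a b \<in> C" for c a b
  proof -
    \<comment> \<open>the complex line through \<open>ket a\<close>, written with real scalars to make continuity evident\<close>
    define f where "f = (\<lambda>z. Re z *\<^sub>R ket a + Im z *\<^sub>R scal_op \<i> (ket a))"
    have f: "f z = scal_op z (ket a)" for z
      by (rule l2_eqI) (simp add: f_def coord_add scaleR_l2.rep_eq coord_scal_op coord_ket scaleR_conv_of_real
          complex_eq_iff)
    have "compact (f ` cball 0 (cmod c))"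
      by (intro compact_continuous_image compact_cball) (auto simp: f_def intro!: continuous_intros)
    moreover have "matrix_unit c a b ` cball 0 1 \<subseteq> f ` cball 0 (cmod c)"
    proof
      fix y assume "y \<in> matrix_unit c a b ` cball 0 1"
      then obtain x where x: "norm x \<le> 1" "y = matrix_unit c a b x" by auto
      have "y = f (c * coord x b)"
        unfolding f x(2) by (rule l2_eqI) (simp add: coord_matrix_unit coord_scal_op coord_ket)
      moreover have "cmod (c * coord x b) \<le> cmod c"
        using order_trans[OF norm_coord_le[of x b] x(1)] by (simp add: norm_mult mult_left_le)
      ultimately show "y \<in> f ` cball 0 (cmod c)" by auto
    qed
    ultimately show ?thesis
      unfolding C_def using compact_closure_subset by blast
  qed
  ultimately have "residue_compacts 1 0 \<subseteq> C" by (intro residue_compacts_minimal)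
  moreover have "residue_compacts 1 0 \<subseteq> {T. complex_linear T}"
  proof (rule residue_compacts_minimal)
    show "closed {T :: nat l2 \<Rightarrow>\<^sub>L nat l2. complex_linear T}"
      unfolding complex_linear_def Collect_all_eq
      by (intro closed_INT ballI closed_Collect_eq linear_continuous_on linear_compose_left linear_compose_right)
    show "subspace {T :: nat l2 \<Rightarrow>\<^sub>L nat l2. complex_linear T}"
      by (rule subspaceI) (simp_all add: complex_linear_def op_compose_add op_compose_scaleR)
    show "matrix_unit c a b \<in> {T. complex_linear T}" for c and a b :: nat
      by (auto simp: complex_linear_def coord_scal_op coord_matrix_unit intro!: blinfun_eqI l2_eqI)
  qed
  ultimately show ?thesis by (auto simp: compact_ops_def C_def complex_linear_iff)
qed


section \<open>The unitization of the direct sum of copies of the compacts\<close>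

lemma copy_index_iff:
  fixes l :: nat
  assumes "1 \<le> l" "s \<in> {1..l}"
  shows "k = l * p + s - 1 \<longleftrightarrow> k mod l = s - 1 \<and> k div l = p"
proof -
  obtain t where t: "s = Suc t" "t < l" using assms by (cases s) auto
  show ?thesis unfolding t(1) using t(2) mult_div_mod_eq[of l k] by auto
qed

lemma inj_copy: "1 \<le> l \<Longrightarrow> 1 \<le> s \<Longrightarrow> inj (\<lambda>p. l * p + s - 1 :: nat)"
proof (rule injI)
  fix x y assume "1 \<le> l" "1 \<le> s" "l * x + s - 1 = l * y + s - 1"
  then have "l * x = l * y" by linarith
  then show "x = y" using \<open>1 \<le> l\<close> by simp
qed

lemma coord_copy_embed_adjoint:
  assumes "1 \<le> l" "1 \<le> s"
  shows "coord (op_adjoint (copy_embed l s) x) p = coord x (l * p + s - 1)"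
  using op_adjoint_weighted_shift(1)[OF inj_copy[OF assms], of "\<lambda>_. 1" 1] by (simp add: copy_embed_def)

lemma coord_copy_embed:
  assumes "1 \<le> l" "s \<in> {1..l}"
  shows "coord (copy_embed l s x) k = (if k mod l = s - 1 then coord x (k div l) else 0)"
proof (cases "k mod l = s - 1")
  case True
  then have k: "k = l * (k div l) + s - 1"
    using assms(2) mult_div_mod_eq[of l k] by auto
  have "coord (copy_embed l s x) (l * (k div l) + s - 1) = 1 * coord x (k div l)"
    unfolding copy_embed_def using assms by (intro coord_weighted_shift_image(1)[where C = 1] inj_copy) auto
  then show ?thesis using k True by simp
next
  case False
  then have "k \<notin> range (\<lambda>p. l * p + s - 1)"
    using copy_index_iff[OF assms, of k] by auto
  then have "coord (copy_embed l s x) k = 0"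
    unfolding copy_embed_def using assms by (intro coord_weighted_shift_image(2)[where C = 1] inj_copy) auto
  then show ?thesis using False by simp
qed

lemma coord_direct_sum:
  assumes "1 \<le> l"
  shows "coord (direct_sum l K x) k =
    coord (K (k mod l + 1) (op_adjoint (copy_embed l (k mod l + 1)) x)) (k div l)"
proof -
  have "coord (direct_sum l K x) k =
      (\<Sum>s = 1..l. if s = k mod l + 1 then coord (K s (op_adjoint (copy_embed l s) x)) (k div l) else 0)"
    unfolding direct_sum_def blinfun_apply_sum coord_sum
    by (rule sum.cong) (use assms in \<open>auto simp: coord_copy_embed\<close>)
  also have "\<dots> = coord (K (k mod l + 1) (op_adjoint (copy_embed l (k mod l + 1)) x)) (k div l)"
    using assms by (auto simp: Suc_le_eq)
  finally show ?thesis .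
qed

lemma copy_matrix_unit:
  assumes "1 \<le> l" "s \<in> {1..l}"
  shows "copy_embed l s o\<^sub>L matrix_unit c a b o\<^sub>L op_adjoint (copy_embed l s) =
    matrix_unit c (l * a + s - 1) (l * b + s - 1)"
proof -
  have "coord ((copy_embed l s o\<^sub>L matrix_unit c a b o\<^sub>L op_adjoint (copy_embed l s)) x) k =
      coord (matrix_unit c (l * a + s - 1) (l * b + s - 1) x) k" for x k
    unfolding coord_matrix_unit copy_index_iff[OF assms]
    using assms by (auto simp: coord_copy_embed coord_matrix_unit coord_copy_embed_adjoint)
  then show ?thesis by (intro blinfun_eqI l2_eqI)
qed

lemma direct_sum_residue_compacts:
  assumes "1 \<le> l" and "\<forall>s\<in>{1..l}. K s \<in> compact_ops"
  shows "direct_sum l K \<in> residue_compacts l 0"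
  unfolding direct_sum_def
proof (intro subspace_sum subspace_residue_compacts)
  fix s assume s: "s \<in> {1..l}"
  show "copy_embed l s o\<^sub>L K s o\<^sub>L op_adjoint (copy_embed l s) \<in> residue_compacts l 0"
  proof (rule residue_compacts_map[where f = "\<lambda>T. copy_embed l s o\<^sub>L T o\<^sub>L op_adjoint (copy_embed l s)"])
    show "bounded_linear (\<lambda>T. copy_embed l s o\<^sub>L T o\<^sub>L op_adjoint (copy_embed l s))"
      by (rule bounded_linear_compose[OF linear_compose_right linear_compose_left])
    show "K s \<in> residue_compacts 1 0" using assms(2) s compact_ops_subset_matrix_closure by blast
    fix c a b
    show "copy_embed l s o\<^sub>L matrix_unit c a b o\<^sub>L op_adjoint (copy_embed l s) \<in> residue_compacts l 0"
      unfolding copy_matrix_unit[OF assms(1) s]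
      using s by (intro matrix_unit_residue_compacts) (auto simp: of_nat_diff algebra_simps simp flip: right_diff_distrib)
  qed
qed

text \<open>The summands of \<open>R\<close> are its diagonal corners.  An operator is the sum of these corners if it respects residues
  modulo \<open>l\<close>, and this only has to be checked on matrix units.\<close>

lemma residue_compacts_direct_sum:
  assumes "1 \<le> l" and "R \<in> residue_compacts l 0"
  shows "\<exists>K. (\<forall>s\<in>{1..l}. K s \<in> compact_ops) \<and> direct_sum l K = R"
proof (intro exI conjI ballI)
  define corner where "corner = (\<lambda>R s. op_adjoint (copy_embed l s) o\<^sub>L R o\<^sub>L copy_embed l s)"
  have bl: "bounded_linear (\<lambda>R. corner R s)" for s
    unfolding corner_def by (rule bounded_linear_compose[OF linear_compose_right linear_compose_left])
  show "corner R s \<in> compact_ops" if s: "s \<in> {1..l}" for s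
  proof -
    have "corner R s \<in> residue_compacts 1 0"
    proof (rule residue_compacts_map[OF bl _ assms(2)])
      fix c a b
      have "corner (matrix_unit c a b) s =
        (if a mod l = s - 1 \<and> b mod l = s - 1 then matrix_unit c (a div l) (b div l) else 0)"
      proof (intro blinfun_eqI l2_eqI)
        fix x p
        have "l * p + s - 1 = a \<longleftrightarrow> a mod l = s - 1 \<and> a div l = p"
          using copy_index_iff[OF assms(1) s, of a p] by auto
        then show "coord (corner (matrix_unit c a b) s x) p =
          coord ((if a mod l = s - 1 \<and> b mod l = s - 1 then matrix_unit c (a div l) (b div l) else 0) x) p"
          using s assms(1)
          by (auto simp: corner_def coord_copy_embed_adjoint coord_matrix_unit coord_copy_embed)
      qed
      then show "corner (matrix_unit c a b) s \<in> residue_compacts 1 0"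
        using subspace_0[OF subspace_residue_compacts] by (simp add: matrix_unit_residue_compacts)
    qed
    then show ?thesis using matrix_closure_subset_compact_ops by blast
  qed
  have sum_bl: "bounded_linear (\<lambda>R. direct_sum l (corner R))"
    unfolding direct_sum_def
    by (intro bounded_linear_sum bounded_linear_compose[OF linear_compose_right] bounded_linear_compose[OF linear_compose_left] bl)
  have "residue_compacts l 0 \<subseteq> {R. direct_sum l (corner R) = R}"
  proof (rule residue_compacts_minimal)
    show "closed {R. direct_sum l (corner R) = R}"
      by (intro closed_Collect_eq linear_continuous_on sum_bl continuous_on_id)
    interpret ds: bounded_linear "\<lambda>R. direct_sum l (corner R)" by (rule sum_bl)
    show "subspace {R. direct_sum l (corner R) = R}"
      by (rule subspaceI) (simp_all add: ds.zero ds.add ds.scaleR)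
    fix c a b assume ab: "int l dvd int a - int b + 0"
    then have "int a mod int l = int b mod int l" by (simp add: mod_eq_dvd_iff)
    then have m: "a mod l = b mod l" by (simp flip: of_nat_mod)
    have "coord (direct_sum l (corner (matrix_unit c a b)) x) k = coord (matrix_unit c a b x) k" for x k
      using assms(1) m
      by (auto simp: coord_direct_sum corner_def coord_copy_embed_adjoint coord_copy_embed coord_matrix_unit Suc_le_eq)
    then show "matrix_unit c a b \<in> {R. direct_sum l (corner R) = R}"
      by (auto intro!: blinfun_eqI l2_eqI)
  qed
  then show "direct_sum l (corner R) = R" using assms(2) by blast
qed

definition compacts_plus_line :: "nat \<Rightarrow> int \<Rightarrow> (nat l2 \<Rightarrow>\<^sub>L nat l2) \<Rightarrow> (nat l2 \<Rightarrow>\<^sub>L nat l2) set" where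
  "compacts_plus_line l i V = {R + (scal_op c o\<^sub>L V) | R c. R \<in> residue_compacts l i}"

lemma compact_sum_unitization_eq:
  assumes "1 \<le> l"
  shows "compact_sum_unitization l = compacts_plus_line l 0 id_blinfun"
  unfolding compact_sum_unitization_def compacts_plus_line_def op_compose_id
  using direct_sum_residue_compacts[OF assms] residue_compacts_direct_sum[OF assms] by blast

section \<open>The module of compacts and multiples of a shift\<close>

text \<open>A compact operator sends the weakly null sequence of kets to a norm null sequence.\<close>

lemma residue_compacts_ket_tendsto:
  assumes "R \<in> residue_compacts l i"
  shows "(\<lambda>b. R (ket b)) \<longlonglongrightarrow> 0"
proof -
  define S where "S = {R :: nat l2 \<Rightarrow>\<^sub>L nat l2. (\<lambda>b. R (ket b)) \<longlonglongrightarrow> 0}"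
  have "residue_compacts l i \<subseteq> S"
  proof (rule residue_compacts_minimal)
    show "subspace S"
      by (rule subspaceI) (auto simp: S_def blinfun.add_left blinfun.scaleR_left intro: tendsto_add_zero tendsto_scaleR[OF tendsto_const, of _ 0, simplified])
    have "T \<in> S" if T: "T \<in> closure S" for T
      unfolding S_def mem_Collect_eq
    proof (rule metric_LIMSEQ_I)
      fix e :: real assume e: "0 < e"
      then obtain R where R: "R \<in> S" "dist R T < e / 2"
        using T half_gt_zero[OF e] unfolding closure_approachable by blast
      then obtain N where N: "\<And>b. N \<le> b \<Longrightarrow> norm (R (ket b)) < e / 2"
        using LIMSEQ_D[of "\<lambda>b. R (ket b)" 0 "e / 2"] half_gt_zero[OF e] unfolding S_def by auto
      have "norm (T (ket b)) < e" if "N \<le> b" for b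
      proof -
        have "norm (T (ket b)) \<le> norm ((T - R) (ket b)) + norm (R (ket b))"
          using norm_triangle_ineq[of "(T - R) (ket b)" "R (ket b)"] by (simp add: blinfun.diff_left)
        also have "norm ((T - R) (ket b)) \<le> norm (T - R)"
          using norm_blinfun[of "T - R" "ket b"] by (simp only: norm_ket mult_1_right)
        finally show ?thesis using R(2) N[OF that] by (simp add: dist_norm norm_minus_commute)
      qed
      then show "\<exists>N. \<forall>b\<ge>N. dist (T (ket b)) 0 < e" by auto
    qed
    then show "closed S" using closure_subset_eq by blast
    fix c and a b :: nat
    have "matrix_unit c a b (ket k) = 0" if "b < k" for k
      using that by (intro l2_eqI) (auto simp: coord_matrix_unit coord_ket)
    then have "\<forall>\<^sub>F k in sequentially. matrix_unit c a b (ket k) = 0"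
      unfolding eventually_sequentially by (metis Suc_le_lessD)
    then show "matrix_unit c a b \<in> S" unfolding S_def by (simp add: tendsto_eventually)
  qed
  then show ?thesis using assms unfolding S_def by blast
qed

text \<open>Along the kets on which \<open>V\<close> has unit entries the compact part dies out, so the scalar is bounded by the
  norm of the whole operator; it therefore converges along every convergent sequence.\<close>

lemma compacts_plus_line_scalar:
  fixes V :: "nat l2 \<Rightarrow>\<^sub>L nat l2"
  assumes R: "R \<in> residue_compacts l i" and h: "filterlim h at_top sequentially"
    and V: "\<And>k :: nat. coord (V (ket (h k))) (g k) = 1"
  shows "cmod c \<le> norm (R + (scal_op c o\<^sub>L V))"
proof (rule LIMSEQ_le_const)
  have "(\<lambda>k. R (ket (h k))) \<longlonglongrightarrow> 0"
    by (rule filterlim_compose[OF residue_compacts_ket_tendsto[OF R] h])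
  from tendsto_add[OF tendsto_const[of "norm (R + (scal_op c o\<^sub>L V))"] tendsto_norm_zero[OF this]]
  show "(\<lambda>k. norm (R + (scal_op c o\<^sub>L V)) + norm (R (ket (h k)))) \<longlonglongrightarrow> norm (R + (scal_op c o\<^sub>L V))"
    by simp
  have "cmod c \<le> norm (R + (scal_op c o\<^sub>L V)) + norm (R (ket (h k)))" for k
  proof -
    have "cmod c = cmod (coord (scal_op c (V (ket (h k)))) (g k))" by (simp add: coord_scal_op V)
    also have "\<dots> \<le> norm (scal_op c (V (ket (h k))))" by (rule norm_coord_le)
    also have "scal_op c (V (ket (h k))) = (R + (scal_op c o\<^sub>L V)) (ket (h k)) - R (ket (h k))"
      by (simp add: blinfun.add_left)
    also have "norm \<dots> \<le> norm ((R + (scal_op c o\<^sub>L V)) (ket (h k))) + norm (R (ket (h k)))"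
      by (rule norm_triangle_ineq4)
    also have "norm ((R + (scal_op c o\<^sub>L V)) (ket (h k))) \<le> norm (R + (scal_op c o\<^sub>L V))"
      using norm_blinfun[of "R + (scal_op c o\<^sub>L V)" "ket (h k)"] by (simp only: norm_ket mult_1_right)
    finally show ?thesis by simp
  qed
  then show "\<exists>N. \<forall>k\<ge>N. cmod c \<le> norm (R + (scal_op c o\<^sub>L V)) + norm (R (ket (h k)))" by blast
qed

lemma scal_op_minus: "scal_op (c - d) = scal_op c - scal_op d"
  by (simp add: eq_diff_eq flip: scal_op_add)

lemma norm_scal_op_le: "norm (scal_op c) \<le> cmod c"
  by (rule norm_blinfun_bound) (simp_all add: norm_scal_op_apply)

lemma closed_compacts_plus_line:
  fixes V :: "nat l2 \<Rightarrow>\<^sub>L nat l2"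
  assumes h: "filterlim h at_top sequentially" and V: "\<And>k :: nat. coord (V (ket (h k))) (g k) = 1"
  shows "closed (compacts_plus_line l i V)"
  unfolding closed_sequential_limits
proof (intro allI impI, elim conjE)
  fix X T assume X: "\<forall>n. X n \<in> compacts_plus_line l i V" and lim: "X \<longlonglongrightarrow> T"
  then have "\<exists>R c. \<forall>n. R n \<in> residue_compacts l i \<and> X n = R n + (scal_op (c n) o\<^sub>L V)"
    unfolding compacts_plus_line_def mem_Collect_eq by metis
  then obtain R c where R: "\<And>n. R n \<in> residue_compacts l i" and Xeq: "\<And>n. X n = R n + (scal_op (c n) o\<^sub>L V)"
    by blast
  have diff: "cmod (c m - c n) \<le> norm (X m - X n)" for m n
  proof -
    have eq: "X m - X n = (R m - R n) + (scal_op (c m - c n) o\<^sub>L V)"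
      unfolding Xeq by (rule blinfun_eqI) (simp add: scal_op_minus blinfun.add_left blinfun.diff_left)
    have "R m - R n \<in> residue_compacts l i"
      by (intro subspace_diff subspace_residue_compacts R)
    from compacts_plus_line_scalar[where h = h and g = g and V = V, OF this h V, of "c m - c n"]
    show ?thesis unfolding eq .
  qed
  have "Cauchy c"
  proof (rule metric_CauchyI)
    fix e :: real assume "0 < e"
    then obtain M where "\<forall>m\<ge>M. \<forall>n\<ge>M. dist (X m) (X n) < e"
      using metric_CauchyD[OF LIMSEQ_imp_Cauchy[OF lim]] by blast
    then show "\<exists>M. \<forall>m\<ge>M. \<forall>n\<ge>M. dist (c m) (c n) < e"
      using diff unfolding dist_norm by (meson le_less_trans)
  qed
  then obtain d where d: "c \<longlonglongrightarrow> d" unfolding Cauchy_convergent_iff convergent_def by blast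
  have "(\<lambda>n. scal_op (c n) :: nat l2 \<Rightarrow>\<^sub>L nat l2) \<longlonglongrightarrow> scal_op d"
  proof (rule LIM_zero_cancel, rule tendsto_norm_zero_cancel, rule tendsto_sandwich[of "\<lambda>_. 0"])
    show "(\<lambda>n. cmod (c n - d)) \<longlonglongrightarrow> 0" by (rule tendsto_norm_zero[OF LIM_zero[OF d]])
    show "\<forall>\<^sub>F n in sequentially. norm (scal_op (c n) - scal_op d :: nat l2 \<Rightarrow>\<^sub>L nat l2) \<le> cmod (c n - d)"
      unfolding scal_op_minus[symmetric] by (simp add: norm_scal_op_le)
  qed simp_all
  then have "(\<lambda>n. scal_op (c n) o\<^sub>L V) \<longlonglongrightarrow> (scal_op d o\<^sub>L V)"
    by (rule bounded_linear.tendsto[OF linear_compose_right])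
  then have "(\<lambda>n. X n - (scal_op (c n) o\<^sub>L V)) \<longlonglongrightarrow> T - (scal_op d o\<^sub>L V)"
    by (intro tendsto_diff lim)
  then have "R \<longlonglongrightarrow> T - (scal_op d o\<^sub>L V)" unfolding Xeq by simp
  then have "T - (scal_op d o\<^sub>L V) \<in> residue_compacts l i"
    using closed_residue_compacts R closed_sequentially by blast
  then show "T \<in> compacts_plus_line l i V"
    unfolding compacts_plus_line_def by (metis (mono_tags, lifting) diff_add_cancel mem_Collect_eq)
qed

lemma subspace_compacts_plus_line: "subspace (compacts_plus_line l i V)"
proof (rule subspaceI)
  show "0 \<in> compacts_plus_line l i V"
    unfolding compacts_plus_line_def
    by (rule CollectI, rule exI[of _ 0], rule exI[of _ 0]) (simp add: subspace_0[OF subspace_residue_compacts] scal_op_zero)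
next
  fix S T assume "S \<in> compacts_plus_line l i V" "T \<in> compacts_plus_line l i V"
  then obtain R c R' c' where eq: "S = R + (scal_op c o\<^sub>L V)" "T = R' + (scal_op c' o\<^sub>L V)"
    and R: "R \<in> residue_compacts l i" "R' \<in> residue_compacts l i" unfolding compacts_plus_line_def by blast
  have "S + T = (R + R') + (scal_op (c + c') o\<^sub>L V)"
    unfolding eq scal_op_add op_compose_add by simp
  then show "S + T \<in> compacts_plus_line l i V"
    unfolding compacts_plus_line_def using subspace_add[OF subspace_residue_compacts R] by blast
next
  fix r S assume "S \<in> compacts_plus_line l i V"
  then obtain R c where eq: "S = R + (scal_op c o\<^sub>L V)"
    and R: "R \<in> residue_compacts l i" unfolding compacts_plus_line_def by blast
  have "r *\<^sub>R S = r *\<^sub>R R + (scal_op (of_real r * c) o\<^sub>L V)"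
    unfolding eq scal_op_mult scal_op_of_real op_compose_scaleR op_compose_id by (simp add: scaleR_add_right)
  then show "r *\<^sub>R S \<in> compacts_plus_line l i V"
    unfolding compacts_plus_line_def using subspace_scale[OF subspace_residue_compacts R] by blast
qed



text \<open>The operator \<open>ket k \<mapsto> ket (k - i)\<close>, where kets with negative index are zero.  Thus \<open>shift i\<close> is a coisometry for
  \<open>i \<ge> 0\<close>, an isometry for \<open>i \<le> 0\<close>, and the adjoint of \<open>shift (- i)\<close>.\<close>

definition shift :: "int \<Rightarrow> nat l2 \<Rightarrow>\<^sub>L nat l2" where
  "shift i = (if 0 \<le> i then pullback (\<lambda>k. k + nat i) else weighted_shift (\<lambda>_. 1) (\<lambda>k. k + nat (- i)))"

lemma coord_shift: "coord (shift i x) n = (if - i \<le> int n then coord x (nat (int n + i)) else 0)"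
proof (cases "0 \<le> i")
  case True
  have "inj (\<lambda>k. k + nat i)" by (simp add: inj_def)
  then have "coord (shift i x) n = coord x (n + nat i)" using True by (simp add: shift_def coord_pullback)
  also have "n + nat i = nat (int n + i)" using True by simp
  finally show ?thesis using True by simp
next
  case neg: False
  define f where "f = (\<lambda>k. k + nat (- i))"
  have f: "inj f" by (simp add: inj_def f_def)
  have s: "shift i = weighted_shift (\<lambda>_. 1) f" using neg by (simp add: shift_def f_def)
  show ?thesis
  proof (cases "- i \<le> int n")
    case True
    then have n: "n = f (nat (int n + i))" using neg by (simp add: f_def)
    have "coord (weighted_shift (\<lambda>_. 1) f x) (f (nat (int n + i))) = 1 * coord x (nat (int n + i))"
      by (rule coord_weighted_shift_image(1)[OF f, where C = 1]) simp
    then show ?thesis unfolding n[symmetric] s using True by simp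
  next
    case False
    then have "n \<noteq> f x" for x using neg unfolding f_def by linarith
    then have "n \<notin> range f" by blast
    then have "coord (weighted_shift (\<lambda>_. 1) f x) n = 0"
      by (intro coord_weighted_shift_image(2)[OF f, where C = 1]) auto
    then show ?thesis unfolding s using False by simp
  qed
qed

lemma shift_zero: "shift 0 = id_blinfun"
  by (intro blinfun_eqI l2_eqI) (simp add: coord_shift)

lemma closed_compacts_plus_shift: "closed (compacts_plus_line l i (shift i))"
proof (rule closed_compacts_plus_line[where h = "\<lambda>k. k + nat i" and g = "\<lambda>k. k + nat (- i)"])
  show "filterlim (\<lambda>k. k + nat i) at_top sequentially"
    by (rule filterlim_at_top_mono[OF filterlim_ident]) simp
  show "coord (shift i (ket (k + nat i))) (k + nat (- i)) = 1" for k
    by (auto simp: coord_shift coord_ket)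
qed

section \<open>Homogeneous operators\<close>

definition source_embed :: "nat \<Rightarrow> int \<Rightarrow> int \<Rightarrow> nat l2 \<Rightarrow>\<^sub>L (int \<times> nat) l2" where
  "source_embed l i m = weighted_shift (\<lambda>_. 1) (\<lambda>k. ((int k - i) div int l + m, k))"

definition slice :: "nat \<Rightarrow> int \<Rightarrow> int \<Rightarrow> (int \<times> nat) l2 \<Rightarrow>\<^sub>L nat l2" where
  "slice l i m = pullback (\<lambda>k. ((int k - i) div int l + m, k))"

lemma inj_source: "inj (\<lambda>k :: nat. ((int k - i) div int l + m, k))"
  by (auto simp: inj_def)

lemma coord_source_embed:
  "coord (source_embed l i m x) (r, n) = (if r = (int n - i) div int l + m then coord x n else 0)"
proof (cases "r = (int n - i) div int l + m")
  case True
  then show ?thesis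
    using coord_weighted_shift_image(1)[OF inj_source, where C = 1 and w = "\<lambda>_. 1" and a = n]
    by (simp add: source_embed_def)
next
  case False
  then show ?thesis
    unfolding source_embed_def by (subst coord_weighted_shift_image(2)[OF inj_source, where C = 1]) auto
qed

lemma coord_slice: "coord (slice l i m x) k = coord x ((int k - i) div int l + m, k)"
  unfolding slice_def by (simp add: coord_pullback inj_source)

lemma source_embed_zero: "source_embed l 0 m = block_embed l m"
  by (simp add: source_embed_def block_embed_def zdiv_int)

lemma slice_zero: "slice l 0 m = op_adjoint (block_embed l m)"
  by (simp add: slice_def pullback_def block_embed_def zdiv_int)

text \<open>An operator of degree \<open>i\<close> sends the copy of \<open>nat l2\<close> embedded by \<open>source_embed l i m\<close> to \<open>X\<^sub>m\<close>;
  the degree block is the operator it induces for \<open>m = 0\<close>.\<close>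

definition degree_block :: "nat \<Rightarrow> int \<Rightarrow> ((int \<times> nat) l2 \<Rightarrow>\<^sub>L (int \<times> nat) l2) \<Rightarrow> nat l2 \<Rightarrow>\<^sub>L nat l2" where
  "degree_block l i T = slice l 0 0 o\<^sub>L T o\<^sub>L source_embed l i 0"

definition homogeneous :: "nat \<Rightarrow> int \<Rightarrow> ((int \<times> nat) l2 \<Rightarrow>\<^sub>L (int \<times> nat) l2) set" where
  "homogeneous l i = {T. \<forall>m. slice l 0 m o\<^sub>L T = degree_block l i T o\<^sub>L slice l i m}"

lemma degree_block_zero: "degree_block l 0 = block l 0"
  by (rule ext) (simp add: degree_block_def block_def source_embed_zero slice_zero)

lemma linear_degree_block: "bounded_linear (degree_block l i)"
  unfolding degree_block_def by (rule bounded_linear_compose[OF linear_compose_right linear_compose_left])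

text \<open>Each defining equation is an equation between continuous linear functions of the operator, which is why
  homogeneity passes to norm limits.\<close>

lemma closed_homogeneous: "closed (homogeneous l i)"
  unfolding homogeneous_def Collect_all_eq
  by (intro closed_INT ballI closed_Collect_eq linear_continuous_on linear_compose_left
      bounded_linear_compose[OF linear_compose_right linear_degree_block])

lemma subspace_homogeneous: "subspace (homogeneous l i)"
proof -
  interpret bounded_linear "degree_block l i" by (rule linear_degree_block)
  show ?thesis
    by (rule subspaceI)
      (simp_all only: homogeneous_def mem_Collect_eq op_compose_zero zero add scaleR op_compose_add op_compose_scaleR simp_thms)
qed

text \<open>Parseval: the slices cut \<open>l2\<close> of \<open>int \<times> nat\<close> into orthogonal pieces.\<close>

lemma norm_slices:
  assumes "1 \<le> l"
  shows "(\<lambda>m. (norm (slice l i m x))\<^sup>2) summable_on UNIV"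
    and "(norm x)\<^sup>2 = (\<Sum>\<^sub>\<infinity>m. (norm (slice l i m x))\<^sup>2)"
proof -
  define e where "e = (\<lambda>(m, k :: nat). ((int k - i) div int l + m, k))"
  define f where "f = (\<lambda>m k. (cmod (coord (slice l i m x) k))\<^sup>2)"
  have f: "(\<lambda>(m, k). f m k) = (\<lambda>p. (cmod (coord x (e p)))\<^sup>2)"
    by (auto simp: f_def e_def coord_slice)
  have e: "bij_betw e UNIV UNIV"
    by (rule bij_betw_byWitness[where f' = "\<lambda>(r, k). (r - (int k - i) div int l, k)"]) (auto simp: e_def)
  have s: "(\<lambda>(m, k). f m k) summable_on UNIV \<times> UNIV"
    unfolding f using summable_on_reindex_bij_betw[OF e, of "\<lambda>p. (cmod (coord x p))\<^sup>2"] coord_summable[of x]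
    by (simp only: UNIV_Times_UNIV)
  have n: "(norm (slice l i m x))\<^sup>2 = (\<Sum>\<^sub>\<infinity>k. f m k)" for m
    by (simp only: norm_l2_power2 f_def)
  show "(\<lambda>m. (norm (slice l i m x))\<^sup>2) summable_on UNIV"
    unfolding n by (rule summable_on_Sigma_banach[OF s])
  have "(norm x)\<^sup>2 = (\<Sum>\<^sub>\<infinity>p. (cmod (coord x (e p)))\<^sup>2)"
    unfolding norm_l2_power2 by (rule infsum_reindex_bij_betw[OF e, symmetric])
  also have "\<dots> = (\<Sum>\<^sub>\<infinity>m. \<Sum>\<^sub>\<infinity>k. f m k)"
    using infsum_Sigma'_banach[OF s] by (simp only: UNIV_Times_UNIV f)
  finally show "(norm x)\<^sup>2 = (\<Sum>\<^sub>\<infinity>m. (norm (slice l i m x))\<^sup>2)" unfolding n .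
qed

text \<open>An operator of degree \<open>i\<close> is an orthogonal sum of copies of its degree block.\<close>

lemma norm_le_degree_block:
  assumes l: "1 \<le> l" and T: "T \<in> homogeneous l i"
  shows "norm T \<le> norm (degree_block l i T)"
proof (rule norm_blinfun_bound[OF norm_ge_zero])
  fix x
  let ?R = "degree_block l i T"
  have sl: "slice l 0 m (T x) = ?R (slice l i m x)" for m
  proof -
    have "slice l 0 m o\<^sub>L T = ?R o\<^sub>L slice l i m" using T by (simp add: homogeneous_def)
    then have "(slice l 0 m o\<^sub>L T) x = (?R o\<^sub>L slice l i m) x" by (simp only:)
    then show ?thesis by simp
  qed
  have "(norm (T x))\<^sup>2 = (\<Sum>\<^sub>\<infinity>m. (norm (slice l 0 m (T x)))\<^sup>2)" by (rule norm_slices(2)[OF l])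
  also have "\<dots> \<le> (\<Sum>\<^sub>\<infinity>m. (norm ?R)\<^sup>2 * (norm (slice l i m x))\<^sup>2)"
  proof (rule infsum_mono)
    show "(\<lambda>m. (norm (slice l 0 m (T x)))\<^sup>2) summable_on UNIV" by (rule norm_slices(1)[OF l])
    show "(\<lambda>m. (norm ?R)\<^sup>2 * (norm (slice l i m x))\<^sup>2) summable_on UNIV"
      by (intro summable_on_cmult_right norm_slices(1)[OF l])
    show "(norm (slice l 0 m (T x)))\<^sup>2 \<le> (norm ?R)\<^sup>2 * (norm (slice l i m x))\<^sup>2" for m
      unfolding sl power_mult_distrib[symmetric] by (intro power_mono norm_blinfun norm_ge_zero)
  qed
  also have "\<dots> = (norm ?R * norm x)\<^sup>2"
    unfolding infsum_cmult_right' norm_slices(2)[OF l, of x i, symmetric] power_mult_distrib ..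
  finally show "norm (T x) \<le> norm ?R * norm x"
    by (rule power2_le_imp_le) (intro mult_nonneg_nonneg norm_ge_zero)
qed

text \<open>\<open>T (ket (r, n)) = g (n + a) \<cdot> ket (r + b, n + a)\<close>, with weights indexed by the target so that truncation at
  \<open>n + a < 0\<close> is the only case distinction.\<close>

definition banded :: "((int \<times> nat) l2 \<Rightarrow>\<^sub>L (int \<times> nat) l2) \<Rightarrow> (nat \<Rightarrow> complex) \<Rightarrow> int \<Rightarrow> int \<Rightarrow> bool" where
  "banded T g a b \<longleftrightarrow> (\<forall>x r n. coord (T x) (r, n) =
    (if a \<le> int n then g n * coord x (r - b, nat (int n - a)) else 0))"

lemma bandedD: "banded T g a b \<Longrightarrow> coord (T x) (r, n) =
    (if a \<le> int n then g n * coord x (r - b, nat (int n - a)) else 0)"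
  by (simp add: banded_def)

lemma banded_scal_op: "banded T g a b \<Longrightarrow> banded (scal_op c o\<^sub>L T) (\<lambda>n. c * g n) a b"
  by (simp add: banded_def coord_scal_op)

lemma banded_compose:
  assumes "banded S g a b" "banded T g' a' b'"
  shows "banded (S o\<^sub>L T) (\<lambda>n. if a \<le> int n then g n * g' (nat (int n - a)) else 0) (a + a') (b + b')"
  unfolding banded_def
proof (intro allI)
  fix x r n
  have "nat (int (nat (int n - a)) - a') = nat (int n - (a + a'))" if "a \<le> int n"
    using that by simp
  moreover have "r - b - b' = r - (b + b')" by simp
  ultimately show "coord ((S o\<^sub>L T) x) (r, n) = (if a + a' \<le> int n
      then (if a \<le> int n then g n * g' (nat (int n - a)) else 0) * coord x (r - (b + b'), nat (int n - (a + a'))) else 0)"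
    by (auto simp: bandedD[OF assms(1)] bandedD[OF assms(2)] diff_diff_eq)
qed

text \<open>The first indices of the source kets are chosen such that \<open>(n - a - i) div l = n div l - b\<close> when
  \<open>i = l b - a\<close>; the first coordinate then matches automatically and only the band in the second one is left.\<close>

lemma banded_degree_block:
  assumes l: "1 \<le> l" and T: "banded T g a b" and i: "i = int l * b - a"
  shows "coord (degree_block l i T x) n = (if a \<le> int n then g n * coord x (nat (int n - a)) else 0)"
    and "T \<in> homogeneous l i"
proof -
  have div: "(int (nat (int n - a)) - i) div int l = int n div int l - b" if "a \<le> int n" for n
  proof -
    have "int (nat (int n - a)) - i = int n + int l * (- b)" using that i by simp
    then show ?thesis using l by (simp only: div_mult_self2)
  qed
  show c: "coord (degree_block l i T x) n = (if a \<le> int n then g n * coord x (nat (int n - a)) else 0)" for x n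
  proof (cases "a \<le> int n")
    case True
    show ?thesis
      unfolding degree_block_def blinfun_apply_blinfun_compose coord_slice bandedD[OF T] coord_source_embed div[OF True]
      using True by simp
  qed (simp add: degree_block_def coord_slice bandedD[OF T])
  have "coord (slice l 0 m (T x)) n = coord (degree_block l i T (slice l i m x)) n" for m x n
  proof (cases "a \<le> int n")
    case True
    have e: "(int n - 0) div int l + m - b = int n div int l - b + m" by simp
    show ?thesis
      unfolding c coord_slice bandedD[OF T] div[OF True] e using True by simp
  qed (simp add: c coord_slice bandedD[OF T])
  then show "T \<in> homogeneous l i"
    unfolding homogeneous_def by (auto intro!: blinfun_eqI l2_eqI)
qed

section \<open>Monomials in the generators\<close>

text \<open>The degree \<open>i\<close> component of the coaction picks the words of degree \<open>i\<close> out of any representative, so the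
  homogeneous elements are the classes of linear combinations of such words.\<close>

lemma suq_rep_degree_span:
  assumes q: "0 < q" "q < 1"
  shows "suq_rep q ` suq_degree q l i = span {scal_op c o\<^sub>L rep_word q w | c w. word_deg l w = i}" (is "?L = span ?W")
proof
  show "?L \<subseteq> span ?W"
  proof
    fix T assume "T \<in> ?L"
    then obtain X where X: "X \<in> suq_degree q l i" "T = suq_rep q X" by blast
    obtain t where t: "X = suq_class q t" using X suq_classE by (auto simp: suq_degree_def)
    have "suq_theta q l X i = X" using X by (simp add: suq_degree_def tensor_u_def)
    then have "T = free_rep q (Poly_Mapping.lookup (free_theta l t) i)"
      unfolding X(2) t suq_theta_class by (metis suq_rep_class[OF q])
    also have "\<dots> \<in> span ?W"
    proof (induction t rule: free_suq_induct)
      case (single w c)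
      have "free_rep q (Poly_Mapping.single w c) \<in> span ?W" if "word_deg l w = i"
        using that by (intro span_base) (auto simp: free_rep_single[OF q])
      then show ?case
        by (auto simp: lookup_free_theta_single free_rep_zero[OF q] intro: span_zero)
    next
      case (add s t)
      then show ?case
        by (simp only: lookup_free_theta_add free_rep_add[OF q] span_add)
    qed
    finally show "T \<in> span ?W" .
  qed
next
  define G where "G = {t. \<forall>k. Poly_Mapping.lookup (free_theta l t) k = (if k = i then t else 0)}"
  have "free_rep q ` G \<subseteq> ?L"
  proof
    fix T assume "T \<in> free_rep q ` G"
    then obtain t where t: "t \<in> G" "T = free_rep q t" by blast
    have "suq_theta q l (suq_class q t) k = tensor_u q (suq_class q t) i k" for k
      using t(1) by (auto simp: suq_theta_class G_def tensor_u_def)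
    then have "suq_class q t \<in> suq_degree q l i"
      unfolding suq_degree_def suq_def suq_class_def by (auto intro: quotientI)
    then show "T \<in> ?L" unfolding t(2) suq_rep_class[OF q, symmetric] by (rule imageI)
  qed
  moreover have "span ?W \<subseteq> free_rep q ` G"
  proof (rule span_minimal)
    show "?W \<subseteq> free_rep q ` G"
    proof
      fix T assume "T \<in> ?W"
      then obtain c w where T: "T = scal_op c o\<^sub>L rep_word q w" "word_deg l w = i" by blast
      have "Poly_Mapping.single w c \<in> G" using T(2) by (auto simp: G_def lookup_free_theta_single)
      then show "T \<in> free_rep q ` G" unfolding T(1) free_rep_single[OF q, symmetric] by (rule imageI)
    qed
    have single: "free_rep q (cst (of_real r) * t) = r *\<^sub>R free_rep q t" for r t
      by (simp add: free_rep_mult[OF q] free_rep_cst[OF q] scal_op_of_real op_compose_scaleR op_compose_id)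
    have deg0: "word_deg l 0 = 0" by (simp add: word_deg_def zero_suq_word_def)
    show "subspace (free_rep q ` G)"
    proof (rule subspaceI)
      have "0 \<in> G" by (simp add: G_def lookup_free_theta_zero)
      then show "0 \<in> free_rep q ` G" using free_rep_zero[OF q] by (metis imageI)
    next
      fix S T assume "S \<in> free_rep q ` G" "T \<in> free_rep q ` G"
      then obtain s t where "s \<in> G" "t \<in> G" "S = free_rep q s" "T = free_rep q t" by blast
      moreover from this have "s + t \<in> G" by (auto simp: G_def lookup_free_theta_add)
      ultimately show "S + T \<in> free_rep q ` G" by (metis free_rep_add[OF q] imageI)
    next
      fix r S assume "S \<in> free_rep q ` G"
      then obtain s where s: "s \<in> G" "S = free_rep q s" by blast
      have "cst (of_real r) * s \<in> G"
        using s(1) by (auto simp: G_def cst_def free_theta_left deg0)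
      then show "r *\<^sub>R S \<in> free_rep q ` G" unfolding s(2) single[symmetric] by (rule imageI)
    qed
  qed
  ultimately show "span ?W \<subseteq> ?L" by (rule subset_trans[rotated])
qed

context
  fixes q :: real
  assumes q: "0 < q" "q < 1"
begin

lemma banded_gen:
  "banded (rep_gen q Alpha) (\<lambda>n. of_real (sqrt (1 - q ^ (2 * n)))) 1 0"
  "banded (rep_gen q AlphaStar) (\<lambda>n. of_real (sqrt (1 - q ^ (2 * (n + 1))))) (- 1) 0"
  "banded (rep_gen q Beta) (\<lambda>n. of_real (q ^ n)) 0 1"
  "banded (rep_gen q BetaStar) (\<lambda>n. of_real (q ^ n)) 0 (- 1)"
  unfolding banded_def coord_rep_gen[OF q]
  by (auto simp: nat_diff_distrib nat_add_distrib)

lemma gen_weight_bounds: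
  "cmod (of_real (sqrt (1 - q ^ (2 * n)))) \<le> 1" "0 < n \<Longrightarrow> complex_of_real (sqrt (1 - q ^ (2 * n))) \<noteq> 0"
proof -
  have "0 \<le> q ^ (2 * n)" "q ^ (2 * n) \<le> 1" using q by (simp_all add: power_le_one)
  then show "cmod (of_real (sqrt (1 - q ^ (2 * n)))) \<le> 1" by simp
  assume "0 < n"
  then have "q ^ (2 * n) < 1" using q power_strict_decreasing[of 0 "2 * n" q] by simp
  then show "complex_of_real (sqrt (1 - q ^ (2 * n))) \<noteq> 0" by simp
qed

lemma gen_weight_tendsto: "(\<lambda>n. complex_of_real (sqrt (1 - q ^ (2 * n)))) \<longlonglongrightarrow> 1"
proof -
  have "norm (q\<^sup>2) < 1" using q abs_square_less_1[of q] by simp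
  then have "(\<lambda>n. complex_of_real (sqrt (1 - q ^ (2 * n)))) \<longlonglongrightarrow> complex_of_real (sqrt (1 - 0))"
    unfolding power_mult by (intro tendsto_intros)
  then show ?thesis by simp
qed

lemma rep_word_nil: "banded (rep_word q (Word [])) (\<lambda>_. 1) 0 0"
  using rep_word_zero[OF q] by (simp add: banded_def zero_suq_word_def)

text \<open>The weights of \<open>\<alpha>\<close> and \<open>\<alpha>\<^sup>*\<close> tend to \<open>1\<close>, those of \<open>\<beta>\<close> and \<open>\<beta>\<^sup>*\<close> to \<open>0\<close>, and limits multiply
  along a word.\<close>

lemma rep_word_banded:
  "\<exists>g a b L. word_deg l w = int l * b - a \<and> banded (rep_word q w) g a b \<and> g \<longlonglongrightarrow> L \<and>
    (if set (letters w) \<subseteq> {Alpha, AlphaStar} then b = 0 \<and> L = 1 else L = 0)"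
proof (induction w rule: suq_word_induct[OF q, case_names zero add])
  case zero
  show ?case
    by (rule exI[of _ "\<lambda>_. 1"], rule exI[of _ 0], rule exI[of _ 0], rule exI[of _ 1])
      (simp add: rep_word_nil word_deg_def zero_suq_word_def)
next
  case (add x w)
  then obtain g a b L where IH: "word_deg l w = int l * b - a" "banded (rep_word q w) g a b" "g \<longlonglongrightarrow> L"
    "if set (letters w) \<subseteq> {Alpha, AlphaStar} then b = 0 \<and> L = 1 else L = 0" by blast
  have ex: "\<exists>h c d M. gen_deg l x = int l * d - c \<and> banded (rep_gen q x) h c d \<and> h \<longlonglongrightarrow> M \<and>
    (if x \<in> {Alpha, AlphaStar} then d = 0 \<and> M = 1 else M = 0)"
  proof (cases x)
    case Alpha
    then show ?thesis using banded_gen(1) gen_weight_tendsto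
      by (intro exI[of _ "\<lambda>n. of_real (sqrt (1 - q ^ (2 * n)))"] exI[of _ 1] exI[of _ 0]) (auto simp del: rep_gen.simps)
  next
    case AlphaStar
    then show ?thesis using banded_gen(2) LIMSEQ_Suc[OF gen_weight_tendsto]
      by (intro exI[of _ "\<lambda>n. of_real (sqrt (1 - q ^ (2 * (n + 1))))"] exI[of _ "- 1"] exI[of _ 0] exI[of _ 1])
        (auto simp del: rep_gen.simps)
  next
    case Beta
    have "(\<lambda>n. complex_of_real (q ^ n)) \<longlonglongrightarrow> of_real 0" using q by (intro tendsto_of_real LIMSEQ_power_zero) auto
    then show ?thesis using banded_gen(3) Beta
      by (intro exI[of _ "\<lambda>n. of_real (q ^ n)"] exI[of _ 0] exI[of _ 1]) (auto simp del: rep_gen.simps)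
  next
    case BetaStar
    have "(\<lambda>n. complex_of_real (q ^ n)) \<longlonglongrightarrow> of_real 0" using q by (intro tendsto_of_real LIMSEQ_power_zero) auto
    then show ?thesis using banded_gen(4) BetaStar
      by (intro exI[of _ "\<lambda>n. of_real (q ^ n)"] exI[of _ 0] exI[of _ "- 1"]) (auto simp del: rep_gen.simps)
  qed
  then obtain h c d M where x: "gen_deg l x = int l * d - c" "banded (rep_gen q x) h c d" "h \<longlonglongrightarrow> M"
    "if x \<in> {Alpha, AlphaStar} then d = 0 \<and> M = 1 else M = 0" by blast
  let ?g = "\<lambda>n. if c \<le> int n then h n * g (nat (int n - c)) else 0"
  have "word_deg l (Word [x] + w) = int l * (d + b) - (c + a)"
    unfolding word_deg_add IH(1) by (simp add: word_deg_def x(1) algebra_simps)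
  moreover have "banded (rep_word q (Word [x] + w)) ?g (c + a) (d + b)"
    unfolding rep_word_add[OF q] rep_word_single[OF q] by (rule banded_compose[OF x(2) IH(2)])
  moreover have "?g \<longlonglongrightarrow> M * L"
  proof (rule Lim_transform_eventually)
    have "Z \<le> nat (int n - c)" if "Z + nat c \<le> n" for Z n using that by linarith
    then have "filterlim (\<lambda>n. nat (int n - c)) at_top sequentially"
      unfolding filterlim_at_top eventually_sequentially by blast
    then have "(\<lambda>n. g (nat (int n - c))) \<longlonglongrightarrow> L" by (rule filterlim_compose[OF IH(3)])
    then show "(\<lambda>n. h n * g (nat (int n - c))) \<longlonglongrightarrow> M * L" by (intro tendsto_mult x(3))
    show "\<forall>\<^sub>F n in sequentially. h n * g (nat (int n - c)) = ?g n"
      using eventually_ge_at_top[of "nat c"] by eventually_elim (auto simp: nat_le_iff)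
  qed
  moreover have "set (letters (Word [x] + w)) = insert x (set (letters w))"
    by (simp add: plus_suq_word_def)
  ultimately show ?case using IH(4) x(4)
    by (intro exI[of _ ?g] exI[of _ "c + a"] exI[of _ "d + b"] exI[of _ "M * L"]) (auto split: if_splits)
qed

lemma rep_word_replicate: "rep_word q (Word (replicate (Suc k) x)) = rep_gen q x o\<^sub>L rep_word q (Word (replicate k x))"
  using rep_word_add[OF q, of "Word [x]" "Word (replicate k x)"] by (simp only: plus_suq_word_def suq_word.sel
    append_Cons append_Nil replicate_Suc rep_word_single[OF q])

lemma alpha_power_banded:
  "\<exists>A. (\<forall>n\<ge>k. A n \<noteq> 0 \<and> cmod (A n) \<le> 1) \<and> (\<forall>n<k. A n = 0) \<and>
    banded (rep_word q (Word (replicate k Alpha))) A (int k) 0"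
proof (induction k)
  case 0
  show ?case by (rule exI[of _ "\<lambda>_. 1"]) (use rep_word_nil in simp)
next
  case (Suc k)
  then obtain A where A: "\<And>n. k \<le> n \<Longrightarrow> A n \<noteq> 0 \<and> cmod (A n) \<le> 1" "\<And>n. n < k \<Longrightarrow> A n = 0"
    "banded (rep_word q (Word (replicate k Alpha))) A (int k) 0" by blast
  define B where "B n = (if 1 \<le> int n then of_real (sqrt (1 - q ^ (2 * n))) * A (nat (int n - 1)) else 0)" for n
  have "banded (rep_word q (Word (replicate (Suc k) Alpha))) B (int (Suc k)) 0"
    using banded_compose[OF banded_gen(1) A(3)] unfolding rep_word_replicate B_def by (simp add: add.commute)
  moreover have "B n \<noteq> 0 \<and> cmod (B n) \<le> 1" if n: "Suc k \<le> n" for n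
  proof -
    have "k \<le> nat (int n - 1)" "0 < n" using n by auto
    then show ?thesis using A(1)[of "nat (int n - 1)"] gen_weight_bounds[of n] n
      by (auto simp: B_def norm_mult intro: mult_le_one simp del: norm_of_real of_real_eq_0_iff)
  qed
  moreover have "B n = 0" if "n < Suc k" for n using A(2)[of "nat (int n - 1)"] that by (auto simp: B_def)
  ultimately show ?case by blast
qed

lemma alpha_star_power_banded:
  "\<exists>A. (\<forall>n. A n \<noteq> 0 \<and> cmod (A n) \<le> 1) \<and> banded (rep_word q (Word (replicate k AlphaStar))) A (- int k) 0"
proof (induction k)
  case 0
  show ?case by (rule exI[of _ "\<lambda>_. 1"]) (use rep_word_nil in simp)
next
  case (Suc k)
  then obtain A where A: "\<And>n. A n \<noteq> 0 \<and> cmod (A n) \<le> 1"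
    "banded (rep_word q (Word (replicate k AlphaStar))) A (- int k) 0" by blast
  define B where "B n = (if - 1 \<le> int n then of_real (sqrt (1 - q ^ (2 * (n + 1)))) * A (nat (int n - - 1)) else 0)" for n
  have "banded (rep_word q (Word (replicate (Suc k) AlphaStar))) B (- int (Suc k)) 0"
    using banded_compose[OF banded_gen(2) A(2)] unfolding rep_word_replicate B_def by simp
  moreover have "B n \<noteq> 0 \<and> cmod (B n) \<le> 1" for n
    using A(1)[of "nat (int n - - 1)"] gen_weight_bounds[of "n + 1"]
    by (auto simp: B_def norm_mult intro: mult_le_one simp del: norm_of_real of_real_eq_0_iff)
  ultimately show ?case by blast
qed

lemma beta_power_banded:
  "banded (rep_word q (Word (replicate k Beta))) (\<lambda>n. of_real (q ^ n) ^ k) 0 (int k)"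
  "banded (rep_word q (Word (replicate k BetaStar))) (\<lambda>n. of_real (q ^ n) ^ k) 0 (- int k)"
proof (induction k)
  case 0
  show "banded (rep_word q (Word (replicate 0 Beta))) (\<lambda>n. of_real (q ^ n) ^ 0) 0 (int 0)"
    "banded (rep_word q (Word (replicate 0 BetaStar))) (\<lambda>n. of_real (q ^ n) ^ 0) 0 (- int 0)"
    using rep_word_nil by simp_all
next
  case (Suc k)
  show "banded (rep_word q (Word (replicate (Suc k) Beta))) (\<lambda>n. of_real (q ^ n) ^ Suc k) 0 (int (Suc k))"
    using banded_compose[OF banded_gen(3) Suc.IH(1)] unfolding rep_word_replicate by (simp add: mult.commute add.commute)
  show "banded (rep_word q (Word (replicate (Suc k) BetaStar))) (\<lambda>n. of_real (q ^ n) ^ Suc k) 0 (- int (Suc k))"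
    using banded_compose[OF banded_gen(4) Suc.IH(2)] unfolding rep_word_replicate by (simp add: mult.commute add.commute)
qed

end



context
  fixes q :: real and l :: nat
  assumes q: "0 < q" "q < 1" and l: "1 \<le> l"
begin

section \<open>The completed homogeneous parts\<close>

text \<open>A monomial without \<open>\<beta>\<close> and \<open>\<beta>\<^sup>*\<close> agrees with the shift up to weights that tend to zero, and every other
  monomial is compact.\<close>

lemma monomial_degree_block:
  assumes "word_deg l w = i"
  shows "scal_op c o\<^sub>L rep_word q w \<in> homogeneous l i"
    and "degree_block l i (scal_op c o\<^sub>L rep_word q w) -
      (scal_op (if set (letters w) \<subseteq> {Alpha, AlphaStar} then c else 0) o\<^sub>L shift i) \<in> residue_compacts l i"
proof -
  obtain g a b L where i: "i = int l * b - a" and T: "banded (rep_word q w) g a b" and g: "g \<longlonglongrightarrow> L"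
    and L: "if set (letters w) \<subseteq> {Alpha, AlphaStar} then b = 0 \<and> L = 1 else L = 0"
    using rep_word_banded[OF q, of l w] assms by blast
  note cT = banded_scal_op[OF T, of c]
  show "scal_op c o\<^sub>L rep_word q w \<in> homogeneous l i"
    by (rule banded_degree_block(2)[OF l cT i])
  note coord = banded_degree_block(1)[OF l cT i]
  have a: "int l dvd a + i" using i by simp
  show "degree_block l i (scal_op c o\<^sub>L rep_word q w) -
      (scal_op (if set (letters w) \<subseteq> {Alpha, AlphaStar} then c else 0) o\<^sub>L shift i) \<in> residue_compacts l i"
  proof (cases "set (letters w) \<subseteq> {Alpha, AlphaStar}")
    case True
    then have mi: "- i = a" "int n + i = int n - a" and "L = 1" for n using L i by auto
    have "(\<lambda>n. c * (g n - 1)) \<longlonglongrightarrow> c * (L - 1)" by (intro tendsto_intros g)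
    then show ?thesis
      using True \<open>L = 1\<close>
      by (intro vanishing_band_residue_compacts[where g = "\<lambda>n. c * (g n - 1)" and a = a] a)
        (auto simp: blinfun.diff_left coord_minus coord coord_scal_op coord_shift mi left_diff_distrib right_diff_distrib)
  next
    case False
    then have "L = 0" using L by auto
    have "(\<lambda>n. c * g n) \<longlonglongrightarrow> c * L" by (intro tendsto_intros g)
    then show ?thesis
      using False \<open>L = 0\<close>
      by (intro vanishing_band_residue_compacts[where g = "\<lambda>n. c * g n" and a = a] a)
        (auto simp: coord scal_op_zero)
  qed
qed

lemma degree_closure_span:
  "suq_degree_closure q l i = closure (span {scal_op c o\<^sub>L rep_word q w | c w. word_deg l w = i})"
  unfolding suq_degree_closure_def suq_rep_degree_span[OF q] ..

lemma subspace_degree_closure: "subspace (suq_degree_closure q l i)"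
  unfolding degree_closure_span by (intro subspace_closure subspace_span)

lemma monomial_degree_closure: "word_deg l w = i \<Longrightarrow> scal_op c o\<^sub>L rep_word q w \<in> suq_degree_closure q l i"
  unfolding degree_closure_span by (intro subsetD[OF closure_subset] span_base) blast

lemma degree_closure_minimal:
  assumes "closed S" "subspace S" "\<And>c w. word_deg l w = i \<Longrightarrow> scal_op c o\<^sub>L rep_word q w \<in> S"
  shows "suq_degree_closure q l i \<subseteq> S"
  unfolding degree_closure_span using assms by (intro closure_minimal span_minimal) auto

lemma degree_closure_homogeneous: "suq_degree_closure q l i \<subseteq> homogeneous l i"
  by (rule degree_closure_minimal[OF closed_homogeneous subspace_homogeneous monomial_degree_block(1)])

text \<open>The degree block is isometric and the completed homogeneous part is complete.\<close>

lemma closed_degree_block_image: "closed (degree_block l i ` suq_degree_closure q l i)"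
proof -
  have "closed (suq_degree_closure q l i)" unfolding degree_closure_span by simp
  then have "complete (suq_degree_closure q l i)" by (simp add: complete_eq_closed)
  then have "complete (degree_block l i ` suq_degree_closure q l i)"
    using norm_le_degree_block[OF l] degree_closure_homogeneous
    by (intro complete_isometric_image[where e = 1] subspace_degree_closure linear_degree_block) auto
  then show ?thesis by (simp add: complete_eq_closed)
qed

lemma subspace_degree_block_image: "subspace (degree_block l i ` suq_degree_closure q l i)"
  by (rule linear_subspace_image[OF bounded_linear.linear[OF linear_degree_block] subspace_degree_closure])

text \<open>\<open>(\<alpha>\<^sup>*)\<^sup>k\<close> moves \<open>ket (r, k)\<close> to a multiple of \<open>ket (r, 0)\<close>, on which \<open>(\<beta>\<beta>\<^sup>*)\<^sup>m\<close> is the identity while it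
  contracts the other kets by a factor of at most \<open>q ^ (2 * m)\<close>; then a power of \<open>\<beta>\<close> or \<open>\<beta>\<^sup>*\<close> adjusts the degree
  without further weights on \<open>ket (r, 0)\<close>, and \<open>\<alpha> ^ k'\<close> moves to the required row.\<close>

lemma matrix_unit_degree_block_image:
  assumes dvd: "int l dvd int k' - int k + i"
  shows "matrix_unit c k' k \<in> degree_block l i ` suq_degree_closure q l i"
proof -
  obtain b where b: "int k' - int k + i = int l * b" using dvd by (elim dvdE)
  obtain A where A: "\<And>n. k' \<le> n \<Longrightarrow> A n \<noteq> 0 \<and> cmod (A n) \<le> 1" "\<And>n. n < k' \<Longrightarrow> A n = 0"
    "banded (rep_word q (Word (replicate k' Alpha))) A (int k') 0"
    using alpha_power_banded[OF q, of k'] by blast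
  obtain A' where A': "\<And>n. A' n \<noteq> 0 \<and> cmod (A' n) \<le> 1"
    "banded (rep_word q (Word (replicate k AlphaStar))) A' (- int k) 0"
    using alpha_star_power_banded[OF q, of k] by blast
  \<comment> \<open>normalises the entry at \<open>(k', k)\<close>, where the powers of \<open>\<beta>\<close> and \<open>\<beta>\<^sup>*\<close> have weight \<open>1\<close>\<close>
  define d where "d = c / (A k' * A' 0)"
  \<comment> \<open>\<open>x - y = b\<close> gives the degree, and \<open>x + y \<ge> 2 m\<close> gives the decay\<close>
  define x where "x m = m + nat b" for m
  define y where "y m = m + nat (- b)" for m
  define w where "w m = Word (replicate k' Alpha) + (Word (replicate (x m) Beta) +
    (Word (replicate (y m) BetaStar) + Word (replicate k AlphaStar)))" for m
  have xy: "int (x m) - int (y m) = b" for m by (simp add: x_def y_def)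
  have deg: "word_deg l (w m) = i" for m
  proof -
    have "word_deg l (w m) = - int k' + int (x m) * int l - int (y m) * int l + int k"
      by (simp add: w_def word_deg_add) (simp add: word_deg_def sum_list_replicate)
    also have "\<dots> = - int k' + (int (x m) - int (y m)) * int l + int k" by (simp add: algebra_simps)
    also have "\<dots> = i" unfolding xy using b by (simp add: algebra_simps)
    finally show ?thesis .
  qed
  define T where "T m = degree_block l i (scal_op d o\<^sub>L rep_word q (w m))" for m
  define u where "u m n = d * (A n * (of_real (q ^ (n - k')) ^ (x m + y m) * A' (n - k')))" for m n
  have T: "coord (T m z) n = (if k' \<le> n then u m n * coord z (n - k' + k) else 0)" for m z n
  proof -
    note banded_compose[OF A(3) banded_compose[OF beta_power_banded(1)[OF q, of "x m"]
        banded_compose[OF beta_power_banded(2)[OF q, of "y m"] A'(2)]]]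
    then have bw: "banded (rep_word q (w m)) (\<lambda>n. if int k' \<le> int n then A n *
        (of_real (q ^ (n - k')) ^ x m * (of_real (q ^ (n - k')) ^ y m * A' (n - k'))) else 0)
        (int k' - int k) b"
      unfolding w_def rep_word_add[OF q] by (simp add: nat_diff_distrib xy cong: if_cong)
    have "i = int l * b - (int k' - int k)" using b by simp
    from banded_degree_block(1)[OF l banded_scal_op[OF bw, of d] this, of z n]
    have "coord (T m z) n = (if int k' - int k \<le> int n then d * (if k' \<le> n then A n *
        (of_real (q ^ (n - k')) ^ x m * (of_real (q ^ (n - k')) ^ y m * A' (n - k'))) else 0) *
        coord z (nat (int n - (int k' - int k))) else 0)"
      unfolding T_def by simp
    also have "\<dots> = (if k' \<le> n then u m n * coord z (n - k' + k) else 0)"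
    proof (cases "k' \<le> n")
      case True
      then have "nat (int n - (int k' - int k)) = n - k' + k" "int k' - int k \<le> int n" by auto
      then show ?thesis using True by (simp only: if_True u_def power_add mult.assoc)
    qed simp
    finally show ?thesis .
  qed
  have u0: "u m k' = c" for m
    using A(1)[of k'] A'(1)[of 0] by (simp add: u_def d_def)
  have u: "cmod (u m n) \<le> cmod d * q ^ m" if n: "k' < n" for m n
  proof -
    have "cmod (u m n) = cmod d * (cmod (A n) * ((q ^ (n - k')) ^ (x m + y m) * cmod (A' (n - k'))))"
      using q by (simp add: u_def norm_mult norm_power)
    also have "\<dots> \<le> cmod d * (1 * ((q ^ (n - k')) ^ (x m + y m) * 1))"
      using A(1)[of n] A'(1)[of "n - k'"] n q
      by (intro mult_left_mono mult_mono) (auto intro!: mult_nonneg_nonneg)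
    also have "(q ^ (n - k')) ^ (x m + y m) = q ^ ((n - k') * (x m + y m))" by (rule power_mult[symmetric])
    also have "\<dots> \<le> q ^ m"
    proof (rule power_decreasing)
      have "1 * m \<le> (n - k') * (x m + y m)" using n by (intro mult_le_mono) (auto simp: x_def)
      then show "m \<le> (n - k') * (x m + y m)" by simp
    qed (use q in auto)
    finally show ?thesis by (simp add: mult_left_mono)
  qed
  have "norm (T m - matrix_unit c k' k) \<le> cmod d * q ^ m" for m
  proof (rule norm_op_leI[where S = "{k'<..}" and h = "\<lambda>n. n - k' + k"])
    fix z n
    have "coord ((T m - matrix_unit c k' k) z) n = (if k' < n then u m n * coord z (n - k' + k) else 0)"
      using u0 by (auto simp: blinfun.diff_left coord_minus coord_matrix_unit T)
    then show "n \<in> {k'<..} \<Longrightarrow> cmod (coord ((T m - matrix_unit c k' k) z) n) \<le> cmod d * q ^ m * cmod (coord z (n - k' + k))"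
      "n \<notin> {k'<..} \<Longrightarrow> coord ((T m - matrix_unit c k' k) z) n = 0"
      using u[of n m] by (auto simp: norm_mult intro!: mult_right_mono)
  qed (use q in \<open>auto simp: inj_on_def\<close>)
  then have bound: "\<forall>\<^sub>F m in sequentially. norm (T m - matrix_unit c k' k) \<le> cmod d * q ^ m"
    by (intro always_eventually allI)
  have "(\<lambda>m. q ^ m) \<longlonglongrightarrow> 0" using q by (intro LIMSEQ_power_zero) simp
  then have "(\<lambda>m. cmod d * q ^ m) \<longlonglongrightarrow> 0" by (rule tendsto_mult_right_zero)
  then have "(\<lambda>m. T m - matrix_unit c k' k) \<longlonglongrightarrow> 0" by (rule Lim_null_comparison[OF bound])
  then have "T \<longlonglongrightarrow> matrix_unit c k' k" by (rule LIM_zero_cancel)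
  moreover have "T m \<in> degree_block l i ` suq_degree_closure q l i" for m
    unfolding T_def by (intro imageI monomial_degree_closure deg)
  ultimately show ?thesis using closed_sequentially[OF closed_degree_block_image] by blast
qed

lemma degree_block_image:
  "degree_block l i ` suq_degree_closure q l i = compacts_plus_line l i (shift i)"
proof
  interpret D: bounded_linear "degree_block l i" by (rule linear_degree_block)
  have "suq_degree_closure q l i \<subseteq> degree_block l i -` compacts_plus_line l i (shift i)"
  proof (rule degree_closure_minimal)
    show "closed (degree_block l i -` compacts_plus_line l i (shift i))"
      by (rule continuous_closed_vimage[OF closed_compacts_plus_shift D.isCont[OF continuous_ident]])
    show "subspace (degree_block l i -` compacts_plus_line l i (shift i))"
      by (rule linear_subspace_vimage[OF D.linear_axioms subspace_compacts_plus_line])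
    fix c w assume "word_deg l w = i"
    from monomial_degree_block(2)[OF this, of c]
    show "scal_op c o\<^sub>L rep_word q w \<in> degree_block l i -` compacts_plus_line l i (shift i)"
      unfolding compacts_plus_line_def vimage_def mem_Collect_eq by (metis diff_add_cancel)
  qed
  then show "degree_block l i ` suq_degree_closure q l i \<subseteq> compacts_plus_line l i (shift i)" by blast
next
  let ?I = "degree_block l i ` suq_degree_closure q l i"
  have K: "residue_compacts l i \<subseteq> ?I"
    by (rule residue_compacts_minimal[OF closed_degree_block_image subspace_degree_block_image matrix_unit_degree_block_image])
  have V: "scal_op c o\<^sub>L shift i \<in> ?I" for c
  proof -
    \<comment> \<open>a power of \<open>\<alpha>\<^sup>*\<close> or \<open>\<alpha>\<close> of degree \<open>i\<close>; its block differs from the shift by a compact operator\<close>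
    define w where "w = Word (if 0 \<le> i then replicate (nat i) AlphaStar else replicate (nat (- i)) Alpha)"
    have w: "word_deg l w = i" "set (letters w) \<subseteq> {Alpha, AlphaStar}"
      by (auto simp: w_def word_deg_def sum_list_replicate)
    let ?T = "scal_op c o\<^sub>L rep_word q w"
    have diff: "degree_block l i ?T - (scal_op c o\<^sub>L shift i) \<in> ?I"
      using monomial_degree_block(2)[OF w(1), of c] w(2) K by auto
    have "degree_block l i ?T \<in> ?I" by (intro imageI monomial_degree_closure w(1))
    from subspace_diff[OF subspace_degree_block_image this diff]
    show ?thesis by (simp only: diff_diff_eq2 add_diff_cancel_left')
  qed
  show "compacts_plus_line l i (shift i) \<subseteq> ?I"
    unfolding compacts_plus_line_def using K V subspace_add[OF subspace_degree_block_image] by blast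
qed

lemma inj_on_degree_block: "inj_on (degree_block l i) (suq_degree_closure q l i)"
proof (rule inj_onI)
  fix S T assume ST: "S \<in> suq_degree_closure q l i" "T \<in> suq_degree_closure q l i"
    and eq: "degree_block l i S = degree_block l i T"
  interpret D: bounded_linear "degree_block l i" by (rule linear_degree_block)
  have "S - T \<in> homogeneous l i"
    using subspace_diff[OF subspace_degree_closure ST] degree_closure_homogeneous by blast
  from norm_le_degree_block[OF l this] show "S = T" by (simp add: D.diff eq)
qed

text \<open>The degree zero operator \<open>b\<close> acts on \<open>X\<^sub>0\<close>, the target of the copy that defines the degree block, by its own
  block.\<close>

lemma degree_block_compose:
  assumes "b \<in> suq_degree_closure q l 0"
  shows "degree_block l i (b o\<^sub>L T) = block l 0 b o\<^sub>L degree_block l i T"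
proof -
  have "slice l 0 0 o\<^sub>L b = degree_block l 0 b o\<^sub>L slice l 0 0"
    using assms degree_closure_homogeneous[of 0] unfolding homogeneous_def by blast
  then have "(slice l 0 0 o\<^sub>L b) o\<^sub>L (T o\<^sub>L source_embed l i 0) =
      (degree_block l 0 b o\<^sub>L slice l 0 0) o\<^sub>L (T o\<^sub>L source_embed l i 0)" by (simp only:)
  then show ?thesis
    unfolding degree_block_zero[symmetric] by (simp only: degree_block_def op_compose_assoc)
qed

lemma CWP_eq: "CWP q l = compact_sum_unitization l"
proof -
  have "CWP q l = closure (degree_block l 0 ` suq_rep q ` suq_degree q l 0)"
    by (simp add: CWP_def degree_block_zero image_image)
  also have "\<dots> = degree_block l 0 ` suq_degree_closure q l 0"
  proof
    show "closure (degree_block l 0 ` suq_rep q ` suq_degree q l 0) \<subseteq> degree_block l 0 ` suq_degree_closure q l 0"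
      unfolding suq_degree_closure_def
      by (rule closure_minimal[OF image_mono[OF closure_subset] closed_degree_block_image[unfolded suq_degree_closure_def]])
    show "degree_block l 0 ` suq_degree_closure q l 0 \<subseteq> closure (degree_block l 0 ` suq_rep q ` suq_degree q l 0)"
      unfolding suq_degree_closure_def
      by (rule image_closure_subset[OF linear_continuous_on[OF linear_degree_block] closed_closure closure_subset])
  qed
  also have "\<dots> = compact_sum_unitization l"
    unfolding degree_block_image shift_zero compact_sum_unitization_eq[OF l] ..
  finally show ?thesis .
qed

text \<open>Right multiplications commute with the left action, so every bijection built from them is a module
  isomorphism.\<close>

lemma module_isomorphicI:
  assumes bij: "bij_betw (\<lambda>R t. R o\<^sub>L F t) (compacts_plus_line l i (shift i)) P"
  shows "module_isomorphic q l (suq_degree_closure q l i) P"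
  unfolding module_isomorphic_def
proof (intro exI[of _ "\<lambda>T t. degree_block l i T o\<^sub>L F t"] conjI ballI)
  interpret D: bounded_linear "degree_block l i" by (rule linear_degree_block)
  have "bij_betw (degree_block l i) (suq_degree_closure q l i) (compacts_plus_line l i (shift i))"
    unfolding bij_betw_def by (intro conjI inj_on_degree_block degree_block_image)
  from bij_betw_trans[OF this bij]
  show "bij_betw (\<lambda>T t. degree_block l i T o\<^sub>L F t) (suq_degree_closure q l i) P"
    by (simp add: comp_def)
  show "(\<lambda>t. degree_block l i (S + T) o\<^sub>L F t) = (\<lambda>t. (degree_block l i S o\<^sub>L F t) + (degree_block l i T o\<^sub>L F t))" for S T
    by (simp only: D.add op_compose_add)
  show "(\<lambda>t. degree_block l i (b o\<^sub>L T) o\<^sub>L F t) = (\<lambda>t. block l 0 b o\<^sub>L (degree_block l i T o\<^sub>L F t))"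
    if "b \<in> suq_degree_closure q l 0" for b T
    by (simp only: degree_block_compose[OF that] op_compose_assoc)
qed

end

section \<open>The projections\<close>

lemma shift_compose:
  assumes "0 \<le> i"
  shows "shift i o\<^sub>L shift (- i) = id_blinfun"
    and "coord ((shift (- i) o\<^sub>L shift i) x) n = (if i \<le> int n then coord x n else 0)"
  using assms by (auto intro!: blinfun_eqI l2_eqI simp: coord_shift)

lemma residue_compacts_shift: "T \<in> residue_compacts l i \<Longrightarrow> T o\<^sub>L shift d \<in> residue_compacts l (i + d)"
proof (rule residue_compacts_compose_coord)
  fix b
  show "(\<exists>b'. int l dvd int b' - int b - d \<and> (\<forall>x. coord (shift d x) b = coord x b')) \<or>
      (\<forall>x. coord (shift d x) b = 0)"
  proof (cases "- d \<le> int b")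
    case True
    then have "int l dvd int (nat (int b + d)) - int b - d" by simp
    then show ?thesis
      using True by (intro disjI1 exI[of _ "nat (int b + d)"]) (simp add: coord_shift)
  qed (simp add: coord_shift)
qed

text \<open>\<open>(R + c V) S = R S + c (V S)\<close>: the compact part and the single operator \<open>V\<close> can be treated separately.\<close>

lemma compacts_plus_line_compose:
  assumes T: "T \<in> compacts_plus_line l i V"
    and K: "\<And>R. R \<in> residue_compacts l i \<Longrightarrow> R o\<^sub>L S \<in> residue_compacts l i'"
    and V: "V o\<^sub>L S \<in> compacts_plus_line l i' V'"
  shows "T o\<^sub>L S \<in> compacts_plus_line l i' V'"
proof -
  obtain R c where R: "R \<in> residue_compacts l i" "T = R + (scal_op c o\<^sub>L V)"
    using T by (auto simp: compacts_plus_line_def)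
  obtain R' c' where R': "R' \<in> residue_compacts l i'" "V o\<^sub>L S = R' + (scal_op c' o\<^sub>L V')"
    using V by (auto simp: compacts_plus_line_def)
  have "scal_op c o\<^sub>L R' \<in> residue_compacts l i'"
  proof (rule residue_compacts_map[OF linear_compose_left _ R'(1)])
    fix d a b assume ab: "int l dvd int a - int b + i'"
    have "scal_op c o\<^sub>L matrix_unit d a b = matrix_unit (c * d) a b"
      by (intro blinfun_eqI l2_eqI) (simp add: coord_scal_op coord_matrix_unit)
    then show "scal_op c o\<^sub>L matrix_unit d a b \<in> residue_compacts l i'"
      using ab by (simp add: matrix_unit_residue_compacts)
  qed
  then have "(R o\<^sub>L S) + (scal_op c o\<^sub>L R') \<in> residue_compacts l i'"
    by (intro subspace_add subspace_residue_compacts K R(1))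
  moreover have "T o\<^sub>L S = ((R o\<^sub>L S) + (scal_op c o\<^sub>L R')) + (scal_op (c * c') o\<^sub>L V')"
    unfolding R(2) op_compose_add op_compose_assoc R'(2) scal_op_mult by (simp add: add.assoc)
  ultimately show ?thesis unfolding compacts_plus_line_def by blast
qed

lemma residue_compacts_subset_line: "residue_compacts l i \<subseteq> compacts_plus_line l i V"
proof
  fix R assume "R \<in> residue_compacts l i"
  moreover have "R = R + (scal_op 0 o\<^sub>L V)" by (simp add: scal_op_zero)
  ultimately show "R \<in> compacts_plus_line l i V" unfolding compacts_plus_line_def by blast
qed

lemma line_in_compacts_plus_line: "V \<in> compacts_plus_line l i V"
  unfolding compacts_plus_line_def
  by (rule CollectI, rule exI[of _ 0], rule exI[of _ 1])
    (simp add: scal_op_one op_compose_id subspace_0[OF subspace_residue_compacts])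

lemma coord_direct_sum_rank_proj:
  assumes "1 \<le> l"
  shows "coord (direct_sum l (\<lambda>s. rank_proj (\<rho> s)) x) k = (if k div l < \<rho> (k mod l + 1) then coord x k else 0)"
  by (simp add: coord_direct_sum[OF assms] coord_rank_proj coord_copy_embed_adjoint[OF assms])

lemma direct_sum_rank_proj_residue_compacts:
  assumes "1 \<le> l"
  shows "direct_sum l (\<lambda>s. rank_proj (\<rho> s)) \<in> residue_compacts l 0"
proof (rule vanishing_band_residue_compacts[where a = 0 and g = "\<lambda>k. if k div l < \<rho> (k mod l + 1) then 1 else 0"])
  \<comment> \<open>the sum of all ranks bounds each of them, so the projection vanishes on kets from \<open>N\<close> on\<close>
  define N where "N = l * (\<Sum>s\<le>l. \<rho> s)"
  have "\<not> k div l < \<rho> (k mod l + 1)" if "N \<le> k" for k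
  proof -
    have "k mod l + 1 \<le> l" using assms by (simp add: Suc_leI)
    then have "\<rho> (k mod l + 1) \<le> (\<Sum>s\<le>l. \<rho> s)" by (intro member_le_sum) auto
    also have "\<dots> \<le> k div l"
      using that assms unfolding N_def by (metis div_le_mono nonzero_mult_div_cancel_left not_one_le_zero)
    finally show ?thesis by simp
  qed
  then show "(\<lambda>k. if k div l < \<rho> (k mod l + 1) then 1 else 0 :: complex) \<longlonglongrightarrow> 0"
    by (intro tendsto_eventually eventually_sequentiallyI[of N]) auto
qed (simp_all add: coord_direct_sum_rank_proj[OF assms])

lemma proj_module_single:
  "proj_module A 1 (diag_matrix [p]) = {(\<lambda>t :: nat. if t = 0 then v o\<^sub>L p else 0) | v. v \<in> A}"
proof -
  have eq: "(\<lambda>j. if j < 1 then \<Sum>i<1. v i o\<^sub>L diag_matrix [p] i j else 0) = (\<lambda>t. if t = 0 then v 0 o\<^sub>L p else 0)"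
    for v :: "nat \<Rightarrow> nat l2 \<Rightarrow>\<^sub>L nat l2"
    by (rule ext) (simp add: diag_matrix_def)
  have all: "(\<forall>i<1. v i \<in> A) \<longleftrightarrow> v 0 \<in> A" for v :: "nat \<Rightarrow> nat l2 \<Rightarrow>\<^sub>L nat l2"
    by auto
  show ?thesis
    unfolding proj_module_def eq all
  proof (intro set_eqI iffI; clarify)
    fix v assume "v \<in> A"
    then show "\<exists>u :: nat \<Rightarrow> _. (\<lambda>t :: nat. if t = 0 then v o\<^sub>L p else 0) = (\<lambda>t. if t = 0 then u 0 o\<^sub>L p else 0) \<and> u 0 \<in> A"
      by (intro exI[of _ "\<lambda>_. v"]) simp
  qed blast
qed

lemma proj_module_free_plus:
  "proj_module A 2 (diag_matrix [id_blinfun, p]) =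
    {(\<lambda>t :: nat. if t = 0 then v else if t = 1 then w o\<^sub>L p else 0) | v w. v \<in> A \<and> w \<in> A}"
proof -
  have eq: "(\<lambda>j. if j < 2 then \<Sum>i<2. v i o\<^sub>L diag_matrix [id_blinfun, p] i j else 0) =
      (\<lambda>t. if t = 0 then v 0 else if t = 1 then v 1 o\<^sub>L p else 0)"
    for v :: "nat \<Rightarrow> nat l2 \<Rightarrow>\<^sub>L nat l2"
    by (rule ext) (simp add: diag_matrix_def numeral_2_eq_2 op_compose_id)
  have all: "(\<forall>i<2. v i \<in> A) \<longleftrightarrow> v 0 \<in> A \<and> v 1 \<in> A" for v :: "nat \<Rightarrow> nat l2 \<Rightarrow>\<^sub>L nat l2"
    by (auto simp: numeral_2_eq_2 less_Suc_eq)
  show ?thesis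
    unfolding proj_module_def eq all
  proof (intro set_eqI iffI; clarify)
    fix v w assume vw: "v \<in> A" "w \<in> A"
    show "\<exists>u :: nat \<Rightarrow> _. (\<lambda>t :: nat. if t = 0 then v else if t = 1 then w o\<^sub>L p else 0) =
        (\<lambda>t. if t = 0 then u 0 else if t = 1 then u 1 o\<^sub>L p else 0) \<and> u 0 \<in> A \<and> u 1 \<in> A"
      by (rule exI[of _ "\<lambda>t. if t = 0 then v else w"]) (simp add: vw)
  qed blast
qed

text \<open>For \<open>i \<le> 0\<close> the operator \<open>V = shift i\<close> is an isometry with \<open>V V\<^sup>* = 1 - Q\<close>.  Therefore \<open>R \<mapsto> R V\<^sup>*\<close> has
  the inverse \<open>v \<mapsto> v V\<close>, and its values satisfy \<open>R V\<^sup>* = R V\<^sup>* (1 - Q)\<close>.\<close>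

lemma negative_degree_module:
  assumes i: "i \<le> 0" and Q: "\<And>x k. coord (blinfun_apply Q x) k = (if int k < - i then coord x k else 0)"
    and Qc: "Q \<in> residue_compacts l 0"
  shows "bij_betw (\<lambda>R t. R o\<^sub>L (if t = 0 then shift (- i) else 0)) (compacts_plus_line l i (shift i))
    (proj_module (compacts_plus_line l 0 id_blinfun) 1 (diag_matrix [id_blinfun - Q]))"
proof -
  have iso: "shift (- i) o\<^sub>L shift i = id_blinfun"
    using shift_compose(1)[of "- i"] i by simp
  have rng: "shift i o\<^sub>L shift (- i) = id_blinfun - Q"
    using shift_compose(2)[of "- i"] i
    by (intro blinfun_eqI l2_eqI) (auto simp: blinfun.diff_left coord_minus Q)
  have into: "R o\<^sub>L shift (- i) \<in> compacts_plus_line l 0 id_blinfun" if "R \<in> compacts_plus_line l i (shift i)" for R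
  proof (rule compacts_plus_line_compose[OF that])
    show "R o\<^sub>L shift (- i) \<in> residue_compacts l 0" if "R \<in> residue_compacts l i" for R
      using residue_compacts_shift[OF that, of "- i"] by simp
    have "- Q \<in> compacts_plus_line l 0 id_blinfun"
      using subspace_neg[OF subspace_residue_compacts Qc] residue_compacts_subset_line by blast
    from subspace_add[OF subspace_compacts_plus_line line_in_compacts_plus_line this]
    show "shift i o\<^sub>L shift (- i) \<in> compacts_plus_line l 0 id_blinfun" unfolding rng by simp
  qed
  have onto: "v o\<^sub>L shift i \<in> compacts_plus_line l i (shift i)" if "v \<in> compacts_plus_line l 0 id_blinfun" for v
  proof (rule compacts_plus_line_compose[OF that])
    show "R o\<^sub>L shift i \<in> residue_compacts l i" if "R \<in> residue_compacts l 0" for R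
      using residue_compacts_shift[OF that, of i] by simp
    show "id_blinfun o\<^sub>L shift i \<in> compacts_plus_line l i (shift i)"
      unfolding op_compose_id by (rule line_in_compacts_plus_line)
  qed
  have absorb: "shift (- i) o\<^sub>L (id_blinfun - Q) = shift (- i)" "(id_blinfun - Q) o\<^sub>L shift i = shift i"
    unfolding rng[symmetric] op_compose_assoc iso op_compose_id
    unfolding op_compose_assoc[symmetric] iso op_compose_id by (rule refl)+
  show ?thesis
  proof (rule bij_betw_byWitness[where f' = "\<lambda>y. y 0 o\<^sub>L shift i"])
    show "\<forall>R\<in>compacts_plus_line l i (shift i). (R o\<^sub>L (if (0::nat) = 0 then shift (- i) else 0)) o\<^sub>L shift i = R"
      by (simp add: op_compose_assoc iso op_compose_id)
    show "\<forall>y\<in>proj_module (compacts_plus_line l 0 id_blinfun) 1 (diag_matrix [id_blinfun - Q]).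
        (\<lambda>t. y 0 o\<^sub>L shift i o\<^sub>L (if t = 0 then shift (- i) else 0)) = y"
    proof
      fix y assume "y \<in> proj_module (compacts_plus_line l 0 id_blinfun) 1 (diag_matrix [id_blinfun - Q])"
      then obtain v where y: "y = (\<lambda>t. if t = 0 then v o\<^sub>L (id_blinfun - Q) else 0)"
        unfolding proj_module_single by blast
      have "((v o\<^sub>L (id_blinfun - Q)) o\<^sub>L shift i) o\<^sub>L shift (- i) = v o\<^sub>L (id_blinfun - Q)"
        by (simp only: op_compose_assoc absorb rng)
      then show "(\<lambda>t. y 0 o\<^sub>L shift i o\<^sub>L (if t = 0 then shift (- i) else 0)) = y"
        by (intro ext) (simp add: y)
    qed
    show "(\<lambda>R t. R o\<^sub>L (if t = 0 then shift (- i) else 0)) ` compacts_plus_line l i (shift i)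
        \<subseteq> proj_module (compacts_plus_line l 0 id_blinfun) 1 (diag_matrix [id_blinfun - Q])"
    proof (rule image_subsetI)
      fix R assume R: "R \<in> compacts_plus_line l i (shift i)"
      have "(\<lambda>t. R o\<^sub>L (if t = 0 then shift (- i) else 0)) =
          (\<lambda>t :: nat. if t = 0 then (R o\<^sub>L shift (- i)) o\<^sub>L (id_blinfun - Q) else 0)"
        by (rule ext) (simp add: op_compose_assoc absorb)
      then show "(\<lambda>t. R o\<^sub>L (if t = 0 then shift (- i) else 0))
          \<in> proj_module (compacts_plus_line l 0 id_blinfun) 1 (diag_matrix [id_blinfun - Q])"
        unfolding proj_module_single using into[OF R] by blast
    qed
    show "(\<lambda>y. y 0 o\<^sub>L shift i) ` proj_module (compacts_plus_line l 0 id_blinfun) 1 (diag_matrix [id_blinfun - Q])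
        \<subseteq> compacts_plus_line l i (shift i)"
      unfolding proj_module_single by (auto simp: op_compose_assoc absorb onto)
  qed
qed

text \<open>For \<open>i \<ge> 0\<close> the operator \<open>V = shift i\<close> is a coisometry with \<open>1 - V\<^sup>* V = U Q U'\<close>, where \<open>U\<close> carries
  operators that shift residues by \<open>- i\<close> to operators that preserve them.  The maps
  \<open>R \<mapsto> (R V\<^sup>*, R U Q)\<close> and \<open>(v, w) \<mapsto> v V + w U'\<close> are inverse to each other because
  \<open>V U Q = 0\<close> and \<open>Q U' V\<^sup>* = 0\<close>.  The scalar part of \<open>w Q\<close> stays in the module because \<open>Q\<close> is compact.\<close>

lemma positive_degree_module:
  assumes i: "0 \<le> i" and U: "U' o\<^sub>L U = id_blinfun"
    and Q: "Q o\<^sub>L Q = Q"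
    and kernel: "\<And>x k. coord (blinfun_apply (U o\<^sub>L Q o\<^sub>L U') x) k = (if int k < i then coord x k else 0)"
    and Qc: "Q \<in> residue_compacts l 0"
    and Ul: "\<And>R. R \<in> residue_compacts l i \<Longrightarrow> R o\<^sub>L U \<in> residue_compacts l 0"
    and Ul': "\<And>R. R \<in> residue_compacts l 0 \<Longrightarrow> R o\<^sub>L U' \<in> residue_compacts l i"
    and Ql: "\<And>R. R \<in> residue_compacts l 0 \<Longrightarrow> R o\<^sub>L Q \<in> residue_compacts l 0"
  shows "bij_betw (\<lambda>R t. R o\<^sub>L (if t = 0 then shift (- i) else if t = 1 then U o\<^sub>L Q else 0))
    (compacts_plus_line l i (shift i))
    (proj_module (compacts_plus_line l 0 id_blinfun) 2 (diag_matrix [id_blinfun, Q]))"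
proof -
  let ?N = "compacts_plus_line l i (shift i)" and ?A = "compacts_plus_line l 0 id_blinfun"
  have coiso: "shift i o\<^sub>L shift (- i) = id_blinfun"
    by (rule shift_compose(1)[OF i])
  have UQU: "Q o\<^sub>L U' o\<^sub>L U o\<^sub>L Q = Q"
    by (simp only: op_compose_assoc U Q op_compose_id)
  have split: "(shift (- i) o\<^sub>L shift i) + (U o\<^sub>L Q o\<^sub>L U') = id_blinfun"
  proof (intro blinfun_eqI l2_eqI)
    fix x n
    show "coord (((shift (- i) o\<^sub>L shift i) + (U o\<^sub>L Q o\<^sub>L U')) x) n = coord (id_blinfun x) n"
      unfolding blinfun.add_left coord_add shift_compose(2)[OF i] kernel by simp
  qed
  have "shift i o\<^sub>L (U o\<^sub>L Q o\<^sub>L U') = 0"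
    using i by (intro blinfun_eqI l2_eqI)
      (simp only: blinfun_apply_blinfun_compose[of "shift i"] coord_shift kernel, simp)
  then have "(shift i o\<^sub>L (U o\<^sub>L Q o\<^sub>L U')) o\<^sub>L (U o\<^sub>L Q) = 0" by simp
  then have VU: "shift i o\<^sub>L (U o\<^sub>L Q) = 0"
    using UQU by (simp only: op_compose_assoc)
  have "(U o\<^sub>L Q o\<^sub>L U') o\<^sub>L shift (- i) = 0"
    using i by (intro blinfun_eqI l2_eqI)
      (simp only: blinfun_apply_blinfun_compose[of _ "shift (- i)"] coord_shift kernel, simp)
  then have "Q o\<^sub>L U' o\<^sub>L ((U o\<^sub>L Q o\<^sub>L U') o\<^sub>L shift (- i)) = 0" by simp
  then have QS: "Q o\<^sub>L (U' o\<^sub>L shift (- i)) = 0"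
    using UQU by (metis op_compose_assoc)
  have into0: "R o\<^sub>L shift (- i) \<in> ?A" if "R \<in> ?N" for R
  proof (rule compacts_plus_line_compose[OF that])
    show "R o\<^sub>L shift (- i) \<in> residue_compacts l 0" if "R \<in> residue_compacts l i" for R
      using residue_compacts_shift[OF that, of "- i"] by simp
  qed (simp only: coiso line_in_compacts_plus_line)
  have into1: "R o\<^sub>L (U o\<^sub>L Q) \<in> ?A" if "R \<in> ?N" for R
  proof (rule compacts_plus_line_compose[OF that])
    show "R o\<^sub>L (U o\<^sub>L Q) \<in> residue_compacts l 0" if "R \<in> residue_compacts l i" for R
      unfolding op_compose_assoc[symmetric] by (intro Ql Ul that)
  qed (simp only: VU subspace_0[OF subspace_compacts_plus_line])
  have back0: "v o\<^sub>L shift i \<in> ?N" if "v \<in> ?A" for v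
  proof (rule compacts_plus_line_compose[OF that])
    show "R o\<^sub>L shift i \<in> residue_compacts l i" if "R \<in> residue_compacts l 0" for R
      using residue_compacts_shift[OF that, of i] by simp
  qed (simp only: op_compose_id line_in_compacts_plus_line)
  have back1: "w o\<^sub>L (Q o\<^sub>L U') \<in> ?N" if "w \<in> ?A" for w
  proof (rule compacts_plus_line_compose[OF that])
    show "R o\<^sub>L (Q o\<^sub>L U') \<in> residue_compacts l i" if "R \<in> residue_compacts l 0" for R
      unfolding op_compose_assoc[symmetric] by (intro Ul' Ql that)
    show "id_blinfun o\<^sub>L (Q o\<^sub>L U') \<in> ?N"
      unfolding op_compose_id by (rule subsetD[OF residue_compacts_subset_line Ul'[OF Qc]])
  qed
  show ?thesis
  proof (rule bij_betw_byWitness[where f' = "\<lambda>y. (y 0 o\<^sub>L shift i) + (y 1 o\<^sub>L U')"])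
    show "\<forall>R\<in>?N. ((R o\<^sub>L (if (0::nat) = 0 then shift (- i) else if (0::nat) = 1 then U o\<^sub>L Q else 0)) o\<^sub>L shift i) +
        ((R o\<^sub>L (if (1::nat) = 0 then shift (- i) else if (1::nat) = 1 then U o\<^sub>L Q else 0)) o\<^sub>L U') = R"
    proof
      fix R
      have "R o\<^sub>L ((shift (- i) o\<^sub>L shift i) + (U o\<^sub>L Q o\<^sub>L U')) = R" unfolding split op_compose_id ..
      then show "((R o\<^sub>L (if (0::nat) = 0 then shift (- i) else if (0::nat) = 1 then U o\<^sub>L Q else 0)) o\<^sub>L shift i) +
        ((R o\<^sub>L (if (1::nat) = 0 then shift (- i) else if (1::nat) = 1 then U o\<^sub>L Q else 0)) o\<^sub>L U') = R"
        by (simp add: op_compose_add op_compose_assoc)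
    qed
    show "\<forall>y\<in>proj_module ?A 2 (diag_matrix [id_blinfun, Q]).
        (\<lambda>t. ((y 0 o\<^sub>L shift i) + (y 1 o\<^sub>L U')) o\<^sub>L (if t = 0 then shift (- i) else if t = 1 then U o\<^sub>L Q else 0)) = y"
    proof
      fix y assume "y \<in> proj_module ?A 2 (diag_matrix [id_blinfun, Q])"
      then obtain v w where y: "y = (\<lambda>t. if t = 0 then v else if t = 1 then w o\<^sub>L Q else 0)"
        unfolding proj_module_free_plus by blast
      have y01: "y 0 = v" "y 1 = w o\<^sub>L Q" by (simp_all add: y)
      have "((v o\<^sub>L shift i) + ((w o\<^sub>L Q) o\<^sub>L U')) o\<^sub>L shift (- i) = v"
        by (simp only: op_compose_add op_compose_assoc coiso QS op_compose_id op_compose_zero add_0_right)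
      moreover have "((v o\<^sub>L shift i) + ((w o\<^sub>L Q) o\<^sub>L U')) o\<^sub>L (U o\<^sub>L Q) = w o\<^sub>L Q"
        using UQU by (simp only: op_compose_add op_compose_assoc VU op_compose_zero add_0_left)
      ultimately show "(\<lambda>t. ((y 0 o\<^sub>L shift i) + (y 1 o\<^sub>L U')) o\<^sub>L (if t = 0 then shift (- i) else if t = 1 then U o\<^sub>L Q else 0)) = y"
        unfolding y01 by (intro ext) (simp add: y)
    qed
    show "(\<lambda>R t. R o\<^sub>L (if t = 0 then shift (- i) else if t = 1 then U o\<^sub>L Q else 0)) ` ?N
        \<subseteq> proj_module ?A 2 (diag_matrix [id_blinfun, Q])"
    proof (rule image_subsetI)
      fix R assume R: "R \<in> ?N"
      have "(\<lambda>t. R o\<^sub>L (if t = 0 then shift (- i) else if t = 1 then U o\<^sub>L Q else 0)) =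
          (\<lambda>t :: nat. if t = 0 then R o\<^sub>L shift (- i) else if t = 1 then (R o\<^sub>L (U o\<^sub>L Q)) o\<^sub>L Q else 0)"
        by (rule ext) (simp add: op_compose_assoc Q)
      then show "(\<lambda>t. R o\<^sub>L (if t = 0 then shift (- i) else if t = 1 then U o\<^sub>L Q else 0))
          \<in> proj_module ?A 2 (diag_matrix [id_blinfun, Q])"
        unfolding proj_module_free_plus using into0[OF R] into1[OF R] by blast
    qed
    show "(\<lambda>y. (y 0 o\<^sub>L shift i) + (y 1 o\<^sub>L U')) ` proj_module ?A 2 (diag_matrix [id_blinfun, Q]) \<subseteq> ?N"
    proof (rule image_subsetI)
      fix y assume "y \<in> proj_module ?A 2 (diag_matrix [id_blinfun, Q])"
      then obtain v w where y: "y = (\<lambda>t. if t = 0 then v else if t = 1 then w o\<^sub>L Q else 0)"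
        and vw: "v \<in> ?A" "w \<in> ?A"
        unfolding proj_module_free_plus by blast
      have "(v o\<^sub>L shift i) + (w o\<^sub>L (Q o\<^sub>L U')) \<in> ?N"
        by (intro subspace_add subspace_compacts_plus_line back0 back1 vw)
      then show "(y 0 o\<^sub>L shift i) + (y 1 o\<^sub>L U') \<in> ?N" by (simp add: y op_compose_assoc)
    qed
  qed
qed

text \<open>The rotation by \<open>j\<close> inside every interval from \<open>l p\<close> to \<open>l p + l - 1\<close>: it adds \<open>j\<close> to residues modulo \<open>l\<close> and
  keeps quotients, so it moves the copies of \<open>l\<^sup>2(\<nat>)\<close> without changing the index within a copy.\<close>

definition rotate_index :: "nat \<Rightarrow> nat \<Rightarrow> nat \<Rightarrow> nat" where
  "rotate_index l j k = l * (k div l) + (k mod l + j) mod l"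

lemma rotate_index_div_mod:
  assumes "1 \<le> l"
  shows "rotate_index l j k div l = k div l" "rotate_index l j k mod l = (k mod l + j) mod l"
  using assms by (simp_all add: rotate_index_def)

lemma rotate_index_inverse:
  assumes "1 \<le> l" "j + j' = l"
  shows "rotate_index l j' (rotate_index l j k) = k"
proof -
  have "((k mod l + j) mod l + j') mod l = (k mod l + (j + j')) mod l"
    by (simp only: mod_add_left_eq add.assoc)
  also have "\<dots> = k mod l" unfolding assms(2) by simp
  finally show ?thesis
    unfolding rotate_index_def[of l j'] rotate_index_div_mod[OF assms(1)] by simp
qed

text \<open>This is the count of the numbers below \<open>n l + r\<close> by residue class: \<open>n + 1\<close> in the first \<open>r\<close> classes, \<open>n\<close> in
  the others.\<close>

lemma less_block_index_iff:
  fixes l :: nat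
  assumes "1 \<le> l" "r \<le> l"
  shows "k < n * l + r \<longleftrightarrow> k div l < (if k mod l < r then n + 1 else n)"
proof -
  define p m where "p = k div l" and "m = k mod l"
  have k: "k = p * l + m" and m: "m < l" using assms(1) by (simp_all add: p_def m_def)
  show ?thesis
  proof (cases "p < n")
    case True
    then have "(p + 1) * l \<le> n * l" by (intro mult_le_mono1) simp
    then have "k < n * l + r" using k m by simp
    then show ?thesis using True by (simp flip: p_def m_def)
  next
    case False
    then show ?thesis
    proof (cases "p = n")
      case True
      have "k < n * l + r \<longleftrightarrow> m < r" unfolding k True by simp
      then show ?thesis using True by (simp flip: p_def m_def)
    next
      case ne: False
      then have "(n + 1) * l \<le> p * l" using False by (intro mult_le_mono1) simp
      then have "\<not> k < n * l + r" using k assms(2) by simp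
      then show ?thesis using ne False by (simp flip: p_def m_def)
    qed
  qed
qed

text \<open>The rotation sends the last \<open>j\<close> residues \<open>l - j, \<dots>, l - 1\<close> to the first \<open>j\<close>, which have \<open>n + 1\<close>
  numbers below \<open>n l + j\<close>.  This is why the larger rank sits on the copies \<open>s > l - j\<close>, although the kernel of the
  shift has it on the copies \<open>s \<le> j\<close>.\<close>

lemma rotate_index_less_iff:
  assumes "1 \<le> l" "j \<in> {1..l - 1}"
  shows "rotate_index l j k < n * l + j \<longleftrightarrow> k div l < (if k mod l + 1 \<le> l - j then n else n + 1)"
proof -
  define m where "m = k mod l"
  have m: "m < l" using assms(1) by (simp add: m_def)
  have "(m + j) mod l < j \<longleftrightarrow> \<not> m + 1 \<le> l - j"
  proof (cases "m + 1 \<le> l - j")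
    case True
    then have "(m + j) mod l = m + j" using assms by (intro mod_less) auto
    then show ?thesis using True by simp
  next
    case False
    then have "m + j = l + (m + j - l)" "m + j - l < j" "j < l" using m assms by auto
    then have "(m + j) mod l = m + j - l" by (metis mod_add_self1 mod_less order_less_trans)
    then show ?thesis using False \<open>m + j - l < j\<close> by simp
  qed
  moreover have "j \<le> l" using assms(2) by auto
  ultimately show ?thesis
    unfolding less_block_index_iff[OF assms(1) \<open>j \<le> l\<close>] rotate_index_div_mod[OF assms(1)] m_def by auto
qed

lemma residue_compacts_rotate:
  assumes l: "1 \<le> l" and j: "j + j' = l" and d: "int l dvd i + int j - i'"
    and R: "R \<in> residue_compacts l i"
  shows "R o\<^sub>L pullback (rotate_index l j) \<in> residue_compacts l i'"
proof -
  have inj: "inj (rotate_index l j)"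
    by (rule inj_on_inverseI[of _ "rotate_index l j'"]) (rule rotate_index_inverse[OF l j])
  have dvd: "int l dvd int (rotate_index l j b) - int b - int j" for b
  proof -
    have "rotate_index l j b mod l = (b + j) mod l"
      by (simp add: rotate_index_div_mod[OF l] mod_add_left_eq)
    then have "int (rotate_index l j b) mod int l = int (b + j) mod int l"
      by (simp only: of_nat_mod[symmetric])
    then show ?thesis unfolding mod_eq_dvd_iff by (simp add: diff_diff_eq)
  qed
  have "R o\<^sub>L pullback (rotate_index l j) \<in> residue_compacts l (i + int j)"
    by (rule residue_compacts_compose_coord[OF disjI1 R]) (use dvd in \<open>auto simp: coord_pullback[OF inj]\<close>)
  then show ?thesis using residue_compacts_mod[OF d] by simp
qed

theorem theorem1:
  fixes q :: real and l j :: nat and n :: int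
  assumes "0 < q" and "q < 1" and "1 \<le> l" and "j \<in> {1..l - 1}"
  shows "CWP q l = compact_sum_unitization l \<and>
    module_isomorphic q l (suq_degree_closure q l (n * int l + int j))
      (if 0 \<le> n
       then proj_module (compact_sum_unitization l) 2
         (diag_matrix [id_blinfun,
            direct_sum l (\<lambda>s. if s \<le> l - j then rank_proj (nat n) else rank_proj (nat (n + 1)))])
       else proj_module (compact_sum_unitization l) 1
         (diag_matrix [id_blinfun -
            direct_sum l (\<lambda>s. if s \<le> l - j then rank_proj (nat \<bar>n\<bar>) else rank_proj (nat \<bar>n + 1\<bar>))]))"
proof (cases "0 \<le> n")
  case True
  note ql = assms(1-3)
  define i where "i = n * int l + int j"
  define \<rho> where "\<rho> = (\<lambda>s. if s \<le> l - j then nat n else nat (n + 1))"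
  define Q where "Q = direct_sum l (\<lambda>s. rank_proj (\<rho> s))"
  have i: "0 \<le> i" "int (nat n * l + j) = i" using True by (simp_all add: i_def)
  have Q_eq: "direct_sum l (\<lambda>s. if s \<le> l - j then rank_proj (nat n) else rank_proj (nat (n + 1))) = Q"
    unfolding Q_def \<rho>_def by (rule arg_cong[of _ _ "direct_sum l"]) auto
  have cQ: "coord (Q x) k = (if k div l < \<rho> (k mod l + 1) then coord x k else 0)" for x k
    unfolding Q_def by (rule coord_direct_sum_rank_proj[OF assms(3)])
  define U where "U = pullback (rotate_index l (l - j))"
  define U' where "U' = pullback (rotate_index l j)"
  have jl: "l - j + j = l" "j + (l - j) = l" using assms(4) by auto
  have inv: "rotate_index l j (rotate_index l (l - j) k) = k" "rotate_index l (l - j) (rotate_index l j k) = k" for k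
    by (intro rotate_index_inverse assms(3) jl)+
  have inj: "inj (rotate_index l j)" "inj (rotate_index l (l - j))"
    by (rule inj_on_inverseI, rule inv)+
  have cU: "coord (U x) k = coord x (rotate_index l (l - j) k)" "coord (U' x) k = coord x (rotate_index l j k)" for x k
    by (simp_all add: U_def U'_def coord_pullback inj)
  have less: "k div l < \<rho> (k mod l + 1) \<longleftrightarrow> int (rotate_index l j k) < i" for k
    using rotate_index_less_iff[OF assms(3,4), of k "nat n"] True
    unfolding \<rho>_def i(2)[symmetric] of_nat_less_iff by (simp add: nat_add_distrib)
  have "bij_betw (\<lambda>R t. R o\<^sub>L (if t = 0 then shift (- i) else if t = 1 then U o\<^sub>L Q else 0))
    (compacts_plus_line l i (shift i))
    (proj_module (compacts_plus_line l 0 id_blinfun) 2 (diag_matrix [id_blinfun, Q]))"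
  proof (rule positive_degree_module[OF i(1)])
    show "U' o\<^sub>L U = id_blinfun" by (intro blinfun_eqI l2_eqI) (simp add: cU inv)
    show "Q o\<^sub>L Q = Q" by (intro blinfun_eqI l2_eqI) (simp add: cQ)
    show "coord ((U o\<^sub>L Q o\<^sub>L U') x) k = (if int k < i then coord x k else 0)" for x k
      by (simp only: blinfun_apply_blinfun_compose cU cQ less inv)
    show "Q \<in> residue_compacts l 0" unfolding Q_def by (rule direct_sum_rank_proj_residue_compacts[OF assms(3)])
    show "R o\<^sub>L U \<in> residue_compacts l 0" if "R \<in> residue_compacts l i" for R
    proof -
      have "i + int (l - j) - 0 = (n + 1) * int l" using jl(1) unfolding i_def
        by (simp add: algebra_simps flip: of_nat_add)
      then show ?thesis unfolding U_def by (intro residue_compacts_rotate[OF assms(3) jl(1) _ that]) simp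
    qed
    show "R o\<^sub>L U' \<in> residue_compacts l i" if "R \<in> residue_compacts l 0" for R
      unfolding U'_def by (rule residue_compacts_rotate[OF assms(3) jl(2) _ that]) (simp add: i_def)
    show "R o\<^sub>L Q \<in> residue_compacts l 0" if "R \<in> residue_compacts l 0" for R
    proof -
      have "R o\<^sub>L Q \<in> residue_compacts l (0 + 0)"
      proof (rule residue_compacts_compose_coord[OF _ that])
        fix b
        show "(\<exists>b'. int l dvd int b' - int b - 0 \<and> (\<forall>x. coord (Q x) b = coord x b')) \<or> (\<forall>x. coord (Q x) b = 0)"
          by (cases "b div l < \<rho> (b mod l + 1)") (auto simp: cQ intro: exI[of _ b])
      qed
      then show ?thesis by simp
    qed
  qed
  from module_isomorphicI[OF ql this]
  show ?thesis
    using True CWP_eq[OF ql] unfolding Q_eq compact_sum_unitization_eq[OF assms(3)] i_def by simp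
next
  case False
  note ql = assms(1-3)
  define i where "i = n * int l + int j"
  define \<rho> where "\<rho> = (\<lambda>s. if s \<le> l - j then nat \<bar>n\<bar> else nat \<bar>n + 1\<bar>)"
  define Q where "Q = direct_sum l (\<lambda>s. rank_proj (\<rho> s))"
  \<comment> \<open>\<open>\<bar>n\<bar> = N + 1\<close> and \<open>- i = N l + (l - j)\<close>, so the first \<open>l - j\<close> copies have the larger rank\<close>
  define N where "N = nat \<bar>n + 1\<bar>"
  have nN: "n = - int N - 1" using False by (simp add: N_def)
  have jl: "l - (l - j) = j" "l - j \<in> {1..l - 1}" using assms(4) by auto
  have Q_eq: "direct_sum l (\<lambda>s. if s \<le> l - j then rank_proj (nat \<bar>n\<bar>) else rank_proj (nat \<bar>n + 1\<bar>)) = Q"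
    unfolding Q_def \<rho>_def by (rule arg_cong[of _ _ "direct_sum l"]) auto
  have "k div l < \<rho> (k mod l + 1) \<longleftrightarrow> int k < - i" for k
  proof -
    have "- i = int (N * l + (l - j))" using assms(4) unfolding i_def nN by (auto simp: algebra_simps of_nat_diff)
    then have "int k < - i \<longleftrightarrow> k < N * l + (l - j)" by (simp only: of_nat_less_iff)
    also have "\<dots> \<longleftrightarrow> k div l < (if k mod l < l - j then N + 1 else N)"
      by (rule less_block_index_iff[OF assms(3)]) simp
    finally show ?thesis unfolding \<rho>_def nN by (simp add: Suc_le_eq nat_add_distrib)
  qed
  then have cQ: "coord (Q x) k = (if int k < - i then coord x k else 0)" for x k
    unfolding Q_def by (simp add: coord_direct_sum_rank_proj[OF assms(3)])
  have i: "i \<le> 0"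
  proof -
    have "int j \<le> int l + int N * int l" using assms(4) by (intro add_increasing2) auto
    then show ?thesis unfolding i_def nN by (simp add: algebra_simps)
  qed
  have "bij_betw (\<lambda>R t. R o\<^sub>L (if t = 0 then shift (- i) else 0)) (compacts_plus_line l i (shift i))
    (proj_module (compacts_plus_line l 0 id_blinfun) 1 (diag_matrix [id_blinfun - Q]))"
    by (rule negative_degree_module[OF i cQ])
      (unfold Q_def, rule direct_sum_rank_proj_residue_compacts[OF assms(3)])
  from module_isomorphicI[OF ql this]
  show ?thesis
    using False CWP_eq[OF ql] unfolding Q_eq compact_sum_unitization_eq[OF assms(3)] i_def by simp
qed

end
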